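(* Let $X=X_\Delta$ be a smooth compact toric variety of dimension $n$ associated with a fan $\Delta$ in $N_{\mathbb R}$. Then: (1) For all $0\le k\le n$, $$H^0(X,\wedge^k T_X)=\bigoplus_{I\in S_k(\Delta)}V_I^k(\Delta),$$ where $V_I^k(\Delta)=V_{-I}^k$ for all $I\in S_k(\Delta)$ (here $V_{-I}^k$ is the weight space of $H^0(X,\wedge^kT_X)$ for the character $-I$). (2) For all $0\le k\le n$, $$\dim H^0(X,\wedge^kT_X)=\sum_{0\le i\le k}\ \sum_{F_j\in P_\Delta(n-i)}\binom{n-i}{k-i}\cdot\#(\mathrm{int}(F_j)\cap M).$$
   Context: Toric notation. $T=(\mathbb C^* )^n$, $N=\mathrm{Hom}(\mathbb C^*,T)\cong\mathbb Z^n$, $M=\mathrm{Hom}(T,\mathbb C^* )\cong\mathrm{Hom}_{\mathbb Z}(N,\mathbb Z)$, with pairing $\langle\cdot,\cdot\rangle$; $N_{\mathbb R}=N\otimes\mathbb R$, $M_{\mathbb R}=M\otimes\mathbb R$, $N_{\mathbb C}=N\otimes\mathbb C\cong\mathrm{Lie}(T)$. For $m\in M$, $\chi^m$ is the corresponding character, viewed also as a rational function on $X\supset T$. $T_X$ is the holomorphic tangent bundle. $T$ acts on $H^0(X,\wedge^kT_X)$ by push-forward $v\mapsto t_*v$, and for $I\in M$, $V_I^k=\{v\in H^0(X,\wedge^kT_X): t_*v=\chi^I(t)v\ \text{for all } t\in T\}$. The map $\rho:\wedge^kN_{\mathbb C}\to H^0(X,\wedge^kT_X)$ is induced by the infinitesimal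 action $N_{\mathbb C}\cong\mathrm{Lie}(T)\to H^0(X,T_X)$; it is injective. Set $W^k=\rho(\wedge^kN_{\mathbb C})$, $W^0=\mathbb C$. Polytope and lattice sets. Let $\Delta(1)=\{\alpha_1,\dots,\alpha_r\}$ be the one-dimensional cones of $\Delta$, $e(\alpha_t)\in N$ the primitive generator of $\alpha_t$. Put $P_\Delta=\{I\in M_{\mathbb R}:\langle I,e(\alpha_t)\rangle\ge -1\ \text{for all } t\}$ (a compact polytope), $S_\Delta=P_\Delta\cap M$. $P_\Delta(i)$ is the set of $i$-dimensional faces of $P_\Delta$ (with $P_\Delta$ itself the $n$-dimensional face), $\mathrm{int}(F)$ is the relative interior of a face $F$. $S(\Delta,i)=\bigcup_{F_j\in P_\Delta(n-i)}(\mathrm{int}(F_j)\cap M)$ and $S_k(\Delta)=\bigcup_{0\le i\le k}S(\Delta,i)$. For $I\in S_\Delta$, $|I_\Delta|$ is the unique $i$ with $I\in S(\Delta,i)$. The spaces $V_I^k(\Delta)$. For $I\in S_\Delta$ let $E_I(\Delta)=\{e(\alpha_t):\langle I,e(\alpha_t)\rangle=-1\}$ and let $F_I^\perp(\Delta)\subseteq N_{\mathbb R}$ be its real span (zero if $E_I(\Delta)=\emptyset$); it has dimension $i=|I_\Delta|$. Choose a basis $e(\alpha_{s_1}),\dots,e(\alpha_{s_i})$ of $F_I^\perp(\Delta)$ from $E_I(\Delta)$ and put $\mathcal E_I(\Delta)=e(\alpha_{s_1})\wedge\cdots\wedge e(\alpha_{s_i})\in\wedge^iN$ (well defined up to a nonzero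 scalar; equal to $1$ if $i=0$). Let $N_I^k(\Delta)=\mathbb C\cdot\mathcal E_I(\Delta)\wedge(\wedge^{k-|I_\Delta|}N_{\mathbb C})$ if $|I_\Delta|\le k$, and $N_I^k(\Delta)=0$ if $|I_\Delta|>k$. Let $W_I^k(\Delta)=\rho(N_I^k(\Delta))\subseteq W^k$ and $V_I^k(\Delta)=\chi^I\cdot W_I^k(\Delta)=\{\chi^I\cdot w: w\in W_I^k(\Delta)\}$, a priori a space of meromorphic $k$-vector fields on $X$; an element whose restriction to $T$ extends holomorphically to $X$ is identified with that holomorphic $k$-vector field. *)

theory Defs
  imports "HOL-Analysis.Analysis" "HOL-Library.Function_Algebras" "HOL-Combinatorics.Permutations"
begin

(* Conventions.  N = M = Z^n is rendered as int ^ 'n and N_R = M_R = R^n as real ^ 'n, with the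
   standard pairing; n = CARD('n).  N_C = C^n is complex ^ 'n. *)

type_synonym 'n lat = "int ^ 'n"
type_synonym 'n cone = "(real ^ 'n) set"
type_synonym 'n point = "'n lat \<Rightarrow> complex"

(* All complex vector spaces below are spaces of complex-valued functions. *)

definition cscale :: "complex \<Rightarrow> ('a \<Rightarrow> complex) \<Rightarrow> ('a \<Rightarrow> complex)" where
  "cscale c f = (\<lambda>a. c * f a)"

global_interpretation cfun: vector_space "cscale :: complex \<Rightarrow> ('a \<Rightarrow> complex) \<Rightarrow> ('a \<Rightarrow> complex)"
  by unfold_locales (auto simp: cscale_def fun_eq_iff algebra_simps)

definition internal_direct_sum ::
  "('a \<Rightarrow> complex) set \<Rightarrow> 'i set \<Rightarrow> ('i \<Rightarrow> ('a \<Rightarrow> complex) set) \<Rightarrow> bool" where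
  "internal_direct_sum H A V \<longleftrightarrow>
     (\<forall>i\<in>A. cfun.subspace (V i)) \<and>
     H = cfun.span (\<Union>i\<in>A. V i) \<and>
     (\<forall>B f. finite B \<and> B \<subseteq> A \<and> (\<forall>i\<in>B. f i \<in> V i) \<and> (\<Sum>i\<in>B. f i) = 0 \<longrightarrow> (\<forall>i\<in>B. f i = 0))"

definition rvec :: "'n::finite lat \<Rightarrow> real ^ 'n" where
  "rvec u = (\<chi> i. real_of_int (u $ i))"

definition lpair :: "'n::finite lat \<Rightarrow> 'n lat \<Rightarrow> int" where
  "lpair m u = (\<Sum>i\<in>UNIV. m $ i * u $ i)"

definition cpair :: "complex ^ 'n \<Rightarrow> 'n::finite lat \<Rightarrow> complex" where
  "cpair u m = (\<Sum>i\<in>UNIV. of_int (m $ i) * u $ i)"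

definition cvec :: "'n::finite lat \<Rightarrow> complex ^ 'n" where
  "cvec u = (\<chi> i. of_int (u $ i))"


subsection \<open>Exterior powers\<close>

(* For a space V of functions on a set S, the exterior power of degree k of V embeds into the
   functions on S^k (lists of length k) by
   D_0 /\ ... /\ D_(k-1)  |->  ((m_0,...,m_(k-1)) |-> det (D_i(m_j))). *)

definition wedge :: "('m \<Rightarrow> complex) list \<Rightarrow> 'm list \<Rightarrow> complex" where
  "wedge Ds ms =
     (if length ms = length Ds
      then \<Sum>p | p permutes {..<length Ds}.
             of_int (sign p) * (\<Prod>i<length Ds. (Ds ! i) (ms ! p i))
      else 0)"

definition ext_power :: "nat \<Rightarrow> ('m \<Rightarrow> complex) set \<Rightarrow> ('m list \<Rightarrow> complex) set" where
  "ext_power k V = cfun.span {wedge Ds | Ds. length Ds = k \<and> set Ds \<subseteq> V}"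


subsection \<open>Fans\<close>

definition rational_polyhedral_cone :: "'n::finite cone \<Rightarrow> bool" where
  "rational_polyhedral_cone \<sigma> \<longleftrightarrow>
     (\<exists>A :: 'n lat set. finite A \<and> \<sigma> = convex_cone hull (rvec ` A))"

definition strongly_convex :: "'n::finite cone \<Rightarrow> bool" where
  "strongly_convex \<sigma> \<longleftrightarrow> \<sigma> \<inter> uminus ` \<sigma> = {0}"

(* The library relation face_of also admits the empty face, which is not a cone. *)

definition fan :: "'n::finite cone set \<Rightarrow> bool" where
  "fan \<Delta> \<longleftrightarrow>
     finite \<Delta> \<and> \<Delta> \<noteq> {} \<and>
     (\<forall>\<sigma>\<in>\<Delta>. rational_polyhedral_cone \<sigma> \<and> strongly_convex \<sigma>) \<and>
     (\<forall>\<sigma>\<in>\<Delta>. \<forall>\<tau>. \<tau> face_of \<sigma> \<and> \<tau> \<noteq> {} \<longrightarrow> \<tau> \<in> \<Delta>) \<and>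
     (\<forall>\<sigma>\<in>\<Delta>. \<forall>\<tau>\<in>\<Delta>. (\<sigma> \<inter> \<tau>) face_of \<sigma> \<and> (\<sigma> \<inter> \<tau>) face_of \<tau>)"

definition rays :: "'n::finite cone set \<Rightarrow> 'n cone set" where
  "rays \<Delta> = {\<alpha>\<in>\<Delta>. aff_dim \<alpha> = 1}"

definition prim_gen :: "'n::finite cone \<Rightarrow> 'n lat" where
  "prim_gen \<alpha> = (THE u. {w. rvec w \<in> \<alpha>} = range (\<lambda>c::nat. int c *s u))"


subsection \<open>The toric variety of a fan\<close>

definition dual_monoid :: "'n::finite cone \<Rightarrow> 'n lat set" where
  "dual_monoid \<sigma> = {m. \<forall>y\<in>\<sigma>. 0 \<le> rvec m \<bullet> y}"

(* U_sigma = Spec C[S_sigma], S_sigma = dual_monoid sigma: its complex points are the monoid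
   homomorphisms from S_sigma to the multiplicative monoid C, extended by 0 outside S_sigma; the
   analytic topology is pointwise convergence.  The value x m is the value of the character chi^m
   at the point x. *)

definition affine_chart :: "'n::finite cone \<Rightarrow> 'n point set" where
  "affine_chart \<sigma> =
     {x. x 0 = 1 \<and>
         (\<forall>m\<in>dual_monoid \<sigma>. \<forall>m'\<in>dual_monoid \<sigma>. x (m + m') = x m * x m') \<and>
         (\<forall>m. m \<notin> dual_monoid \<sigma> \<longrightarrow> x m = 0)}"

(* The open embedding U_tau -> U_sigma for a face tau of sigma. *)

definition chart_incl :: "'n::finite cone \<Rightarrow> 'n point \<Rightarrow> 'n point" where
  "chart_incl \<sigma> x = (\<lambda>m. if m \<in> dual_monoid \<sigma> then x m else 0)"

definition glue_rel :: "'n::finite cone set \<Rightarrow> (('n cone \<times> 'n point) \<times> ('n cone \<times> 'n point)) set" where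
  "glue_rel \<Delta> =
     {((\<sigma>, x), (\<tau>, y)) | \<sigma> x \<tau> y. \<sigma> \<in> \<Delta> \<and> \<tau> \<in> \<Delta> \<and>
        (\<exists>z\<in>affine_chart (\<sigma> \<inter> \<tau>). x = chart_incl \<sigma> z \<and> y = chart_incl \<tau> z)}"

definition toric_points :: "'n::finite cone set \<Rightarrow> ('n cone \<times> 'n point) set set" where
  "toric_points \<Delta> = (SIGMA \<sigma>:\<Delta>. affine_chart \<sigma>) // glue_rel \<Delta>"

definition toric_topology :: "'n::finite cone set \<Rightarrow> ('n cone \<times> 'n point) set topology" where
  "toric_topology \<Delta> = topology (\<lambda>G. G \<subseteq> toric_points \<Delta> \<and>
     (\<forall>\<sigma>\<in>\<Delta>. openin (top_of_set (affine_chart \<sigma>))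
               {x \<in> affine_chart \<sigma>. glue_rel \<Delta> `` {(\<sigma>, x)} \<in> G}))"

lemma openin_toric_topology:
  "openin (toric_topology \<Delta>) G \<longleftrightarrow> G \<subseteq> toric_points \<Delta> \<and>
     (\<forall>\<sigma>\<in>\<Delta>. openin (top_of_set (affine_chart \<sigma>))
               {x \<in> affine_chart \<sigma>. glue_rel \<Delta> `` {(\<sigma>, x)} \<in> G})"
proof -
  let ?pre = "\<lambda>\<sigma> G. {x \<in> affine_chart \<sigma>. glue_rel \<Delta> `` {(\<sigma>, x)} \<in> G}"
  have inter: "?pre \<sigma> (G \<inter> G') = ?pre \<sigma> G \<inter> ?pre \<sigma> G'" for \<sigma> G G' by auto
  have union: "?pre \<sigma> (\<Union>\<G>) = (\<Union>G\<in>\<G>. ?pre \<sigma> G)" for \<sigma> \<G> by auto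
  have "istopology (\<lambda>G. G \<subseteq> toric_points \<Delta> \<and>
     (\<forall>\<sigma>\<in>\<Delta>. openin (top_of_set (affine_chart \<sigma>)) (?pre \<sigma> G)))"
    unfolding istopology_def
  proof (intro conjI allI impI)
    fix G G'
    assume "G \<subseteq> toric_points \<Delta> \<and>
        (\<forall>\<sigma>\<in>\<Delta>. openin (top_of_set (affine_chart \<sigma>)) (?pre \<sigma> G))"
      and "G' \<subseteq> toric_points \<Delta> \<and>
        (\<forall>\<sigma>\<in>\<Delta>. openin (top_of_set (affine_chart \<sigma>)) (?pre \<sigma> G'))"
    then show "G \<inter> G' \<subseteq> toric_points \<Delta>"
      and "\<forall>\<sigma>\<in>\<Delta>. openin (top_of_set (affine_chart \<sigma>)) (?pre \<sigma> (G \<inter> G'))"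
      unfolding inter by (blast, blast intro: openin_Int)
  next
    fix \<G>
    assume "\<forall>G\<in>\<G>. G \<subseteq> toric_points \<Delta> \<and>
        (\<forall>\<sigma>\<in>\<Delta>. openin (top_of_set (affine_chart \<sigma>)) (?pre \<sigma> G))"
    then show "\<Union>\<G> \<subseteq> toric_points \<Delta>"
      and "\<forall>\<sigma>\<in>\<Delta>. openin (top_of_set (affine_chart \<sigma>)) (?pre \<sigma> (\<Union>\<G>))"
      unfolding union by (blast, blast intro: openin_Union)
  qed
  then show ?thesis
    unfolding toric_topology_def by (simp add: topology_inverse')
qed

(* Zariski tangent space of U_sigma at x: the derivations of C[S_sigma] at x with values in C,
   each given by its values D m on the characters chi^m. *)

definition tangent_space :: "'n::finite cone \<Rightarrow> 'n point \<Rightarrow> ('n lat \<Rightarrow> complex) set" where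
  "tangent_space \<sigma> x =
     {D. (\<forall>m\<in>dual_monoid \<sigma>. \<forall>m'\<in>dual_monoid \<sigma>. D (m + m') = x m * D m' + x m' * D m) \<and>
         (\<forall>m. m \<notin> dual_monoid \<sigma> \<longrightarrow> D m = 0)}"

definition toric_smooth :: "'n::finite cone set \<Rightarrow> bool" where
  "toric_smooth \<Delta> \<longleftrightarrow>
     (\<forall>\<sigma>\<in>\<Delta>. \<forall>x\<in>affine_chart \<sigma>. cfun.dim (tangent_space \<sigma> x) = CARD('n))"


subsection \<open>Holomorphic multivector fields\<close>

(* Complex differentiability at w of a function g of the finitely many variables (w m), m in A. *)

definition complex_diff_at :: "'m set \<Rightarrow> (('m \<Rightarrow> complex) \<Rightarrow> complex) \<Rightarrow> ('m \<Rightarrow> complex) \<Rightarrow> bool" where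
  "complex_diff_at A g w \<longleftrightarrow>
     (\<exists>c. \<forall>\<epsilon>>0. \<forall>\<^sub>F w' in nhds w.
        cmod (g w' - g w - (\<Sum>m\<in>A. c m * (w' m - w m))) \<le> \<epsilon> * (\<Sum>m\<in>A. cmod (w' m - w m)))"

(* A function on U_sigma is holomorphic if it is locally the restriction of a holomorphic
   function of finitely many of the characters chi^m, m in S_sigma. *)

definition holo_on_chart :: "'n::finite cone \<Rightarrow> ('n point \<Rightarrow> complex) \<Rightarrow> bool" where
  "holo_on_chart \<sigma> f \<longleftrightarrow>
     (\<forall>x\<in>affine_chart \<sigma>. \<exists>A G g. finite A \<and> A \<subseteq> dual_monoid \<sigma> \<and> open G \<and> x \<in> G \<and>
        (\<forall>w\<in>G. complex_diff_at A g w) \<and> (\<forall>y\<in>G \<inter> affine_chart \<sigma>. f y = g y))"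

(* Global holomorphic k-vector fields on X.  A section over X is a compatible family of sections over the charts:
   v (sigma, x, ms) is the value at x in U_sigma of the function v_sigma(d chi^m0, d chi^m1, ...)
   obtained by contracting the k-vector field v_sigma with the differentials of the characters
   ms = [m0, m1, ...].  Since these differentials generate the cotangent sheaf of U_sigma,
   v_sigma is holomorphic iff all these functions are. *)

definition multivector_fields ::
    "'n::finite cone set \<Rightarrow> nat \<Rightarrow> ('n cone \<times> 'n point \<times> 'n lat list \<Rightarrow> complex) set" where
  "multivector_fields \<Delta> k = {v.
     (\<forall>\<sigma>\<in>\<Delta>. \<forall>x\<in>affine_chart \<sigma>. (\<lambda>ms. v (\<sigma>, x, ms)) \<in> ext_power k (tangent_space \<sigma> x)) \<and>
     (\<forall>\<sigma>\<in>\<Delta>. \<forall>ms. set ms \<subseteq> dual_monoid \<sigma> \<longrightarrow> holo_on_chart \<sigma> (\<lambda>x. v (\<sigma>, x, ms))) \<and>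
     (\<forall>\<sigma>\<in>\<Delta>. \<forall>\<tau>\<in>\<Delta>. \<tau> \<subseteq> \<sigma> \<longrightarrow> (\<forall>x\<in>affine_chart \<tau>. \<forall>ms. set ms \<subseteq> dual_monoid \<sigma> \<longrightarrow>
        v (\<sigma>, chart_incl \<sigma> x, ms) = v (\<tau>, x, ms))) \<and>
     (\<forall>\<sigma> x ms. \<not> (\<sigma> \<in> \<Delta> \<and> x \<in> affine_chart \<sigma>) \<longrightarrow> v (\<sigma>, x, ms) = 0)}"


subsection \<open>Torus action and weight spaces\<close>

definition torus :: "(complex ^ 'n::finite) set" where
  "torus = {t. \<forall>i. t $ i \<noteq> 0}"

definition character :: "'n::finite lat \<Rightarrow> complex ^ 'n \<Rightarrow> complex" where
  "character m t = (\<Prod>i\<in>UNIV. t $ i powi m $ i)"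

definition torus_act :: "complex ^ 'n \<Rightarrow> 'n::finite point \<Rightarrow> 'n point" where
  "torus_act t x = (\<lambda>m. character m t * x m)"

(* (t_* v)(y)(d chi^m0, d chi^m1, ...) = v(t^-1 y)(d (chi^m0 o t), d (chi^m1 o t), ...), where
   chi^m o t = chi^m(t) chi^m. *)

definition push_forward ::
    "complex ^ 'n \<Rightarrow> ('n cone \<times> 'n::finite point \<times> 'n lat list \<Rightarrow> complex)
       \<Rightarrow> ('n cone \<times> 'n point \<times> 'n lat list \<Rightarrow> complex)" where
  "push_forward t v = (\<lambda>(\<sigma>, y, ms).
     (\<Prod>m\<leftarrow>ms. character m t) * v (\<sigma>, torus_act (\<chi> i. inverse (t $ i)) y, ms))"

definition weight_space ::
    "'n::finite cone set \<Rightarrow> nat \<Rightarrow> 'n lat \<Rightarrow> ('n cone \<times> 'n point \<times> 'n lat list \<Rightarrow> complex) set" where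
  "weight_space \<Delta> k I =
     {v \<in> multivector_fields \<Delta> k. \<forall>t\<in>torus. push_forward t v = cscale (character I t) v}"

(* The action of u in N_C = Lie(T) at the point x: the velocity at s = 0 of s |-> exp(s u) x. *)

definition inf_action :: "complex ^ 'n \<Rightarrow> 'n::finite point \<Rightarrow> 'n lat \<Rightarrow> complex" where
  "inf_action u x m = deriv (\<lambda>s. torus_act (\<chi> i. exp (s * u $ i)) x m) 0"

(* The map rho on the exterior powers of N_C, where N_C = C^n is identified with Hom(M, C) through
   u |-> cpair u, so that the degree k exterior power of N_C is ext_power k (range cpair).
   By rho_wedge below, rho is the map induced by inf_action. *)

definition rho ::
    "'n::finite cone set \<Rightarrow> ('n lat list \<Rightarrow> complex) \<Rightarrow> ('n cone \<times> 'n point \<times> 'n lat list \<Rightarrow> complex)" where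
  "rho \<Delta> w = (\<lambda>(\<sigma>, x, ms).
     if \<sigma> \<in> \<Delta> \<and> x \<in> affine_chart \<sigma> then w ms * (\<Prod>m\<leftarrow>ms. x m) else 0)"

lemma inf_action_eq: "inf_action u x m = cpair u m * x m"
proof -
  have "torus_act (\<chi> i. exp (s * u $ i)) x m = exp (s * cpair u m) * x m" for s
    by (simp add: torus_act_def character_def cpair_def exp_sum exp_power_int sum_distrib_left
        mult_ac)
  moreover have "((\<lambda>s. exp (s * cpair u m) * x m) has_field_derivative cpair u m * x m) (at 0)"
    by (auto intro!: derivative_eq_intros)
  ultimately show ?thesis
    unfolding inf_action_def by (simp add: DERIV_imp_deriv)
qed

lemma rho_wedge:
  assumes "\<sigma> \<in> \<Delta>" "x \<in> affine_chart \<sigma>"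
  shows "rho \<Delta> (wedge (map cpair us)) (\<sigma>, x, ms) = wedge (map (\<lambda>u. inf_action u x) us) ms"
proof (cases "length ms = length us")
  case True
  have perm: "(\<Prod>i<length us. x (ms ! p i)) = (\<Prod>m\<leftarrow>ms. x m)"
    if "p permutes {..<length us}" for p
  proof -
    have "(\<Prod>i<length us. x (ms ! p i)) = (\<Prod>i<length us. x (ms ! i))"
      using prod.permute[OF that, of "\<lambda>i. x (ms ! i)"] by (simp add: o_def)
    also have "\<dots> = (\<Prod>m\<leftarrow>ms. x m)"
      using True by (simp add: prod.list_conv_set_nth atLeast0LessThan)
    finally show ?thesis .
  qed
  have "wedge (map (\<lambda>u. inf_action u x) us) ms =
      (\<Sum>p | p permutes {..<length us}. of_int (sign p) *
         ((\<Prod>i<length us. cpair (us ! i) (ms ! p i)) * (\<Prod>i<length us. x (ms ! p i))))"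
    using True by (simp add: wedge_def inf_action_eq prod.distrib)
  also have "\<dots> = (\<Sum>p | p permutes {..<length us}. of_int (sign p) *
         ((\<Prod>i<length us. cpair (us ! i) (ms ! p i)) * (\<Prod>m\<leftarrow>ms. x m)))"
    by (rule sum.cong) (auto simp: perm)
  also have "\<dots> = rho \<Delta> (wedge (map cpair us)) (\<sigma>, x, ms)"
    using assms True by (simp add: rho_def wedge_def sum_distrib_right mult.assoc)
  finally show ?thesis by simp
next
  case False
  then show ?thesis using assms by (simp add: rho_def wedge_def)
qed


subsection \<open>The polytope of a fan and the spaces attached to its lattice points\<close>

definition polytope_of :: "'n::finite cone set \<Rightarrow> (real ^ 'n) set" where
  "polytope_of \<Delta> = {I. \<forall>\<alpha>\<in>rays \<Delta>. I \<bullet> rvec (prim_gen \<alpha>) \<ge> -1}"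

definition polytope_faces :: "'n::finite cone set \<Rightarrow> nat \<Rightarrow> (real ^ 'n) set set" where
  "polytope_faces \<Delta> d = {F. F face_of polytope_of \<Delta> \<and> aff_dim F = int d}"

definition int_lattice :: "(real ^ 'n) set \<Rightarrow> 'n::finite lat set" where
  "int_lattice F = {I. rvec I \<in> rel_interior F}"

definition codim_lattice :: "'n::finite cone set \<Rightarrow> nat \<Rightarrow> 'n lat set" where
  "codim_lattice \<Delta> i = (\<Union>F\<in>polytope_faces \<Delta> (CARD('n) - i). int_lattice F)"

definition S_upto :: "'n::finite cone set \<Rightarrow> nat \<Rightarrow> 'n lat set" where
  "S_upto \<Delta> k = (\<Union>i\<in>{0..k}. codim_lattice \<Delta> i)"

(* The bound i <= n matters because of truncated subtraction in codim_lattice. *)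

definition codim_of :: "'n::finite cone set \<Rightarrow> 'n lat \<Rightarrow> nat" where
  "codim_of \<Delta> I = (THE i. i \<le> CARD('n) \<and> I \<in> codim_lattice \<Delta> i)"

definition E_set :: "'n::finite cone set \<Rightarrow> 'n lat \<Rightarrow> 'n lat set" where
  "E_set \<Delta> I = {prim_gen \<alpha> | \<alpha>. \<alpha> \<in> rays \<Delta> \<and> lpair I (prim_gen \<alpha>) = -1}"

definition F_perp :: "'n::finite cone set \<Rightarrow> 'n lat \<Rightarrow> (real ^ 'n) set" where
  "F_perp \<Delta> I = span (rvec ` E_set \<Delta> I)"

definition E_basis :: "'n::finite cone set \<Rightarrow> 'n lat \<Rightarrow> 'n lat list" where
  "E_basis \<Delta> I = (SOME es. distinct es \<and> set es \<subseteq> E_set \<Delta> I \<and>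
     independent (rvec ` set es) \<and> span (rvec ` set es) = F_perp \<Delta> I)"

(* The span of the products E_basis /\ u_1 /\ ... /\ u_(k-i) with u_j in N_C, i = codim_of I. *)

definition N_space :: "'n::finite cone set \<Rightarrow> nat \<Rightarrow> 'n lat \<Rightarrow> ('n lat list \<Rightarrow> complex) set" where
  "N_space \<Delta> k I =
     (if codim_of \<Delta> I \<le> k
      then cfun.span {wedge (map cpair (map cvec (E_basis \<Delta> I) @ us)) | us.
                        length us = k - codim_of \<Delta> I}
      else {0})"

definition W_space ::
    "'n::finite cone set \<Rightarrow> nat \<Rightarrow> 'n lat \<Rightarrow> ('n cone \<times> 'n point \<times> 'n lat list \<Rightarrow> complex) set" where
  "W_space \<Delta> k I = rho \<Delta> ` N_space \<Delta> k I"

(* A meromorphic k-vector field on X with poles outside T is represented by its restriction to T,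
   the chart of the zero cone.  A holomorphic field on X is compared with it through
   restrict_torus. *)

definition restrict_torus ::
    "('n::finite cone \<times> 'n point \<times> 'n lat list \<Rightarrow> complex) \<Rightarrow> ('n point \<times> 'n lat list \<Rightarrow> complex)" where
  "restrict_torus v = (\<lambda>(x, ms). v ({0}, x, ms))"

definition V_space ::
    "'n::finite cone set \<Rightarrow> nat \<Rightarrow> 'n lat \<Rightarrow> ('n point \<times> 'n lat list \<Rightarrow> complex) set" where
  "V_space \<Delta> k I = (\<lambda>w. \<lambda>(x, ms). x I * restrict_torus w (x, ms)) ` W_space \<Delta> k I"

end

theory Submission
  imports Defs "HOL-Complex_Analysis.Cauchy_Integral_Formula"
begin

text \<open>
  Over the torus \<open>T\<close> a \<open>k\<close>-vector field is a function \<open>w\<close> on \<open>T\<close> with values in the exterior power of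
  \<open>N\<^sub>\<complex>\<close>. Compactness makes the fan complete, so every point of \<open>T\<close> lies in a compact part
  of some chart, where the field is bounded; hence \<open>w\<close> has moderate growth and, by Liouville's theorem
  in one variable after the other, it is a Laurent polynomial \<open>\<Sum> \<chi>\<^sup>I a\<^sub>I\<close>. Letting the torus act separates
  the terms \<open>\<chi>\<^sup>I a\<^sub>I\<close>, and boundedness along the one-parameter subgroup of a ray \<open>e\<close> forces
  \<open>a\<^sub>I = 0\<close> if \<open>\<langle>I, e\<rangle> \<le> -2\<close>, and \<open>e\<close> to divide \<open>a\<^sub>I\<close> if \<open>\<langle>I, e\<rangle> = -1\<close>: that is, \<open>a\<^sub>I\<close> lies in
  \<open>N\<^sub>I\<^sup>k(\<Delta>)\<close>. Conversely, for such \<open>a\<^sub>I\<close> the contraction of \<open>\<chi>\<^sup>I a\<^sub>I\<close> with characters that are regular on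
  a chart is a multiple of a character that is again regular there, or zero. An exterior power
  of a finite-dimensional tangent space consists of all alternating functions that are tangent
  vectors in each argument, so no coordinates on the chart are needed; this is the only place
  where smoothness enters.
\<close>

section \<open>Exterior powers of spaces of functions\<close>

text \<open>Contracting \<chi>^I a with characters m_1, ..., m_k gives a(m_1, ..., m_k) times the
  character of exponent I + m_1 + ... + m_k. On the chart of a ray e all <m_j, e> are nonnegative.
  If <I, e> = -1, the exponent is negative on e exactly when every m_j is orthogonal to e, and
  vanishing on such tuples is divisibility by e. If <I, e> <= -2, tuples with one <m_j, e> equal to
  1 and the others 0 must be killed as well; linearity in that slot then leaves a = 0. A cone of the
  fan is generated by its rays, so these conditions suffice on every chart. Boundedness on a chart
  controls only contractions with characters regular there. An arbitrary character is a quotient of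
  two such characters, so its contraction, taken in the invariant frame, is a difference of
  controlled ones. Linear algebra over the lattice uses bases that are dual only up to a common
  nonzero integer, so no unimodular completion of the ray generators is required.\<close>

lemma sum_fun_apply: "(\<Sum>i\<in>A. f i) x = (\<Sum>i\<in>A. f i x)"
  by (induction A rule: infinite_finite_induct) auto

lemma cscale_apply: "cscale c f x = c * f x"
  by (simp add: cscale_def)

lemma cfun_subspace_alt:
  "cfun.subspace S \<longleftrightarrow> 0 \<in> S \<and> (\<forall>f\<in>S. \<forall>g\<in>S. f + g \<in> S) \<and> (\<forall>c. \<forall>f\<in>S. cscale c f \<in> S)"
  unfolding cfun.subspace_def by blast

lemma permutes_lessThan_iff: "p permutes {..<k} \<Longrightarrow> p i < k \<longleftrightarrow> i < k"
  using permutes_in_image[of p "{..<k}" i] by simp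

text \<open>Finitely many point evaluations determine the elements of a finite-dimensional function
  space. A new spanning function contributes only its interpolation error \<open>rest\<close>:
  either it vanishes, or a point \<open>m0\<close> where it does not becomes a further node.\<close>

lemma dual_pair_exists:
  assumes "finite B"
  shows "\<exists>n b q. (\<forall>j<n. b j \<in> cfun.span B) \<and>
           (\<forall>D\<in>cfun.span B. \<forall>m. D m = (\<Sum>j<(n::nat). D (q j) * b j m))"
  using assms
proof (induction B)
  case empty
  show ?case
    by (rule exI[of _ 0]) (simp add: cfun.span_empty)
next
  case (insert D0 B)
  then obtain n b q where b: "\<And>j. j < n \<Longrightarrow> b j \<in> cfun.span B"
    and D: "\<And>D m. D \<in> cfun.span B \<Longrightarrow> D m = (\<Sum>j<(n::nat). D (q j) * b j m)"
    by blast
  have sub: "cfun.span B \<subseteq> cfun.span (insert D0 B)"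
    by (rule cfun.span_mono) auto
  define rest where "rest D = D - (\<Sum>j<n. cscale (D (q j)) (b j))" for D
  have rest_apply: "rest D m = D m - (\<Sum>j<n. D (q j) * b j m)" for D m
    by (simp add: rest_def sum_fun_apply cscale_apply)
  \<comment> \<open>\<open>rest\<close> is linear and kills the old span, so on the enlarged span
    its values are multiples of \<open>rest D0\<close>.\<close>
  have rest_span: "\<exists>c. \<forall>m. rest D m = c * rest D0 m" if "D \<in> cfun.span (insert D0 B)" for D
  proof -
    obtain c where "D - cscale c D0 \<in> cfun.span B"
      using \<open>D \<in> cfun.span (insert D0 B)\<close> cfun.span_breakdown_eq by blast
    then have "D m - c * D0 m = (\<Sum>j<n. (D (q j) - c * D0 (q j)) * b j m)" for m
      using D[of "D - cscale c D0" m] by (simp add: cscale_apply)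
    then have eq: "D m - c * D0 m = (\<Sum>j<n. D (q j) * b j m) - c * (\<Sum>j<n. D0 (q j) * b j m)" for m
      by (simp add: left_diff_distrib sum_subtractf sum_distrib_left mult.assoc)
    have "rest D m = c * rest D0 m" for m
      unfolding rest_apply using eq[of m] by algebra
    then show ?thesis by blast
  qed
  show ?case
  proof (cases "\<forall>m. rest D0 m = 0")
    case True
    have "D m = (\<Sum>j<n. D (q j) * b j m)" if "D \<in> cfun.span (insert D0 B)" for D m
    proof -
      have "rest D m = 0" using rest_span[OF that] True by auto
      then show ?thesis unfolding rest_apply by (rule eq_iff_diff_eq_0[THEN iffD2])
    qed
    then show ?thesis
      using b sub by blast
  next
    case False
    then obtain m0 where m0: "rest D0 m0 \<noteq> 0" by blast
    define e where "e = cscale (1 / rest D0 m0) (rest D0)"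
    \<comment> \<open>Substituting \<open>rest D m = rest D m0 * e m\<close> and collecting the
      coefficient of each \<open>D (q j)\<close> gives these functions.\<close>
    define b' where "b' j = (if j < n then b j - cscale (b j m0) e else e)" for j
    define q' where "q' j = (if j < n then q j else m0)" for j
    have "rest D0 \<in> cfun.span (insert D0 B)"
      unfolding rest_def using b sub
      by (intro cfun.span_diff cfun.span_sum cfun.span_scale) (auto intro: cfun.span_base)
    then have e: "e \<in> cfun.span (insert D0 B)"
      unfolding e_def by (rule cfun.span_scale)
    have "b' j \<in> cfun.span (insert D0 B)" for j
      unfolding b'_def using e b sub by (auto intro!: cfun.span_diff cfun.span_scale)
    moreover have "D m = (\<Sum>j<Suc n. D (q' j) * b' j m)"
      if "D \<in> cfun.span (insert D0 B)" for D m
    proof -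
      obtain c where c: "\<And>m. rest D m = c * rest D0 m"
        using rest_span[OF \<open>D \<in> cfun.span (insert D0 B)\<close>] by blast
      have "rest D m = rest D m0 * e m"
        using m0 by (simp add: c e_def cscale_apply)
      then have "D m = (\<Sum>j<n. D (q j) * b j m) + (D m0 - (\<Sum>j<n. D (q j) * b j m0)) * e m"
        unfolding rest_apply by algebra
      moreover have "(\<Sum>j<Suc n. D (q' j) * b' j m) =
          (\<Sum>j<n. D (q j) * b j m - D (q j) * (b j m0 * e m)) + D m0 * e m"
        by (simp add: b'_def q'_def cscale_apply right_diff_distrib)
      ultimately show ?thesis
        by (simp add: sum_subtractf sum_distrib_right left_diff_distrib mult.assoc)
    qed
    ultimately show ?thesis by blast
  qed
qed

section \<open>Alternating functions and exterior powers\<close>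

definition alternating :: "nat \<Rightarrow> ('m list \<Rightarrow> complex) \<Rightarrow> bool" where
  "alternating k \<phi> \<longleftrightarrow> (\<forall>ms. length ms \<noteq> k \<longrightarrow> \<phi> ms = 0) \<and>
     (\<forall>p ms. p permutes {..<k} \<longrightarrow> length ms = k \<longrightarrow>
        \<phi> (permute_list p ms) = of_int (sign p) * \<phi> ms)"

lemma alternating_length: "alternating k \<phi> \<Longrightarrow> length ms \<noteq> k \<Longrightarrow> \<phi> ms = 0"
  by (simp add: alternating_def)

lemma alternating_permute:
  "alternating k \<phi> \<Longrightarrow> p permutes {..<k} \<Longrightarrow> length ms = k \<Longrightarrow>
     \<phi> (permute_list p ms) = of_int (sign p) * \<phi> ms"
  by (simp add: alternating_def)

lemma alternating_not_distinct:
  assumes "alternating k \<phi>" "\<not> distinct ms"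
  shows "\<phi> ms = 0"
proof (cases "length ms = k")
  case True
  obtain i j where ij: "i < k" "j < k" "i \<noteq> j" "ms ! i = ms ! j"
    using assms(2) True by (auto simp: distinct_conv_nth)
  let ?p = "Transposition.transpose i j"
  have p: "?p permutes {..<k}"
    using ij by (intro permutes_swap_id) auto
  have "permute_list ?p ms = ms"
    using ij True by (intro nth_equalityI) (auto simp: permute_list_def Transposition.transpose_def)
  then have "\<phi> ms = - \<phi> ms"
    using alternating_permute[OF assms(1) p True] ij by (simp add: sign_swap_id)
  then show ?thesis by simp
qed (use assms in \<open>simp add: alternating_length\<close>)

lemma alternating_subspace: "cfun.subspace {\<phi>. alternating k \<phi>}"
  unfolding cfun_subspace_alt alternating_def by (auto simp: cscale_apply algebra_simps)

lemma alternating_wedge: "alternating (length Ds) (wedge Ds)"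
  unfolding alternating_def
proof (intro conjI allI impI)
  fix p and ms :: "'a list"
  assume p: "p permutes {..<length Ds}" and len: "length ms = length Ds"
  let ?S = "{..<length Ds}"
  have "wedge Ds (permute_list p ms) =
      (\<Sum>r | r permutes ?S. of_int (sign r) * (\<Prod>i<length Ds. (Ds ! i) (ms ! p (r i))))"
    using len p by (auto simp: wedge_def permute_list_nth permutes_lessThan_iff intro!: sum.cong prod.cong)
  also have "\<dots> = (\<Sum>r | r permutes ?S. of_int (sign p) * (of_int (sign (p \<circ> r)) *
       (\<Prod>i<length Ds. (Ds ! i) (ms ! (p \<circ> r) i))))"
  proof (rule sum.cong)
    fix r assume "r \<in> {r. r permutes ?S}"
    then have "permutation r" "permutation p"
      using p by (auto simp: permutation_permutes)
    then have "sign (p \<circ> r) = sign p * sign r"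
      by (simp add: sign_compose)
    then have "sign r = sign p * sign (p \<circ> r)"
      by (simp add: sign_def)
    then show "of_int (sign r) * (\<Prod>i<length Ds. (Ds ! i) (ms ! p (r i))) =
      of_int (sign p) * (of_int (sign (p \<circ> r)) * (\<Prod>i<length Ds. (Ds ! i) (ms ! (p \<circ> r) i)))"
      by simp
  qed simp
  also have "\<dots> = of_int (sign p) * (\<Sum>r | r permutes ?S. of_int (sign (p \<circ> r)) *
       (\<Prod>i<length Ds. (Ds ! i) (ms ! (p \<circ> r) i)))"
    by (simp add: sum_distrib_left)
  also have "(\<Sum>r | r permutes ?S. of_int (sign (p \<circ> r)) *
       (\<Prod>i<length Ds. (Ds ! i) (ms ! (p \<circ> r) i))) = wedge Ds ms"
    using setum_permutations_compose_left[OF p,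
        of "\<lambda>r. of_int (sign r) * (\<Prod>i<length Ds. (Ds ! i) (ms ! r i))"] len
    by (simp add: wedge_def)
  finally show "wedge Ds (permute_list p ms) = of_int (sign p) * wedge Ds ms" .
qed (simp add: wedge_def)

text \<open>In the term of \<open>p\<close> the entry \<open>m\<close> meets only the factor with
  index \<open>inv p i\<close>. This is the expansion of a determinant along one column, a linear
  combination of the \<open>Ds\<close>.\<close>

lemma wedge_slot:
  assumes "cfun.subspace V" "set Ds \<subseteq> V" "length ms = length Ds" "i < length Ds"
  shows "(\<lambda>m. wedge Ds (ms[i := m])) \<in> V"
proof -
  let ?k = "length Ds"
  define c where "c p = of_int (sign p) * (\<Prod>l\<in>{..<?k} - {inv p i}. (Ds ! l) (ms ! p l))" for p
  have "(\<lambda>m. wedge Ds (ms[i := m])) =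
      (\<Sum>p | p permutes {..<?k}. cscale (c p) (Ds ! inv p i))"
  proof
    fix m
    have "of_int (sign p) * (\<Prod>l<?k. (Ds ! l) (ms[i := m] ! p l)) = c p * (Ds ! inv p i) m"
      if p: "p permutes {..<?k}" for p
    proof -
      have i: "inv p i \<in> {..<?k}" "p (inv p i) = i"
        using assms(4) p permutes_inv[OF p] by (auto simp: permutes_inverses permutes_lessThan_iff)
      have "(\<Prod>l<?k. (Ds ! l) (ms[i := m] ! p l)) =
          (Ds ! inv p i) m * (\<Prod>l\<in>{..<?k} - {inv p i}. (Ds ! l) (ms[i := m] ! p l))"
        using i assms by (subst prod.remove[of _ "inv p i"]) auto
      also have "(\<Prod>l\<in>{..<?k} - {inv p i}. (Ds ! l) (ms[i := m] ! p l)) =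
          (\<Prod>l\<in>{..<?k} - {inv p i}. (Ds ! l) (ms ! p l))"
      proof (rule prod.cong)
        fix l assume "l \<in> {..<?k} - {inv p i}"
        then have "p l \<noteq> i" using p by (auto simp: permutes_inverses)
        then show "(Ds ! l) (ms[i := m] ! p l) = (Ds ! l) (ms ! p l)" by simp
      qed simp
      finally show ?thesis by (simp add: c_def cscale_apply)
    qed
    then show "wedge Ds (ms[i := m]) = (\<Sum>p | p permutes {..<?k}. cscale (c p) (Ds ! inv p i)) m"
      using assms by (auto simp: wedge_def sum_fun_apply cscale_apply intro!: sum.cong)
  qed
  also have "\<dots> \<in> V"
  proof (intro cfun.subspace_sum[OF assms(1)] cfun.subspace_scale[OF assms(1)])
    fix p assume "p \<in> {p. p permutes {..<?k}}"
    then have "inv p i < ?k"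
      using assms(4) permutes_inv by (metis mem_Collect_eq permutes_lessThan_iff)
    then show "Ds ! inv p i \<in> V" using assms(2) by auto
  qed
  finally show ?thesis .
qed

text \<open>The hypothesis is linear interpolation in one slot. Applying it to the slots in turn
  replaces all arguments by nodes; the list \<open>f\<close> records the node chosen in each
  slot.\<close>

lemma slot_expansion:
  assumes slot: "\<And>ms i m. length ms = k \<Longrightarrow> i < k \<Longrightarrow>
      \<phi> (ms[i := m]) = (\<Sum>j<(n::nat). b j m * \<phi> (ms[i := q j]))"
    and "length ms = k"
  shows "\<phi> ms = (\<Sum>f | set f \<subseteq> {..<n} \<and> length f = k.
           (\<Prod>i<k. b (f ! i) (ms ! i)) * (\<phi> (map q f) :: complex))"
proof -
  let ?L = "\<lambda>j. {f. set f \<subseteq> {..<n} \<and> length f = j}"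
  \<comment> \<open>After \<open>j\<close> rounds the first \<open>j\<close> arguments are nodes and
    the others are still those of \<open>ms\<close>.\<close>
  have "\<phi> ms = (\<Sum>f\<in>?L j. (\<Prod>i<j. b (f ! i) (ms ! i)) * \<phi> (map q f @ drop j ms))" if "j \<le> k" for j
    using that
  proof (induction j)
    case 0
    have "?L 0 = {[]}" by auto
    then show ?case by simp
  next
    case (Suc j)
    have L: "?L (Suc j) = (\<lambda>(f, l). f @ [l]) ` (?L j \<times> {..<n})"
    proof
      show "?L (Suc j) \<subseteq> (\<lambda>(f, l). f @ [l]) ` (?L j \<times> {..<n})"
      proof
        fix f assume f: "f \<in> ?L (Suc j)"
        then have "f = (\<lambda>(f, l). f @ [l]) (butlast f, last f)" "f \<noteq> []"
          by (cases f rule: rev_cases; simp)+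
        moreover have "(butlast f, last f) \<in> ?L j \<times> {..<n}"
          using f \<open>f \<noteq> []\<close> by (auto dest: in_set_butlastD subsetD[OF _ last_in_set])
        ultimately show "f \<in> (\<lambda>(f, l). f @ [l]) ` (?L j \<times> {..<n})" by blast
      qed
    qed auto
    have inj: "inj_on (\<lambda>(f, l). f @ [l]) (?L j \<times> {..<n})"
      by (auto simp: inj_on_def)
    have "\<phi> (map q f @ drop j ms) = (\<Sum>l<n. b l (ms ! j) * \<phi> (map q (f @ [l]) @ drop (Suc j) ms))"
      if "f \<in> ?L j" for f
    proof -
      have d: "drop j ms = ms ! j # drop (Suc j) ms"
        using Suc.prems assms(2) by (simp add: Cons_nth_drop_Suc)
      have "\<phi> (map q f @ drop j ms) = \<phi> ((map q f @ drop j ms)[j := ms ! j])"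
        using that d by (auto simp: list_update_append)
      also have "\<dots> = (\<Sum>l<n. b l (ms ! j) * \<phi> ((map q f @ drop j ms)[j := q l]))"
        using that Suc.prems assms(2) by (intro slot) auto
      also have "\<dots> = (\<Sum>l<n. b l (ms ! j) * \<phi> (map q (f @ [l]) @ drop (Suc j) ms))"
        using that d by (simp add: list_update_append)
      finally show ?thesis .
    qed
    then have "\<phi> ms = (\<Sum>f\<in>?L j. \<Sum>l<n. (\<Prod>i<j. b (f ! i) (ms ! i)) *
        (b l (ms ! j) * \<phi> (map q (f @ [l]) @ drop (Suc j) ms)))"
      using Suc by (simp add: sum_distrib_left)
    also have "\<dots> = (\<Sum>(f, l)\<in>?L j \<times> {..<n}. (\<Prod>i<j. b (f ! i) (ms ! i)) *
        (b l (ms ! j) * \<phi> (map q (f @ [l]) @ drop (Suc j) ms)))"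
      by (simp add: sum.cartesian_product)
    also have "\<dots> = (\<Sum>f\<in>?L (Suc j). (\<Prod>i<Suc j. b (f ! i) (ms ! i)) * \<phi> (map q f @ drop (Suc j) ms))"
      unfolding L sum.reindex[OF inj]
      by (intro sum.cong) (auto simp: nth_append intro!: prod.cong)
    finally show ?case .
  qed
  from this[of k] assms(2) show ?thesis by simp
qed

text \<open>Averaging the multilinear expansion over all signed permutations of the arguments turns
  each product into a determinant; the number of permutations is the origin of
  \<open>fact k\<close>. The lists \<open>f\<close> are not restricted to increasing ones, which
  avoids choosing representatives.\<close>

lemma alternating_expansion:
  assumes alt: "alternating k \<phi>"
    and slot: "\<And>ms i m. length ms = k \<Longrightarrow> i < k \<Longrightarrow>
      \<phi> (ms[i := m]) = (\<Sum>j<(n::nat). b j m * \<phi> (ms[i := q j]))"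
  shows "\<phi> = (\<Sum>f | set f \<subseteq> {..<n} \<and> length f = k. cscale (\<phi> (map q f) / fact k) (wedge (map b f)))"
    (is "_ = sum _ ?L")
proof
  fix ms
  show "\<phi> ms = (\<Sum>f\<in>?L. cscale (\<phi> (map q f) / fact k) (wedge (map b f))) ms"
  proof (cases "length ms = k")
    case True
    let ?P = "{p. p permutes {..<k}}"
    have card: "card ?P = fact k"
      by (rule card_permutations) auto
    have "\<phi> ms = (\<Sum>f\<in>?L. of_int (sign p) * ((\<Prod>i<k. b (f ! i) (ms ! p i)) * \<phi> (map q f)))"
      if p: "p permutes {..<k}" for p
    proof -
      have "\<phi> ms = of_int (sign p) * \<phi> (permute_list p ms)"
        using alternating_permute[OF alt p True] by (simp add: sign_def)
      also have "\<phi> (permute_list p ms) =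
          (\<Sum>f\<in>?L. (\<Prod>i<k. b (f ! i) (permute_list p ms ! i)) * \<phi> (map q f))"
        by (rule slot_expansion[OF slot]) (auto simp: True)
      also have "\<dots> = (\<Sum>f\<in>?L. (\<Prod>i<k. b (f ! i) (ms ! p i)) * \<phi> (map q f))"
        using p True by (auto simp: permute_list_nth intro!: sum.cong prod.cong)
      finally show ?thesis by (simp add: sum_distrib_left)
    qed
    then have "(\<Sum>p\<in>?P. \<phi> ms) = (\<Sum>p\<in>?P. \<Sum>f\<in>?L. of_int (sign p) *
        ((\<Prod>i<k. b (f ! i) (ms ! p i)) * \<phi> (map q f)))"
      by (intro sum.cong) auto
    also have "\<dots> = (\<Sum>f\<in>?L. \<phi> (map q f) * wedge (map b f) ms)"
      using True by (subst sum.swap) (auto simp: wedge_def sum_distrib_left mult_ac intro!: sum.cong)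
    finally show ?thesis
      by (simp add: card sum_fun_apply cscale_apply sum_divide_distrib[symmetric] field_simps)
  next
    case False
    then show ?thesis
      by (simp add: alternating_length[OF alt] sum_fun_apply cscale_apply wedge_def)
  qed
qed

text \<open>The slot conditions give membership without exhibiting decomposable multivectors:
  interpolation in every slot, followed by antisymmetrization, expresses the function through wedges
  of the \<open>b j\<close>.\<close>

theorem ext_power_iff:
  assumes V: "V = cfun.span B" and "finite B"
  shows "\<phi> \<in> ext_power k V \<longleftrightarrow>
    alternating k \<phi> \<and> (\<forall>ms i. length ms = k \<longrightarrow> i < k \<longrightarrow> (\<lambda>m. \<phi> (ms[i := m])) \<in> V)"
    (is "_ \<longleftrightarrow> _ \<and> ?slots \<phi>")
proof
  have sV: "cfun.subspace V" using V by simp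
  assume "\<phi> \<in> ext_power k V"
  moreover have "ext_power k V \<subseteq> {\<phi>. alternating k \<phi>} \<inter> {\<phi>. ?slots \<phi>}"
    unfolding ext_power_def
  proof (rule cfun.span_minimal)
    show "{wedge Ds |Ds. length Ds = k \<and> set Ds \<subseteq> V} \<subseteq> {\<phi>. alternating k \<phi>} \<inter> {\<phi>. ?slots \<phi>}"
      using alternating_wedge wedge_slot[OF sV] by auto
    have "cfun.subspace {\<phi>. ?slots \<phi>}"
      using cfun.subspace_0[OF sV] cfun.subspace_add[OF sV] cfun.subspace_scale[OF sV]
      unfolding cfun_subspace_alt
      by (auto simp: plus_fun_def cscale_def zero_fun_def)
    then show "cfun.subspace ({\<phi>. alternating k \<phi>} \<inter> {\<phi>. ?slots \<phi>})"
      by (intro cfun.subspace_inter alternating_subspace)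
  qed
  ultimately show "alternating k \<phi> \<and> ?slots \<phi>" by blast
next
  assume \<phi>: "alternating k \<phi> \<and> ?slots \<phi>"
  obtain n b q where b: "\<And>j. j < n \<Longrightarrow> b j \<in> V"
    and D: "\<And>D m. D \<in> V \<Longrightarrow> D m = (\<Sum>j<(n::nat). D (q j) * b j m)"
    using dual_pair_exists[OF assms(2)] unfolding V by blast
  have "\<phi> (ms[i := m]) = (\<Sum>j<n. b j m * \<phi> (ms[i := q j]))" if "length ms = k" "i < k" for ms i m
    using D[of "\<lambda>m. \<phi> (ms[i := m])" m] \<phi> that by (simp add: mult.commute)
  then have "\<phi> = (\<Sum>f | set f \<subseteq> {..<n} \<and> length f = k. cscale (\<phi> (map q f) / fact k) (wedge (map b f)))"
    using \<phi> by (intro alternating_expansion) auto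
  also have "\<dots> \<in> ext_power k V"
    unfolding ext_power_def
  proof (intro cfun.span_sum cfun.span_scale cfun.span_base)
    fix f assume "f \<in> {f. set f \<subseteq> {..<n} \<and> length f = k}"
    then show "wedge (map b f) \<in> {wedge Ds |Ds. length Ds = k \<and> set Ds \<subseteq> V}"
      using b by (intro CollectI exI[of _ "map b f"]) auto
  qed
  finally show "\<phi> \<in> ext_power k V" .
qed

text \<open>Invariance of a determinant under transposition, with points read as evaluation
  functionals. It carries alternation and slot linearity from the arguments over to the
  factors.\<close>

lemma wedge_transpose: "wedge Ds ms = wedge (map (\<lambda>m D. D m) ms) Ds"
proof (cases "length ms = length Ds")
  case True
  let ?k = "length Ds"
  have "wedge Ds ms = (\<Sum>p | p permutes {..<?k}.
      of_int (sign (inv p)) * (\<Prod>i<?k. (Ds ! i) (ms ! inv p i)))"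
    using True by (subst sum_permutations_inverse[symmetric]) (simp add: wedge_def)
  also have "\<dots> = (\<Sum>p | p permutes {..<?k}. of_int (sign p) * (\<Prod>i<?k. (Ds ! p i) (ms ! i)))"
  proof (rule sum.cong)
    fix p assume "p \<in> {p. p permutes {..<?k}}"
    then have p: "p permutes {..<?k}" by simp
    have "(\<Prod>i<?k. (Ds ! i) (ms ! inv p i)) = (\<Prod>i<?k. (Ds ! p i) (ms ! i))"
      using prod.permute[OF p, of "\<lambda>i. (Ds ! i) (ms ! inv p i)"] p
      by (simp add: o_def permutes_inverses)
    then show "of_int (sign (inv p)) * (\<Prod>i<?k. (Ds ! i) (ms ! inv p i)) =
        of_int (sign p) * (\<Prod>i<?k. (Ds ! p i) (ms ! i))"
      using p by (simp add: sign_inverse permutation_permutes exI[of _ "{..<?k}"])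
  qed simp
  also have "\<dots> = wedge (map (\<lambda>m D. D m) ms) Ds"
    using True by (simp add: wedge_def)
  finally show ?thesis .
qed (simp add: wedge_def)

text \<open>The coefficients do not depend on \<open>D\<close> and multiply only its values at
  entries of \<open>ms\<close>, so a linear relation between factors may be used even if it holds
  only at these points.\<close>

lemma wedge_row_slot:
  assumes "length ms = length Ds" "i < length Ds"
  obtains c where "\<And>D. wedge (Ds[i := D]) ms = (\<Sum>j<length ms. c j * D (ms ! j))"
proof -
  let ?E = "(\<lambda>m (D :: 'a \<Rightarrow> complex). D m) ` set ms"
  have "(\<lambda>D. wedge (map (\<lambda>m D. D m) ms) (Ds[i := D])) \<in> cfun.span ?E"
    using assms by (intro wedge_slot) (auto intro: cfun.span_base)
  then have "(\<lambda>D. wedge (Ds[i := D]) ms) \<in> cfun.span ?E"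
    by (simp add: wedge_transpose[of "Ds[i := _]" ms])
  also have "cfun.span ?E \<subseteq> {\<psi>. \<exists>c. \<forall>D. \<psi> D = (\<Sum>j<length ms. c j * D (ms ! j))}" (is "_ \<subseteq> ?R")
  proof (rule cfun.span_minimal)
    show "?E \<subseteq> ?R"
    proof
      fix \<psi> assume "\<psi> \<in> ?E"
      then obtain j where j: "j < length ms" "\<psi> = (\<lambda>D. D (ms ! j))"
        by (auto simp: in_set_conv_nth)
      then have "\<forall>D. \<psi> D = (\<Sum>l<length ms. (if l = j then 1 else 0) * D (ms ! l))"
        by (auto simp: sum.remove[of "{..<length ms}" j])
      then show "\<psi> \<in> ?R" by (intro CollectI exI)
    qed
    show "cfun.subspace ?R"
      unfolding cfun_subspace_alt
    proof (intro conjI ballI allI)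
      show "0 \<in> ?R" by (auto intro!: exI[of _ "\<lambda>_. 0"])
      fix f g :: "('a \<Rightarrow> complex) \<Rightarrow> complex" and a assume "f \<in> ?R"
      then obtain c where c: "\<forall>D. f D = (\<Sum>j<length ms. c j * D (ms ! j))" by blast
      then show "cscale a f \<in> ?R"
        by (auto intro!: exI[of _ "\<lambda>j. a * c j"] simp: cscale_apply sum_distrib_left mult.assoc)
      assume "g \<in> ?R"
      then obtain d where d: "\<forall>D. g D = (\<Sum>j<length ms. d j * D (ms ! j))" by blast
      with c show "f + g \<in> ?R"
        by (auto intro!: exI[of _ "\<lambda>j. c j + d j"] simp: sum.distrib algebra_simps)
    qed
  qed
  finally show ?thesis using that by blast
qed

text \<open>Insert the relation in place of factor \<open>l0\<close>. Each summand with
  \<open>l\<close> different from \<open>l0\<close> has a repeated factor, so only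
  \<open>c l0\<close> times the original determinant remains.\<close>

lemma wedge_dependent:
  assumes "length ms = length Ds" "r \<le> length Ds"
    and dep: "\<And>m. m \<in> set ms \<Longrightarrow> (\<Sum>l<r. c l * (Ds ! l) m) = 0"
    and "l0 < r" "c l0 \<noteq> 0"
  shows "wedge Ds ms = 0"
proof -
  obtain a where a: "\<And>D. wedge (Ds[l0 := D]) ms = (\<Sum>j<length ms. a j * D (ms ! j))"
    using wedge_row_slot[of ms Ds l0] assms by auto
  have "wedge (Ds[l0 := Ds ! l]) ms = 0" if "l < r" "l \<noteq> l0" for l
  proof -
    have "\<not> distinct (Ds[l0 := Ds ! l])"
    proof -
      have "Ds[l0 := Ds ! l] ! l0 = Ds[l0 := Ds ! l] ! l" "l < length Ds" "l0 < length Ds"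
        using that assms by auto
      then show ?thesis
        using that(2) by (metis distinct_conv_nth length_list_update)
    qed
    then show ?thesis
      using alternating_not_distinct[OF alternating_wedge] by (subst wedge_transpose)
  qed
  then have "(\<Sum>l<r. c l * wedge (Ds[l0 := Ds ! l]) ms) = c l0 * wedge Ds ms"
    using assms(4) by (subst sum.remove[of _ l0]) auto
  moreover have "(\<Sum>l<r. c l * wedge (Ds[l0 := Ds ! l]) ms) =
      (\<Sum>j<length ms. a j * (\<Sum>l<r. c l * (Ds ! l) (ms ! j)))"
    unfolding a by (simp add: sum_distrib_left mult_ac sum.swap[of _ "{..<r}"])
  moreover have "\<dots> = 0" using dep by simp
  ultimately show ?thesis using assms(5) by simp
qed

lemma wedge_dual_same:
  assumes "distinct J"
    and "\<And>i j. i \<in> set J \<Longrightarrow> j \<in> set J \<Longrightarrow> b i (q j) = (if i = j then 1 else 0)"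
  shows "wedge (map b J) (map q J) = 1"
proof -
  let ?k = "length J"
  have "(\<Prod>i<?k. b (J ! i) (q (J ! p i))) = (if p = id then 1 else 0)"
    if p: "p permutes {..<?k}" for p
  proof (cases "p = id")
    case True
    then show ?thesis using assms by simp
  next
    case False
    then obtain i where i: "p i \<noteq> i" by (auto simp: fun_eq_iff)
    then have "i < ?k" using p unfolding permutes_def by blast
    moreover have "J ! i \<noteq> J ! p i"
      using i \<open>i < ?k\<close> p assms(1) by (simp add: nth_eq_iff_index_eq permutes_lessThan_iff)
    ultimately show ?thesis
      using False p assms(2) by (auto simp: prod_zero_iff permutes_lessThan_iff intro!: bexI[of _ i])
  qed
  then have "wedge (map b J) (map q J) =
      (\<Sum>p | p permutes {..<?k}. if p = id then 1 else 0)"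
    by (auto simp: wedge_def permutes_lessThan_iff sign_id intro!: sum.cong)
  also have "\<dots> = 1"
    by (subst sum.delta) (auto simp: finite_permutations permutes_id)
  finally show ?thesis .
qed

text \<open>A nonzero term would match each entry of \<open>J\<close> with an equal entry of
  \<open>J'\<close>, forcing the two sets, of equal size, to coincide.\<close>

lemma wedge_dual_other:
  assumes "length J = length J'" "distinct J" "distinct J'" "set J \<noteq> set J'"
    and "\<And>i j. i \<in> set J \<Longrightarrow> j \<in> set J' \<Longrightarrow> i \<noteq> j \<Longrightarrow> b i (q j) = 0"
  shows "wedge (map b J) (map q J') = 0"
proof -
  let ?k = "length J"
  have "(\<Prod>i<?k. b (J ! i) (q (J' ! p i))) = 0"
    if p: "p permutes {..<?k}" for p
  proof (rule ccontr)
    assume nz: "(\<Prod>i<?k. b (J ! i) (q (J' ! p i))) \<noteq> 0"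
    have all: "J ! i = J' ! p i" if "i < ?k" for i
      using nz assms(1) assms(5)[of "J ! i" "J' ! p i"] that p
      by (auto simp: prod_zero_iff permutes_lessThan_iff)
    have "set J \<subseteq> set J'"
    proof
      fix x assume "x \<in> set J"
      then obtain i where "i < ?k" "x = J ! i" by (auto simp: in_set_conv_nth)
      then show "x \<in> set J'" using all p assms(1) by (auto simp: permutes_lessThan_iff)
    qed
    moreover have "card (set J) = card (set J')"
      using assms by (simp add: distinct_card)
    ultimately show False using assms(4) by (simp add: card_subset_eq)
  qed
  then have "(\<Sum>p | p permutes {..<?k}. of_int (sign p) * (\<Prod>i<?k. b (J ! i) (q (J' ! p i)))) = 0"
    by (intro sum.neutral) auto
  moreover have "wedge (map b J) (map q J') =
      (\<Sum>p | p permutes {..<?k}. of_int (sign p) * (\<Prod>i<?k. b (J ! i) (q (J' ! p i))))"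
    using assms by (auto simp: wedge_def permutes_lessThan_iff intro!: sum.cong prod.cong)
  ultimately show ?thesis by simp
qed

section \<open>Lattice vectors and rational cones\<close>

lemma rvec_nth [simp]: "rvec u $ i = real_of_int (u $ i)"
  by (simp add: rvec_def)

lemma rvec_0 [simp]: "rvec 0 = 0"
  by (simp add: vec_eq_iff)

lemma rvec_add: "rvec (u + v) = rvec u + rvec v"
  by (simp add: vec_eq_iff)

lemma rvec_scale: "rvec (c *s u) = of_int c *\<^sub>R rvec u"
  by (simp add: vec_eq_iff)

lemma rvec_sum: "rvec (\<Sum>i\<in>A. f i) = (\<Sum>i\<in>A. rvec (f i))"
  by (induction A rule: infinite_finite_induct) (auto simp: rvec_add)

lemma rvec_eq_iff [simp]: "rvec u = rvec v \<longleftrightarrow> u = v"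
  by (simp add: vec_eq_iff)

lemma rvec_eq_0_iff [simp]: "rvec u = 0 \<longleftrightarrow> u = 0"
  by (simp add: vec_eq_iff)

lemma inj_rvec: "inj_on rvec A"
  by (simp add: inj_on_def)

lemma rvec_axis: "rvec (axis i 1) = axis i 1"
  by (simp add: vec_eq_iff axis_def)

lemma inner_rvec: "rvec m \<bullet> rvec u = real_of_int (lpair m u)"
  by (simp add: inner_vec_def lpair_def)

lemma lpair_add_left: "lpair (m + m') u = lpair m u + lpair m' u"
  and lpair_diff_left: "lpair (m - m') u = lpair m u - lpair m' u"
  and lpair_minus_left: "lpair (- m) u = - lpair m u"
  and lpair_scale_left: "lpair (c *s m) u = c * lpair m u"
  and lpair_scale_right: "lpair m (c *s u) = c * lpair m u"
  and lpair_0_left [simp]: "lpair 0 u = 0"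
  and lpair_0_right [simp]: "lpair m 0 = 0"
  by (simp_all add: lpair_def algebra_simps sum.distrib sum_subtractf sum_negf sum_distrib_left)

lemma lpair_sum_left: "lpair (\<Sum>i\<in>A. f i) u = (\<Sum>i\<in>A. lpair (f i) u)"
  by (induction A rule: infinite_finite_induct) (auto simp: lpair_add_left)

lemma lpair_axis: "lpair (axis i 1) u = u $ i"
  by (simp add: lpair_def axis_def if_distrib[of "\<lambda>x. x * _"] cong: if_cong)

lemma span_range_rvec: "span (range rvec) = (UNIV :: (real ^ 'n) set)"
proof -
  have "Basis \<subseteq> (range rvec :: (real ^ 'n) set)"
    by (auto simp: Basis_vec_def simp flip: rvec_axis)
  then show ?thesis
    using span_mono span_Basis by blast
qed

section \<open>Integral dual bases and integral approximation of functionals\<close>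

lemma det_Ints:
  assumes "\<And>i j. A $ i $ j \<in> \<int>"
  shows "det (A :: real ^ 'n ^ 'n) \<in> \<int>"
  unfolding det_def by (intro Ints_sum Ints_mult Ints_prod) (auto simp: assms)

text \<open>Complete the list by lattice vectors to a real basis and let \<open>d\<close> be its
  determinant. Cramer's rule produces, for each basis vector, an integral vector pairing to
  \<open>d\<close> with it and to 0 with the others. The factor \<open>d\<close> replaces
  unimodularity, which an arbitrary completion need not have.\<close>

theorem lattice_dual_basis:
  fixes es :: "'n::finite lat list"
  assumes "distinct es" "independent (rvec ` set es)"
  obtains es' q d where "length (es @ es') = CARD('n)" "d \<noteq> 0"
    "\<And>i j. i < CARD('n) \<Longrightarrow> j < CARD('n) \<Longrightarrow> lpair (q i) ((es @ es') ! j) = (if i = j then d else 0)"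
    "span (rvec ` set (es @ es')) = UNIV"
proof -
  obtain B :: "(real ^ 'n) set" where B: "rvec ` set es \<subseteq> B" "B \<subseteq> range rvec"
    "independent B" "range rvec \<subseteq> span B"
    using maximal_independent_subset_extend[of "rvec ` set es" "range rvec"] assms by auto
  have spanB: "span B = UNIV"
    using B(4) span_range_rvec span_mono span_span by (metis top.extremum_uniqueI)
  have cardB: "finite B" "card B = CARD('n)"
    using B(3) spanB independent_bound dim_eq_card[of B UNIV] by (auto simp: finiteI_independent)
  define S where "S = {u. rvec u \<in> B}"
  have imS: "rvec ` S = B" using B(2) by (auto simp: S_def)
  then have finS: "finite S" and cardS: "card S = CARD('n)"
    using cardB inj_rvec by (metis finite_imageD, metis card_image)
  obtain es' where es': "set es' = S - set es" "distinct es'"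
    using finite_distinct_list finS by (metis finite_Diff)
  define bs where "bs = es @ es'"
  have "set es \<subseteq> S" using B(1) by (auto simp: S_def)
  then have setbs: "set bs = S" and dbs: "distinct bs"
    using es' assms(1) by (auto simp: bs_def)
  then have len: "length bs = CARD('n)"
    using cardS by (metis distinct_card)
  obtain h :: "'n \<Rightarrow> nat" where h: "bij_betw h UNIV {0..<CARD('n)}"
    using ex_bij_betw_finite_nat[of "UNIV :: 'n set"] by auto
  define A :: "real ^ 'n ^ 'n" where "A = (\<chi> i. rvec (bs ! h i))"
  have A_mult: "(A *v x) $ i = rvec (bs ! h i) \<bullet> x" for x i
    by (simp add: A_def matrix_vector_mult_def inner_vec_def)
  have "x = 0" if "A *v x = 0" for x
  proof -
    have "x \<bullet> b = 0" if "b \<in> B" for b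
    proof -
      obtain j where j: "j < length bs" "b = rvec (bs ! j)"
        using \<open>b \<in> B\<close> imS setbs by (metis (no_types) imageE in_set_conv_nth)
      then obtain i where "j = h i"
        using h len by (metis bij_betw_imp_surj_on atLeastLessThan_iff imageE le0)
      then show ?thesis
        using \<open>A *v x = 0\<close> A_mult[of x i] j by (simp add: inner_commute)
    qed
    then have "orthogonal x y" if "y \<in> span B" for y
      using orthogonal_to_span[OF that] by (auto simp: orthogonal_def)
    then show "x = 0" using spanB orthogonal_self by blast
  qed
  then have "inj ((*v) A)"
    by (simp add: linear_injective_0)
  then have detA: "det A \<noteq> 0"
    by (metis invertible_det_nz invertible_left_inverse matrix_left_invertible_injective)
  have intA: "A $ i $ j \<in> \<int>" for i j by (simp add: A_def)
  obtain d where d: "det A = of_int d"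
    using det_Ints[of A] intA by (auto elim: Ints_cases)
  have "\<exists>q. \<forall>j. rvec (bs ! h j) \<bullet> rvec q = (if i = j then det A else 0)" for i
  proof -
    \<comment> \<open>\<open>y\<close> is \<open>det A\<close> times Cramer's solution of
      \<open>A *v x = axis i 1\<close>; its entries are determinants of integral matrices.\<close>
    define y :: "real ^ 'n" where
      "y = (\<chi> k. det (\<chi> i' j. if j = k then (axis i 1 :: real ^ 'n) $ i' else A $ i' $ j))"
    have "A *v ((1 / det A) *\<^sub>R y) = axis i 1"
      unfolding cramer[OF detA] by (simp add: y_def vec_eq_iff)
    then have "A *v y = det A *\<^sub>R axis i 1"
      using detA by (simp add: matrix_vector_mult_scaleR flip: divideR_right)
    then have y: "rvec (bs ! h j) \<bullet> y = (if i = j then det A else 0)" for j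
      using A_mult[of y j] by (auto simp: axis_def)
    have "y $ k \<in> \<int>" for k
      unfolding y_def vec_lambda_beta by (rule det_Ints) (auto simp: axis_def intA)
    then have "\<exists>z. y $ k = of_int z" for k
      by (metis Ints_cases)
    then obtain z where "\<And>k. y $ k = of_int (z k)" by metis
    then have "y = rvec (\<chi> k. z k)" by (simp add: vec_eq_iff)
    then show ?thesis using y by metis
  qed
  then obtain q0 where q0: "\<And>i j. rvec (bs ! h j) \<bullet> rvec (q0 i) = (if i = j then det A else 0)"
    by metis
  define q where "q k = q0 (inv_into UNIV h k)" for k
  have "lpair (q i) (bs ! j) = (if i = j then d else 0)" if ij: "i < CARD('n)" "j < CARD('n)" for i j
  proof -
    obtain i' j' where i': "i = h i'" "j = h j'"
      using ij h by (metis bij_betw_imp_surj_on atLeastLessThan_iff imageE le0)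
    have "q i = q0 i'" using i' h by (simp add: q_def bij_betw_def)
    then have "real_of_int (lpair (q i) (bs ! j)) = (if i' = j' then of_int d else 0)"
      using q0[of j' i'] i' d by (metis inner_commute inner_rvec)
    moreover have "i' = j' \<longleftrightarrow> i = j"
      using i' h by (auto simp: bij_betw_def inj_on_def)
    ultimately show ?thesis
      using of_int_eq_iff by fastforce
  qed
  moreover have "d \<noteq> 0" using detA d by auto
  ultimately show thesis
    using that[of es' d q] len spanB imS setbs by (simp add: bs_def)
qed

text \<open>The functionals vanishing on a given set of lattice vectors have a basis of lattice vectors; after
  scaling, the coordinates with respect to it can be rounded to integers.\<close>

lemma lattice_approx:
  fixes a :: "real ^ 'n::finite" and A :: "'n lat set"
  assumes "finite A" "finite Y"
  obtains m where "\<And>x. x \<in> A \<Longrightarrow> a \<bullet> rvec x = 0 \<Longrightarrow> lpair m x = 0"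
    "\<And>y. y \<in> Y \<Longrightarrow> a \<bullet> y > 0 \<Longrightarrow> rvec m \<bullet> y > 0"
proof -
  define Z where "Z = {x\<in>A. a \<bullet> rvec x = 0}"
  obtain B where B: "B \<subseteq> rvec ` Z" "independent B" "rvec ` Z \<subseteq> span B"
    using maximal_independent_subset by blast
  have "finite {u. rvec u \<in> B}"
    using assms(1) B(1) by (rule_tac finite_subset[of _ A]) (auto simp: Z_def)
  then obtain es where es: "set es = {u. rvec u \<in> B}" "distinct es"
    using finite_distinct_list by blast
  have imes: "rvec ` set es = B" using B(1) es by auto
  obtain es' q d where len: "length (es @ es') = CARD('n)" and "d \<noteq> 0"
    and dual: "\<And>i j. i < CARD('n) \<Longrightarrow> j < CARD('n) \<Longrightarrow>
        lpair (q i) ((es @ es') ! j) = (if i = j then d else 0)"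
    and span: "span (rvec ` set (es @ es')) = UNIV"
    by (rule lattice_dual_basis[OF es(2), unfolded imes, OF B(2)]) (rule that)
  define bs where "bs = es @ es'"
  \<comment> \<open>\<open>t j\<close> is the coefficient of \<open>q j\<close> in \<open>a\<close>,
    because \<open>q j\<close> pairs to \<open>d\<close> with \<open>bs ! j\<close> and to 0 with
    the other basis vectors.\<close>
  define t where "t j = (a \<bullet> rvec (bs ! j)) / d" for j
  let ?n = "CARD('n)"
  have "(a - (\<Sum>j<?n. t j *\<^sub>R rvec (q j))) \<bullet> b = 0" if b: "b \<in> rvec ` set bs" for b
  proof -
    obtain i where i: "i < ?n" "b = rvec (bs ! i)"
      using b len by (auto simp: bs_def[symmetric] in_set_conv_nth)
    have "(\<Sum>j<?n. t j *\<^sub>R rvec (q j)) \<bullet> b = (\<Sum>j<?n. t j * (if j = i then d else 0))"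
      using i by (simp add: inner_sum_left inner_rvec bs_def dual if_distrib[of of_int] cong: if_cong)
    also have "\<dots> = t i * d"
      using i by (simp add: if_distrib cong: if_cong)
    finally show ?thesis
      using i \<open>d \<noteq> 0\<close> by (simp add: t_def inner_diff_left)
  qed
  then have "orthogonal (a - (\<Sum>j<?n. t j *\<^sub>R rvec (q j))) y" for y
    using orthogonal_to_span[of y "rvec ` set bs"] span by (auto simp: orthogonal_def bs_def)
  then have a: "a = (\<Sum>j<?n. t j *\<^sub>R rvec (q j))"
    using orthogonal_self right_minus_eq by blast
  have t0: "t j = 0" if "j < length es" for j
  proof -
    have "rvec (bs ! j) \<in> rvec ` Z"
      using that B(1) imes by (auto simp: bs_def nth_append)
    then show ?thesis by (auto simp: t_def Z_def)
  qed
  \<comment> \<open>Coefficients that vanish stay 0 under rounding, so \<open>m N\<close> still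
    vanishes on \<open>Z\<close>; the others approximate \<open>N\<close> times \<open>a\<close>
    with an error bounded independently of \<open>N\<close>.\<close>
  define m where "m N = (\<Sum>j<?n. \<lfloor>real N * t j\<rfloor> *s q j)" for N
  have zero: "lpair (m N) x = 0" if x: "x \<in> Z" for x N
  proof -
    have "rvec (m N) \<bullet> b = 0" if b: "b \<in> B" for b
    proof -
      obtain i where i: "i < length es" "b = rvec (bs ! i)"
        using b imes by (auto simp: bs_def in_set_conv_nth nth_append)
      have "lpair (m N) (bs ! i) = (\<Sum>j<?n. \<lfloor>real N * t j\<rfloor> * (if j = i then d else 0))"
        using dual i len by (simp add: m_def lpair_sum_left lpair_scale_left bs_def)
      also have "\<dots> = 0"
        using t0[OF i(1)] by (intro sum.neutral) auto
      finally show ?thesis using i by (simp add: inner_rvec)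
    qed
    then have "orthogonal (rvec (m N)) (rvec x)"
      unfolding orthogonal_def[symmetric]
    proof (rule orthogonal_to_span[rotated])
      show "rvec x \<in> span B" using x B(3) by blast
    qed
    then show ?thesis
      by (simp add: orthogonal_def inner_rvec)
  qed
  have "\<forall>\<^sub>F N in sequentially. a \<bullet> y > 0 \<longrightarrow> rvec (m N) \<bullet> y > 0" for y
  proof (cases "a \<bullet> y > 0")
    case True
    define K where "K = (\<Sum>j<?n. \<bar>rvec (q j) \<bullet> y\<bar>)"
    have "\<forall>\<^sub>F N in sequentially. real N > K / (a \<bullet> y)"
      using filterlim_real_sequentially by (auto simp: filterlim_at_top_dense)
    then show ?thesis
    proof eventually_elim
      case (elim N)
      have "\<bar>rvec (m N) \<bullet> y - N * (a \<bullet> y)\<bar> =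
          \<bar>\<Sum>j<?n. (real_of_int \<lfloor>real N * t j\<rfloor> - N * t j) * (rvec (q j) \<bullet> y)\<bar>"
        by (subst a) (simp add: m_def rvec_sum rvec_scale inner_sum_left sum_distrib_left
            left_diff_distrib sum_subtractf mult.assoc)
      also have "\<dots> \<le> (\<Sum>j<?n. \<bar>real_of_int \<lfloor>real N * t j\<rfloor> - N * t j\<bar> * \<bar>rvec (q j) \<bullet> y\<bar>)"
        by (rule order_trans[OF sum_abs]) (simp add: abs_mult)
      also have "\<dots> \<le> (\<Sum>j<?n. 1 * \<bar>rvec (q j) \<bullet> y\<bar>)"
        by (intro sum_mono mult_right_mono) linarith+
      finally have "\<bar>rvec (m N) \<bullet> y - N * (a \<bullet> y)\<bar> \<le> K" by (simp add: K_def)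
      moreover have "N * (a \<bullet> y) > K" using elim True by (simp add: field_simps)
      ultimately show ?case by linarith
    qed
  qed simp
  then have "\<forall>\<^sub>F N in sequentially. \<forall>y\<in>Y. a \<bullet> y > 0 \<longrightarrow> rvec (m N) \<bullet> y > 0"
    using assms(2) by (simp add: eventually_ball_finite)
  then obtain N where "\<forall>y\<in>Y. a \<bullet> y > 0 \<longrightarrow> rvec (m N) \<bullet> y > 0"
    using eventually_happens trivial_limit_sequentially by blast
  with zero show thesis
    by (intro that[of "m N"]) (auto simp: Z_def)
qed

section \<open>Rational polyhedral cones and their dual monoids\<close>

lemma convex_cone_hull_nonneg_iff:
  "(\<forall>y\<in>convex_cone hull S. 0 \<le> a \<bullet> y) \<longleftrightarrow> (\<forall>y\<in>S. 0 \<le> a \<bullet> y)"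
proof
  assume "\<forall>y\<in>S. 0 \<le> a \<bullet> y"
  then have "convex_cone hull S \<subseteq> {y. 0 \<le> a \<bullet> y}"
    by (intro hull_minimal) (auto simp: convex_cone_halfspace_ge)
  then show "\<forall>y\<in>convex_cone hull S. 0 \<le> a \<bullet> y" by blast
qed (auto intro: hull_inc)

lemma convex_cone_hull_insertE:
  assumes "y \<in> convex_cone hull (insert x S)"
  obtains c z where "c \<ge> 0" "z \<in> convex_cone hull S" "y = c *\<^sub>R x + z"
proof -
  have "convex_cone hull (insert x S) \<subseteq> {c *\<^sub>R x + z | c z. c \<ge> 0 \<and> z \<in> convex_cone hull S}"
    (is "_ \<subseteq> ?R")
  proof (rule hull_minimal)
    show "insert x S \<subseteq> ?R"
    proof
      fix y assume "y \<in> insert x S"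
      then show "y \<in> ?R"
      proof
        assume "y = x"
        then show ?thesis
          by (intro CollectI exI[of _ 1] exI[of _ 0]) (auto simp: convex_cone_hull_contains_0)
      next
        assume "y \<in> S"
        then show ?thesis
          by (intro CollectI exI[of _ 0] exI[of _ y]) (auto simp: hull_inc)
      qed
    qed
    show "convex_cone ?R"
    proof (rule convex_cone_iff[THEN iffD2], intro conjI ballI allI impI)
      have "0 = 0 *\<^sub>R x + 0" by simp
      then show "0 \<in> ?R"
        using convex_cone_hull_contains_0[of S] by blast
      fix y assume "y \<in> ?R"
      then obtain c z where y: "y = c *\<^sub>R x + z" "c \<ge> 0" "z \<in> convex_cone hull S" by blast
      show "b *\<^sub>R y \<in> ?R" if "b \<ge> 0" for b
        using y that by (intro CollectI exI[of _ "b * c"] exI[of _ "b *\<^sub>R z"])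
          (auto simp: scaleR_add_right intro: convex_cone_hull_mul)
      fix y' assume "y' \<in> ?R"
      then obtain c' z' where y': "y' = c' *\<^sub>R x + z'" "c' \<ge> 0" "z' \<in> convex_cone hull S" by blast
      show "y + y' \<in> ?R"
        using y y' by (intro CollectI exI[of _ "c + c'"] exI[of _ "z + z'"])
          (auto simp: scaleR_add_left intro: convex_cone_hull_add)
    qed
  qed
  then show thesis using assms that by blast
qed

lemma dual_monoid_0 [simp]: "0 \<in> dual_monoid \<sigma>"
  by (simp add: dual_monoid_def)

lemma dual_monoid_add: "m \<in> dual_monoid \<sigma> \<Longrightarrow> m' \<in> dual_monoid \<sigma> \<Longrightarrow> m + m' \<in> dual_monoid \<sigma>"
  by (simp add: dual_monoid_def rvec_add inner_add_left)

lemma dual_monoid_scale: "m \<in> dual_monoid \<sigma> \<Longrightarrow> int N *s m \<in> dual_monoid \<sigma>"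
  by (simp add: dual_monoid_def rvec_scale)

lemma dual_monoid_antimono: "\<tau> \<subseteq> \<sigma> \<Longrightarrow> dual_monoid \<sigma> \<subseteq> dual_monoid \<tau>"
  by (auto simp: dual_monoid_def)

lemma dual_monoid_hull: "dual_monoid (convex_cone hull (rvec ` A)) = {m. \<forall>x\<in>A. 0 \<le> lpair m x}"
  by (simp add: dual_monoid_def convex_cone_hull_nonneg_iff inner_rvec)

lemma dual_monoid_zero_cone [simp]: "dual_monoid {0} = UNIV"
  by (simp add: dual_monoid_def)

text \<open>A separating real functional exists since a finitely generated cone is closed and
  convex; \<open>lattice_approx\<close> replaces it by an integral one with the same signs on the
  generators and at \<open>y\<close>.\<close>

lemma lattice_separation:
  assumes "rational_polyhedral_cone \<sigma>" "y \<notin> \<sigma>"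
  obtains m where "m \<in> dual_monoid \<sigma>" "rvec m \<bullet> y < 0"
proof -
  obtain A where A: "finite A" "\<sigma> = convex_cone hull (rvec ` A)"
    using assms(1) unfolding rational_polyhedral_cone_def by blast
  have "convex \<sigma>" "closed \<sigma>"
    using A by (auto simp: convex_convex_cone_hull closed_convex_cone_hull)
  then obtain a b where ab: "a \<bullet> y < b" "\<And>x. x \<in> \<sigma> \<Longrightarrow> b < a \<bullet> x"
    using separating_hyperplane_closed_point[of \<sigma> y] assms(2) by auto
  have "b < 0" using ab(2)[of 0] A by (simp add: convex_cone_hull_contains_0)
  have nonneg: "0 \<le> a \<bullet> x" if "x \<in> \<sigma>" for x
  proof (rule ccontr)
    assume neg: "\<not> 0 \<le> a \<bullet> x"
    \<comment> \<open>Rescaled so that the value of \<open>a\<close> is exactly \<open>b\<close>,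
      contradicting the strict inequality on \<open>\<sigma>\<close>.\<close>
    then have "(b / (a \<bullet> x)) *\<^sub>R x \<in> \<sigma>"
      using that A \<open>b < 0\<close> by (auto intro!: convex_cone_hull_mul divide_nonpos_nonpos)
    from ab(2)[OF this] show False using neg by simp
  qed
  obtain m where m: "\<And>x. x \<in> A \<Longrightarrow> a \<bullet> rvec x = 0 \<Longrightarrow> lpair m x = 0"
    "\<And>z. z \<in> insert (- y) (rvec ` A) \<Longrightarrow> a \<bullet> z > 0 \<Longrightarrow> rvec m \<bullet> z > 0"
    using lattice_approx[OF A(1), of "insert (- y) (rvec ` A)" a] A(1) by blast
  have "0 \<le> lpair m x" if "x \<in> A" for x
    using m(1)[OF that] m(2)[of "rvec x"] nonneg[of "rvec x"] that A(2)
    by (cases "a \<bullet> rvec x = 0") (auto simp: inner_rvec hull_inc less_le)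
  then have "m \<in> dual_monoid \<sigma>"
    by (simp add: A(2) dual_monoid_hull)
  moreover have "rvec m \<bullet> y < 0"
    using m(2)[of "- y"] ab(1) \<open>b < 0\<close> by simp
  ultimately show thesis by (rule that)
qed

text \<open>Faces of a polyhedron are exposed by a real functional, which can be replaced by an
  integral one vanishing on the same generators of the cone.\<close>

lemma lattice_exposed_face:
  assumes "rational_polyhedral_cone \<sigma>" "\<tau> face_of \<sigma>" "\<tau> \<noteq> {}"
  obtains m where "m \<in> dual_monoid \<sigma>" "\<tau> = \<sigma> \<inter> {y. rvec m \<bullet> y = 0}"
proof -
  obtain A where A: "finite A" "\<sigma> = convex_cone hull (rvec ` A)"
    using assms(1) unfolding rational_polyhedral_cone_def by blast
  then have "polyhedron \<sigma>" by (simp add: polyhedron_convex_cone_hull)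
  then have "\<tau> exposed_face_of \<sigma>"
    using assms(2) by (simp add: exposed_face_of_polyhedron)
  then obtain a b where ab: "\<sigma> \<subseteq> {x. a \<bullet> x \<le> b}" "\<tau> = \<sigma> \<inter> {x. a \<bullet> x = b}"
    unfolding exposed_face_of_def by blast
  have cone: "c *\<^sub>R x \<in> \<sigma>" if "x \<in> \<sigma>" "c \<ge> 0" for c x
    using that A(2) by (simp add: convex_cone_hull_mul)
  obtain x0 where x0: "x0 \<in> \<sigma>" "a \<bullet> x0 = b" using ab assms(3) by auto
  \<comment> \<open>The value at \<open>x0\<close> is the maximum of \<open>a\<close> on the cone,
    and the multiples of \<open>x0\<close> by 0 and by 2 also lie in the cone.\<close>
  have "b = 0"
  proof -
    have "a \<bullet> (2 *\<^sub>R x0) \<le> b" "a \<bullet> (0 *\<^sub>R x0) \<le> b"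
      using ab(1) cone[OF x0(1), of 2] cone[OF x0(1), of 0] by auto
    then show ?thesis using x0(2) by simp
  qed
  obtain m where m: "\<And>x. x \<in> A \<Longrightarrow> (- a) \<bullet> rvec x = 0 \<Longrightarrow> lpair m x = 0"
    "\<And>z. z \<in> rvec ` A \<Longrightarrow> (- a) \<bullet> z > 0 \<Longrightarrow> rvec m \<bullet> z > 0"
    using lattice_approx[OF A(1), of "rvec ` A" "- a"] A(1) by blast
  \<comment> \<open>Agreement of \<open>- a\<close> and \<open>m\<close> in sign and in zeros is
    closed under conic combinations on this set, so it need only be checked on generators.\<close>
  let ?R = "{y. a \<bullet> y \<le> 0 \<and> rvec m \<bullet> y \<ge> 0 \<and> (a \<bullet> y = 0 \<longleftrightarrow> rvec m \<bullet> y = 0)}"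
  have "convex_cone ?R"
    unfolding convex_cone_iff
  proof (intro conjI ballI allI impI)
    fix x y assume "x \<in> ?R" "y \<in> ?R"
    then show "x + y \<in> ?R" unfolding mem_Collect_eq inner_add_right by linarith
  qed (auto simp: mult_nonneg_nonpos)
  moreover have "rvec ` A \<subseteq> ?R"
  proof clarify
    fix x assume "x \<in> A"
    moreover have "a \<bullet> rvec x \<le> 0"
      using \<open>x \<in> A\<close> ab(1) A(2) \<open>b = 0\<close> hull_inc[of "rvec x" "rvec ` A" convex_cone] by auto
    ultimately show "a \<bullet> rvec x \<le> 0 \<and> rvec m \<bullet> rvec x \<ge> 0 \<and> (a \<bullet> rvec x = 0 \<longleftrightarrow> rvec m \<bullet> rvec x = 0)"
      using m(1)[of x] m(2)[of "rvec x"] by (cases "a \<bullet> rvec x = 0") (auto simp: inner_rvec)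
  qed
  ultimately have R: "\<sigma> \<subseteq> ?R" unfolding A(2) by (rule hull_minimal[rotated])
  show thesis
  proof (rule that)
    show "m \<in> dual_monoid \<sigma>" using R by (auto simp: dual_monoid_def)
    show "\<tau> = \<sigma> \<inter> {y. rvec m \<bullet> y = 0}" using R ab(2) \<open>b = 0\<close> by auto
  qed
qed

text \<open>If a positive combination of \<open>a\<close> and \<open>b\<close> is 0, each weighted
  summand is the negative of the other, so it lies in the lineality space, which is trivial.\<close>

lemma strongly_convex_zero_face:
  assumes "convex_cone \<sigma>" "strongly_convex \<sigma>"
  shows "{0} face_of \<sigma>"
  unfolding face_of_def
proof (intro conjI ballI impI)
  show "{0} \<subseteq> \<sigma>" using assms(1) by (simp add: convex_cone_contains_0)
  fix a b x assume ab: "a \<in> \<sigma>" "b \<in> \<sigma>" "x \<in> {0::real ^ 'a}" "x \<in> open_segment a b"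
  then obtain u where u: "0 < u" "u < 1" "(1 - u) *\<^sub>R a + u *\<^sub>R b = 0"
    by (auto simp: in_segment)
  have "(1 - u) *\<^sub>R a \<in> \<sigma>" "u *\<^sub>R b \<in> \<sigma>"
    using u ab assms(1) by (auto intro: convex_cone_scaleR)
  moreover have "(1 - u) *\<^sub>R a = - (u *\<^sub>R b)" "u *\<^sub>R b = - ((1 - u) *\<^sub>R a)"
    using u(3) by (simp_all add: eq_neg_iff_add_eq_0 add.commute)
  ultimately have "(1 - u) *\<^sub>R a \<in> \<sigma> \<inter> uminus ` \<sigma>" "u *\<^sub>R b \<in> \<sigma> \<inter> uminus ` \<sigma>"
    by blast+
  then show "a \<in> {0}" "b \<in> {0}"
    using assms(2) u unfolding strongly_convex_def by auto
qed simp

text \<open>By strong convexity some \<open>m0\<close> in the dual monoid is positive on every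
  nonzero generator, so a large multiple of it outweighs any \<open>m\<close>. This reduces
  contractions with arbitrary characters to regular ones.\<close>

lemma dual_monoid_generates:
  assumes "rational_polyhedral_cone \<sigma>" "strongly_convex \<sigma>"
  obtains a b where "a \<in> dual_monoid \<sigma>" "b \<in> dual_monoid \<sigma>" "m = a - b"
proof -
  obtain A where A: "finite A" "\<sigma> = convex_cone hull (rvec ` A)"
    using assms(1) unfolding rational_polyhedral_cone_def by blast
  have "{0} face_of \<sigma>"
    using A assms(2) by (simp add: strongly_convex_zero_face convex_cone_convex_cone_hull)
  then obtain m0 where m0: "m0 \<in> dual_monoid \<sigma>" "{0} = \<sigma> \<inter> {y. rvec m0 \<bullet> y = 0}"
    using lattice_exposed_face[OF assms(1), of "{0}"] by blast
  define N where "N = nat (\<Sum>x\<in>A. \<bar>lpair m x\<bar>)"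
  have "0 \<le> lpair (m + int N *s m0) x" if x: "x \<in> A" for x
  proof (cases "x = 0")
    case False
    have "rvec x \<in> \<sigma>" using x A(2) by (simp add: hull_inc)
    then have "rvec m0 \<bullet> rvec x \<noteq> 0"
      using m0(2) False by (metis (mono_tags, lifting) IntI mem_Collect_eq rvec_eq_0_iff singletonD)
    then have "lpair m0 x \<noteq> 0" "lpair m0 x \<ge> 0"
      using m0(1) A(2) x by (auto simp: inner_rvec dual_monoid_hull)
    then have "int N * 1 \<le> int N * lpair m0 x"
      by (intro mult_left_mono) auto
    moreover have "\<bar>lpair m x\<bar> \<le> (\<Sum>x\<in>A. \<bar>lpair m x\<bar>)"
      using x A(1) by (intro member_le_sum) auto
    ultimately show ?thesis
      by (simp add: lpair_add_left lpair_scale_left N_def)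
  qed simp
  then have "m + int N *s m0 \<in> dual_monoid \<sigma>"
    by (simp add: A(2) dual_monoid_hull)
  then show thesis
    using m0(1) by (intro that[of "m + int N *s m0" "int N *s m0"]) (auto intro: dual_monoid_scale)
qed

text \<open>The values \<open>lpair m a\<close> form an ideal of the integers. Its least positive
  element divides all coordinates of \<open>a\<close>, and a functional attaining it takes the value
  1 on the quotient, so \<open>u\<close> is primitive.\<close>

lemma primitive_decomposition:
  fixes a :: "'n::finite lat"
  assumes "a \<noteq> 0"
  obtains u m g where "g > 0" "a = int g *s u" "lpair m u = 1"
proof -
  define P where "P g \<longleftrightarrow> g > 0 \<and> (\<exists>m. lpair m a = int g)" for g
  obtain i where i: "a $ i \<noteq> 0" using assms by (auto simp: vec_eq_iff)
  have "lpair (sgn (a $ i) *s axis i 1) a = int (nat \<bar>a $ i\<bar>)"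
    by (simp add: lpair_scale_left lpair_axis sgn_if)
  then have "P (nat \<bar>a $ i\<bar>)" using i by (auto simp: P_def)
  then have "P (LEAST g. P g)" by (rule LeastI)
  then obtain g m0 where g: "g = (LEAST g. P g)" "g > 0" "lpair m0 a = int g"
    by (auto simp: P_def)
  have dvd: "int g dvd lpair m a" for m
  proof (rule ccontr)
    assume "\<not> int g dvd lpair m a"
    then have r: "lpair m a mod int g > 0"
      using g(2) pos_mod_sign[of "int g" "lpair m a"] unfolding dvd_eq_mod_eq_0 by linarith
    have "lpair (m - (lpair m a div int g) *s m0) a = lpair m a mod int g"
      using g(3) by (simp add: lpair_diff_left lpair_scale_left minus_div_mult_eq_mod)
    then have "P (nat (lpair m a mod int g))"
      using r by (auto simp: P_def)
    then have "g \<le> nat (lpair m a mod int g)" unfolding g(1) by (rule Least_le)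
    moreover have "lpair m a mod int g < int g" using g(2) by simp
    ultimately show False using r by linarith
  qed
  define u where "u = (\<chi> i. a $ i div int g)"
  have "int g dvd a $ i" for i using dvd[of "axis i 1"] by (simp add: lpair_axis)
  then have a: "a = int g *s u" by (simp add: vec_eq_iff u_def)
  then have "int g * lpair m0 u = int g * 1"
    using g(3) by (metis lpair_scale_right mult.right_neutral)
  then have "lpair m0 u = 1" using g(2) by simp
  then show thesis using that g(2) a by blast
qed

text \<open>The functional with value 1 identifies the lattice points of the ray: if
  \<open>c\<close> times the generator is a lattice point, then \<open>c\<close> is a value of
  \<open>m\<close> and hence an integer.\<close>

lemma ray_prim_gen:
  assumes "rational_polyhedral_cone \<alpha>" "strongly_convex \<alpha>" "aff_dim \<alpha> = 1"
  obtains m where "lpair m (prim_gen \<alpha>) = 1" "\<alpha> = {c *\<^sub>R rvec (prim_gen \<alpha>) | c. c \<ge> 0}"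
proof -
  obtain A where A: "finite A" "\<alpha> = convex_cone hull (rvec ` A)"
    using assms(1) unfolding rational_polyhedral_cone_def by blast
  have "\<exists>a\<in>A. a \<noteq> 0"
  proof (rule ccontr)
    assume "\<not> (\<exists>a\<in>A. a \<noteq> 0)"
    then have "rvec ` A \<subseteq> {0}" by auto
    then have "\<alpha> \<subseteq> {0}" unfolding A(2) by (rule hull_minimal) simp
    then have "aff_dim \<alpha> \<le> 0" using aff_dim_subset aff_dim_sing by metis
    then show False using assms(3) by simp
  qed
  then obtain a where a: "a \<in> A" "a \<noteq> 0" by blast
  obtain e m g where e: "g > 0" "a = int g *s e" "lpair m e = 1"
    by (rule primitive_decomposition[OF a(2)])
  have "rvec a \<in> \<alpha>" using a A(2) by (simp add: hull_inc)
  moreover have "rvec e = (1 / real g) *\<^sub>R rvec a" using e by (simp add: rvec_scale)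
  ultimately have e\<alpha>: "c *\<^sub>R rvec e \<in> \<alpha>" if "c \<ge> 0" for c
    using that A(2) by (auto intro!: convex_cone_hull_mul)
  have e0: "e \<noteq> 0" using e(3) by auto
  have "0 \<in> \<alpha>" using A(2) by (simp add: convex_cone_hull_contains_0)
  then have "dim \<alpha> = 1"
    using assms(3) aff_dim_zero[of \<alpha>] by (simp add: hull_inc)
  then have "span {rvec e} = span \<alpha>"
    using e0 e\<alpha>[of 1] by (intro dim_eq_span) (auto simp: dim_insert)
  have \<alpha>: "\<alpha> = {c *\<^sub>R rvec e | c. c \<ge> 0}"
  proof
    show "\<alpha> \<subseteq> {c *\<^sub>R rvec e | c. c \<ge> 0}"
    proof
      fix y assume y: "y \<in> \<alpha>"
      then have "y \<in> span {rvec e}" using \<open>span {rvec e} = span \<alpha>\<close> span_base by blast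
      then obtain c where c: "y = c *\<^sub>R rvec e" by (auto simp: span_singleton)
      have "c \<ge> 0"
      proof (rule ccontr)
        assume "\<not> c \<ge> 0"
        then have "- y \<in> \<alpha>" using e\<alpha>[of "- c"] c by simp
        then have "y \<in> \<alpha> \<inter> uminus ` \<alpha>" using y by force
        then have "y = 0" using assms(2) by (auto simp: strongly_convex_def)
        then show False using c e0 \<open>\<not> c \<ge> 0\<close> by simp
      qed
      with c show "y \<in> {c *\<^sub>R rvec e | c. c \<ge> 0}" by blast
    qed
  qed (use e\<alpha> in auto)
  have "{w. rvec w \<in> \<alpha>} = range (\<lambda>c::nat. int c *s e)"
  proof (intro equalityI subsetI)
    fix w assume "w \<in> {w. rvec w \<in> \<alpha>}"
    then obtain c where c: "c \<ge> 0" "rvec w = c *\<^sub>R rvec e" using \<alpha> by auto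
    have "real_of_int (lpair m w) = c"
      using c e(3) by (metis inner_rvec inner_scaleR_right mult.right_neutral of_int_1)
    then have "rvec w = rvec (int (nat (lpair m w)) *s e)"
      using c by (simp add: rvec_scale)
    then have "w = int (nat (lpair m w)) *s e" by (simp only: rvec_eq_iff)
    then show "w \<in> range (\<lambda>c::nat. int c *s e)" by blast
  qed (use e\<alpha> in \<open>auto simp: rvec_scale\<close>)
  \<comment> \<open>Two generators of the same monoid are multiples of each other, with nonnegative
    integer factors of product 1.\<close>
  moreover have "u = e" if "range (\<lambda>c::nat. int c *s u) = range (\<lambda>c::nat. int c *s e)" for u
  proof -
    have "int 1 *s u \<in> range (\<lambda>c::nat. int c *s e)" "int 1 *s e \<in> range (\<lambda>c::nat. int c *s u)"
      using that by blast+
    then obtain c c' :: nat where c: "u = int c *s e" "e = int c' *s u" unfolding image_iff vector_smult_lid of_nat_1 by blast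
    then have "int c' * int c = 1"
      using e(3) by (metis lpair_scale_right mult.right_neutral mult.assoc)
    then show "u = e" using c by (simp add: zmult_eq_1_iff)
  qed
  ultimately have "prim_gen \<alpha> = e"
    unfolding prim_gen_def by (intro the_equality) auto
  then show thesis using that \<alpha> e(3) by blast
qed

text \<open>If two elements of the cone add up to a multiple of \<open>x\<close>, so do their
  contributions from \<open>S\<close>. A positive multiple there would make \<open>x\<close>
  redundant; otherwise strong convexity makes both contributions 0.\<close>

lemma minimal_generator_ray:
  assumes \<sigma>: "\<sigma> = convex_cone hull (insert x S)" and "strongly_convex \<sigma>"
    and x: "x \<notin> convex_cone hull S"
  shows "{c *\<^sub>R x | c. c \<ge> 0} face_of \<sigma>" (is "?R face_of _")
  unfolding face_of_def
proof (intro conjI ballI impI)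
  have cone: "c *\<^sub>R x \<in> \<sigma>" if "c \<ge> 0" for c
    using that convex_cone_hull_mul[OF hull_inc, of x "insert x S" c] \<sigma> by simp
  then show "?R \<subseteq> \<sigma>" by auto
  have "convex_cone ?R"
    unfolding convex_cone_iff
  proof (intro conjI ballI allI impI)
    show "0 \<in> ?R" by (auto intro: exI[of _ 0])
    fix y assume "y \<in> ?R"
    then obtain c where c: "y = c *\<^sub>R x" "c \<ge> 0" by blast
    show "b *\<^sub>R y \<in> ?R" if "b \<ge> 0" for b
      using c that by (auto intro!: exI[of _ "b * c"])
    fix y' assume "y' \<in> ?R"
    then obtain c' where "y' = c' *\<^sub>R x" "c' \<ge> 0" by blast
    then show "y + y' \<in> ?R"
      using c by (auto intro!: exI[of _ "c + c'"] simp: scaleR_add_left)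
  qed
  then show "convex ?R" by (simp add: convex_cone_def)
  have sub: "convex_cone hull S \<subseteq> \<sigma>" unfolding \<sigma> by (rule hull_mono) auto
  have sum_in: "p \<in> ?R \<and> r \<in> ?R" if pr: "p \<in> \<sigma>" "r \<in> \<sigma>" "p + r = c *\<^sub>R x" for p r c
  proof -
    obtain c1 z1 where 1: "c1 \<ge> 0" "z1 \<in> convex_cone hull S" "p = c1 *\<^sub>R x + z1"
      using pr(1) convex_cone_hull_insertE unfolding \<sigma> by blast
    obtain c2 z2 where 2: "c2 \<ge> 0" "z2 \<in> convex_cone hull S" "r = c2 *\<^sub>R x + z2"
      using pr(2) convex_cone_hull_insertE unfolding \<sigma> by blast
    have eq: "z1 + z2 = (c - c1 - c2) *\<^sub>R x"
      using pr(3) 1 2 by (simp add: algebra_simps)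
    have "c - c1 - c2 \<le> 0"
    proof (rule ccontr)
      assume pos: "\<not> c - c1 - c2 \<le> 0"
      then have "x = (1 / (c - c1 - c2)) *\<^sub>R (z1 + z2)" unfolding eq by simp
      also have "\<dots> \<in> convex_cone hull S"
        using pos 1 2 by (intro convex_cone_hull_mul convex_cone_hull_add) auto
      finally show False using x by simp
    qed
    moreover have "z = 0" if "z \<in> convex_cone hull S" "z' \<in> convex_cone hull S"
      "z + z' = (c - c1 - c2) *\<^sub>R x" for z z'
    proof -
      have "- z = z' + (c1 + c2 - c) *\<^sub>R x"
        using that(3) by (simp add: algebra_simps eq_neg_iff_add_eq_0)
      also have "\<dots> \<in> \<sigma>"
        using that(2) sub cone[of "c1 + c2 - c"] \<open>c - c1 - c2 \<le> 0\<close> \<sigma>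
        by (auto intro!: convex_cone_hull_add)
      finally have "z \<in> \<sigma> \<inter> uminus ` \<sigma>" using that(1) sub by force
      then show "z = 0" using assms(2) by (auto simp: strongly_convex_def)
    qed
    ultimately have "z1 = 0" "z2 = 0"
      using 1 2 eq by (auto simp: add.commute)
    then show ?thesis using 1 2 by auto
  qed
  fix a b y assume ab: "a \<in> \<sigma>" "b \<in> \<sigma>" "y \<in> ?R" "y \<in> open_segment a b"
  obtain c where "y = c *\<^sub>R x" using ab(3) by blast
  moreover obtain u where "0 < u" "u < 1" "y = (1 - u) *\<^sub>R a + u *\<^sub>R b"
    using ab(4) by (auto simp: in_segment)
  ultimately have u: "0 < u" "u < 1" "(1 - u) *\<^sub>R a + u *\<^sub>R b = c *\<^sub>R x" by simp_all
  have "(1 - u) *\<^sub>R a \<in> \<sigma>" "u *\<^sub>R b \<in> \<sigma>"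
    using u ab(1,2) unfolding \<sigma> by (simp_all add: convex_cone_hull_mul)
  then have "(1 - u) *\<^sub>R a \<in> ?R" "u *\<^sub>R b \<in> ?R"
    using sum_in[OF _ _ u(3)] by blast+
  moreover have scale: "z \<in> ?R" if "c *\<^sub>R z \<in> ?R" "c > 0" for c z
  proof -
    have "(1 / c) *\<^sub>R (c *\<^sub>R z) \<in> ?R"
      by (rule convex_cone_scaleR[OF \<open>convex_cone ?R\<close> _ that(1)]) (use that(2) in simp)
    moreover have "(1 / c) *\<^sub>R (c *\<^sub>R z) = z" using that(2) by simp
    ultimately show ?thesis by (simp only:)
  qed
  ultimately show "a \<in> ?R" "b \<in> ?R" using u(1,2) scale[of "1 - u" a] scale[of u b] by simp_all
qed

section \<open>Fans\<close>

lemma fanD: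
  assumes "fan \<Delta>" "\<sigma> \<in> \<Delta>"
  shows "rational_polyhedral_cone \<sigma>" "strongly_convex \<sigma>" "convex_cone \<sigma>"
    and fan_face: "\<tau> face_of \<sigma> \<Longrightarrow> \<tau> \<noteq> {} \<Longrightarrow> \<tau> \<in> \<Delta>"
    and fan_inter: "\<tau> \<in> \<Delta> \<Longrightarrow> (\<sigma> \<inter> \<tau>) face_of \<sigma>"
proof -
  show "rational_polyhedral_cone \<sigma>" using assms by (simp add: fan_def)
  then show "convex_cone \<sigma>"
    unfolding rational_polyhedral_cone_def by (auto simp: convex_cone_convex_cone_hull)
qed (use assms in \<open>auto simp: fan_def\<close>)

lemma fan_zero: assumes "fan \<Delta>" shows "{0} \<in> \<Delta>"
proof -
  obtain \<sigma> where "\<sigma> \<in> \<Delta>" using assms by (auto simp: fan_def)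
  then show ?thesis
    using fanD[OF assms] strongly_convex_zero_face by blast
qed

lemma fan_contains_0: "fan \<Delta> \<Longrightarrow> \<sigma> \<in> \<Delta> \<Longrightarrow> 0 \<in> \<sigma>"
  by (simp add: fanD(3) convex_cone_contains_0)

lemma fan_rayE:
  assumes "fan \<Delta>" "\<alpha> \<in> rays \<Delta>"
  obtains m where "lpair m (prim_gen \<alpha>) = 1" "\<alpha> = {c *\<^sub>R rvec (prim_gen \<alpha>) | c. c \<ge> 0}"
  using ray_prim_gen[of \<alpha>] fanD[OF assms(1), of \<alpha>] assms(2) by (auto simp: rays_def)

lemma fan_ray_memE:
  assumes "fan \<Delta>" "\<alpha> \<in> rays \<Delta>" "y \<in> \<alpha>"
  obtains c where "c \<ge> 0" "y = c *\<^sub>R rvec (prim_gen \<alpha>)"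
proof -
  obtain m where "\<alpha> = {c *\<^sub>R rvec (prim_gen \<alpha>) | c. c \<ge> 0}"
    using fan_rayE[OF assms(1,2)] .
  then have "y \<in> {c *\<^sub>R rvec (prim_gen \<alpha>) | c. c \<ge> 0}" using assms(3) by (rule subst)
  then show thesis using that by blast
qed

lemma dual_monoid_ray:
  assumes "fan \<Delta>" "\<alpha> \<in> rays \<Delta>"
  shows "dual_monoid \<alpha> = {m. 0 \<le> lpair m (prim_gen \<alpha>)}"
proof -
  obtain m0 where "\<alpha> = {c *\<^sub>R rvec (prim_gen \<alpha>) | c. c \<ge> 0}"
    using fan_rayE[OF assms] by blast
  then have \<alpha>: "y \<in> \<alpha> \<longleftrightarrow> (\<exists>c\<ge>0. y = c *\<^sub>R rvec (prim_gen \<alpha>))" for y by blast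
  show ?thesis
  proof (intro equalityI subsetI)
    fix m assume "m \<in> dual_monoid \<alpha>"
    moreover have "rvec (prim_gen \<alpha>) \<in> \<alpha>" unfolding \<alpha> by (rule exI[of _ 1]) simp
    ultimately show "m \<in> {m. 0 \<le> lpair m (prim_gen \<alpha>)}"
      by (auto simp: dual_monoid_def inner_rvec)
  next
    fix m assume "m \<in> {m. 0 \<le> lpair m (prim_gen \<alpha>)}"
    then show "m \<in> dual_monoid \<alpha>"
      by (auto simp: dual_monoid_def \<alpha> inner_rvec)
  qed
qed

lemma prim_gen_nonzero: "fan \<Delta> \<Longrightarrow> \<alpha> \<in> rays \<Delta> \<Longrightarrow> prim_gen \<alpha> \<noteq> 0"
  by (metis fan_rayE lpair_0_right zero_neq_one)

text \<open>In a generating set of least cardinality no element is redundant, so each one spans a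
  ray that is a face of the cone and hence belongs to the fan. Each generator is a nonnegative
  multiple of the primitive one on its ray.\<close>

theorem fan_cone_generated_by_rays:
  assumes "fan \<Delta>" "\<sigma> \<in> \<Delta>"
  shows "\<sigma> = convex_cone hull (rvec ` prim_gen ` {\<alpha>\<in>rays \<Delta>. \<alpha> \<subseteq> \<sigma>})" (is "_ = ?H")
proof
  show "?H \<subseteq> \<sigma>"
  proof (rule hull_minimal)
    show "rvec ` prim_gen ` {\<alpha> \<in> rays \<Delta>. \<alpha> \<subseteq> \<sigma>} \<subseteq> \<sigma>"
    proof clarify
      fix \<alpha> assume "\<alpha> \<in> rays \<Delta>" "\<alpha> \<subseteq> \<sigma>"
      moreover have "1 *\<^sub>R rvec (prim_gen \<alpha>) \<in> \<alpha>"
        using fan_rayE[OF assms(1) \<open>\<alpha> \<in> rays \<Delta>\<close>] by (metis (mono_tags, lifting) mem_Collect_eq zero_le_one)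
      ultimately show "rvec (prim_gen \<alpha>) \<in> \<sigma>" by auto
    qed
  qed (rule fanD[OF assms])
  obtain A where A: "finite A" "\<sigma> = convex_cone hull (rvec ` A)"
    using fanD(1)[OF assms] unfolding rational_polyhedral_cone_def by blast
  define P where "P B \<longleftrightarrow> finite B \<and> \<sigma> = convex_cone hull (rvec ` B)" for B
  have "P A" using A by (simp add: P_def)
  then obtain B where B: "P B" "\<And>C. P C \<Longrightarrow> card B \<le> card C"
    using ex_has_least_nat[of P A card] by blast
  have "rvec x \<in> ?H" if x: "x \<in> B" for x
  proof -
    have ins: "insert (rvec x) (rvec ` (B - {x})) = rvec ` B" using x by auto
    have "rvec x \<notin> convex_cone hull (rvec ` (B - {x}))"
    proof
      assume "rvec x \<in> convex_cone hull (rvec ` (B - {x}))"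
      then have "P (B - {x})"
        using B(1) hull_redundant ins by (metis P_def finite_Diff)
      then have "card B \<le> card (B - {x})" by (rule B(2))
      moreover have "card B > 0" using x B(1) by (auto simp: P_def card_gt_0_iff)
      ultimately show False using x by simp
    qed
    moreover have "\<sigma> = convex_cone hull (insert (rvec x) (rvec ` (B - {x})))"
      using B(1) ins by (simp add: P_def)
    ultimately have face: "{c *\<^sub>R rvec x | c. c \<ge> 0} face_of \<sigma>" (is "?\<alpha> face_of _")
      using minimal_generator_ray fanD(2)[OF assms] by blast
    have "rvec x \<in> ?\<alpha>" by (auto intro: exI[of _ 1])
    then have "?\<alpha> \<in> \<Delta>" using fan_face[OF assms face] by blast
    have "x \<noteq> 0"
      using \<open>rvec x \<notin> _\<close> convex_cone_hull_contains_0[of "rvec ` (B - {x})"] by auto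
    have "0 \<in> ?\<alpha>" by (auto intro: exI[of _ 0])
    have "span ?\<alpha> = span {rvec x}"
    proof
      show "span ?\<alpha> \<subseteq> span {rvec x}"
        by (rule span_minimal) (auto intro: span_scale span_base)
      show "span {rvec x} \<subseteq> span ?\<alpha>"
        using \<open>rvec x \<in> ?\<alpha>\<close> by (intro span_mono) auto
    qed
    then have "dim (span ?\<alpha>) = dim (span {rvec x})" by (rule arg_cong)
    then have "dim ?\<alpha> = dim {rvec x}" unfolding dim_span .
    then have "aff_dim ?\<alpha> = 1"
      using aff_dim_zero[OF hull_inc[OF \<open>0 \<in> ?\<alpha>\<close>]] \<open>x \<noteq> 0\<close> by (simp add: dim_insert)
    then have ray: "?\<alpha> \<in> {\<alpha>\<in>rays \<Delta>. \<alpha> \<subseteq> \<sigma>}"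
      using \<open>?\<alpha> \<in> \<Delta>\<close> face face_of_imp_subset by (auto simp: rays_def)
    then have "?\<alpha> \<in> rays \<Delta>" by blast
    then obtain c where c: "c \<ge> 0" "rvec x = c *\<^sub>R rvec (prim_gen ?\<alpha>)"
      by (rule fan_ray_memE[OF assms(1) _ \<open>rvec x \<in> ?\<alpha>\<close>])
    moreover note c(1)
    moreover have "rvec (prim_gen ?\<alpha>) \<in> ?H"
      using ray by (intro hull_inc imageI)
    ultimately have "c *\<^sub>R rvec (prim_gen ?\<alpha>) \<in> ?H" by (intro convex_cone_hull_mul)
    then show ?thesis by (rule ssubst[OF c(2)])
  qed
  then show "\<sigma> \<subseteq> ?H"
    using B(1) hull_minimal[of "rvec ` B" ?H convex_cone] by (auto simp: P_def convex_cone_convex_cone_hull)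
qed

lemma fan_dual_monoid_iff:
  assumes "fan \<Delta>" "\<sigma> \<in> \<Delta>"
  shows "m \<in> dual_monoid \<sigma> \<longleftrightarrow> (\<forall>\<alpha>\<in>rays \<Delta>. \<alpha> \<subseteq> \<sigma> \<longrightarrow> 0 \<le> lpair m (prim_gen \<alpha>))"
  by (subst fan_cone_generated_by_rays[OF assms]) (auto simp: dual_monoid_hull)

section \<open>Points of the affine charts\<close>

lemma affine_chartD:
  assumes "x \<in> affine_chart \<sigma>"
  shows "x 0 = 1"
    and "m \<in> dual_monoid \<sigma> \<Longrightarrow> m' \<in> dual_monoid \<sigma> \<Longrightarrow> x (m + m') = x m * x m'"
    and "m \<notin> dual_monoid \<sigma> \<Longrightarrow> x m = 0"
  using assms by (auto simp: affine_chart_def)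

lemma affine_chart_scale:
  assumes "x \<in> affine_chart \<sigma>" "m \<in> dual_monoid \<sigma>"
  shows "x (int N *s m) = x m ^ N"
proof (induction N)
  case 0
  then show ?case using affine_chartD(1)[OF assms(1)] by simp
next
  case (Suc N)
  have "int (Suc N) *s m = m + int N *s m" by (simp add: vec_eq_iff algebra_simps)
  then show ?case
    using Suc affine_chartD(2)[OF assms] assms(2) by (simp add: dual_monoid_scale)
qed

lemma chart_incl_affine_chart:
  assumes "x \<in> affine_chart \<tau>" "\<tau> \<subseteq> \<sigma>"
  shows "chart_incl \<sigma> x \<in> affine_chart \<sigma>"
  using affine_chartD[OF assms(1)] dual_monoid_antimono[OF assms(2)]
  by (auto simp: affine_chart_def chart_incl_def dual_monoid_add subset_iff)

lemma chart_incl_self: "x \<in> affine_chart \<sigma> \<Longrightarrow> chart_incl \<sigma> x = x"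
  by (auto simp: chart_incl_def affine_chart_def)

section \<open>The torus and its characters\<close>

definition torus_point :: "complex ^ 'n \<Rightarrow> 'n::finite point" where
  "torus_point t = (\<lambda>m. character m t)"

lemma character_0 [simp]: "character 0 t = 1"
  by (simp add: character_def)

lemma character_add: "t \<in> torus \<Longrightarrow> character (m + m') t = character m t * character m' t"
  by (simp add: character_def torus_def power_int_add prod.distrib)

lemma character_nonzero: "t \<in> torus \<Longrightarrow> character m t \<noteq> 0"
  by (simp add: character_def torus_def)

lemma character_mult: "character m (\<chi> i. t $ i * s $ i) = character m t * character m s"
  by (simp add: character_def power_int_mult_distrib prod.distrib)

lemma character_inverse: "character m (\<chi> i. inverse (t $ i)) = inverse (character m t)"
  by (simp add: character_def power_int_inverse o_def flip: prod_inversef)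

lemma character_minus: "character (- m) t = inverse (character m t)"
  by (simp add: character_def power_int_minus o_def flip: prod_inversef)

lemma character_sum_list: "t \<in> torus \<Longrightarrow> character (sum_list ms) t = (\<Prod>m\<leftarrow>ms. character m t)"
  by (induction ms) (auto simp: character_add)

lemma torus_mult: "t \<in> torus \<Longrightarrow> s \<in> torus \<Longrightarrow> (\<chi> i. t $ i * s $ i) \<in> torus"
  by (simp add: torus_def)

lemma torus_inverse: "t \<in> torus \<Longrightarrow> (\<chi> i. inverse (t $ i)) \<in> torus"
  by (simp add: torus_def)

lemma torus_one: "(\<chi> i. 1) \<in> torus"
  by (simp add: torus_def)

lemma character_one [simp]: "character m (\<chi> i. 1) = 1"
  by (simp add: character_def)

lemma torus_exp: "(\<chi> i. exp (f i)) \<in> torus"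
  by (simp add: torus_def)

lemma character_exp:
  "character m (\<chi> i. exp (c * of_real (y $ i))) = exp (c * of_real (rvec m \<bullet> y))"
  by (simp add: character_def exp_power_int inner_vec_def sum_distrib_left exp_sum mult_ac)

lemma norm_character: "cmod (character m t) = (\<Prod>i\<in>UNIV. cmod (t $ i) powi m $ i)"
  by (simp add: character_def norm_power_int prod_norm flip: prod_norm)

lemma torus_point_affine_chart: "t \<in> torus \<Longrightarrow> torus_point t \<in> affine_chart {0}"
  by (simp add: affine_chart_def torus_point_def character_add)

text \<open>A homomorphism from the subgroup \<open>H\<close> of M to the nonzero complex numbers,
  given as a total function with unconstrained values outside \<open>H\<close>. Nonvanishing on
  \<open>H\<close> follows from \<open>f 0 = 1\<close> and closure under negation.\<close>

definition lattice_hom :: "'n::finite lat set \<Rightarrow> ('n lat \<Rightarrow> complex) \<Rightarrow> bool" where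
  "lattice_hom H f \<longleftrightarrow> 0 \<in> H \<and> (\<forall>h\<in>H. \<forall>h'\<in>H. h + h' \<in> H) \<and> (\<forall>h\<in>H. - h \<in> H) \<and>
     f 0 = 1 \<and> (\<forall>h\<in>H. \<forall>h'\<in>H. f (h + h') = f h * f h')"

lemma lattice_homD:
  assumes "lattice_hom H f"
  shows "0 \<in> H" "h \<in> H \<Longrightarrow> h' \<in> H \<Longrightarrow> h + h' \<in> H" "h \<in> H \<Longrightarrow> - h \<in> H"
    and "f 0 = 1" "h \<in> H \<Longrightarrow> h' \<in> H \<Longrightarrow> f (h + h') = f h * f h'"
  using assms by (auto simp: lattice_hom_def)

lemma lattice_hom_powi:
  assumes H: "lattice_hom H f" and "h \<in> H"
  shows "c *s h \<in> H" "f (c *s h) = f h powi c"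
proof -
  note hom = lattice_homD[OF H]
  have nat: "int N *s h \<in> H \<and> f (int N *s h) = f h ^ N" for N
  proof (induction N)
    case (Suc N)
    have "int (Suc N) *s h = h + int N *s h" by (simp add: vec_eq_iff algebra_simps)
    then show ?case using Suc hom(2,5) \<open>h \<in> H\<close> by simp
  qed (use hom in simp)
  have "c *s h \<in> H \<and> f (c *s h) = f h powi c"
  proof (cases "c \<ge> 0")
    case True
    then show ?thesis using nat[of "nat c"] by (simp add: power_int_def)
  next
    case False
    define N where "N = nat (- c)"
    have eq: "c *s h = - (int N *s h)" using False by (simp add: vec_eq_iff N_def)
    have "f (int N *s h) * f (- (int N *s h)) = 1"
      using hom(5)[of "int N *s h" "- (int N *s h)"] hom(3,4) nat by simp
    then have "f (- (int N *s h)) = inverse (f h ^ N)"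
      using nat[of N] inverse_unique[of "f h ^ N" "f (- (int N *s h))"] by simp
    then show ?thesis
      using False hom(3) nat[of N] by (simp add: eq power_int_def power_inverse flip: N_def)
  qed
  then show "c *s h \<in> H" "f (c *s h) = f h powi c" by auto
qed

lemma lattice_vec_expand: "m = (\<Sum>i\<in>UNIV. m $ i *s axis i 1)" for m :: "'n::finite lat"
  by (simp add: vec_eq_iff axis_def if_distrib cong: if_cong)

text \<open>The zero cone has the whole of M as dual monoid, so every value of the point is
  invertible; its values on the standard basis are the torus coordinates.\<close>

lemma affine_chart_zero_cone:
  assumes "x \<in> affine_chart {0}"
  obtains t where "t \<in> torus" "x = torus_point t"
proof -
  have x: "x 0 = 1" "\<And>m m'. x (m + m') = x m * x m'"
    using affine_chartD[OF assms] by auto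
  define t where "t = (\<chi> i. x (axis i 1))"
  have "x (axis i 1) * x (- axis i 1) = 1" for i
    using x by (metis add.right_inverse)
  then have t: "t \<in> torus" by (auto simp: torus_def t_def) (metis mult_zero_left zero_neq_one)
  have sum: "x (\<Sum>i\<in>K. g i) = (\<Prod>i\<in>K. x (g i))" for K :: "'a set" and g
    by (induction K rule: infinite_finite_induct) (auto simp: x)
  have "x m = torus_point t m" for m
  proof -
    have "x m = (\<Prod>i\<in>UNIV. x (m $ i *s axis i 1))"
      using sum lattice_vec_expand[of m] by metis
    also have "\<dots> = (\<Prod>i\<in>UNIV. x (axis i 1) powi m $ i)"
      by (rule prod.cong[OF refl], rule lattice_hom_powi(2)[of UNIV]) (auto simp: x lattice_hom_def)
    finally show ?thesis by (simp add: torus_point_def character_def t_def)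
  qed
  then show thesis using t that by blast
qed

text \<open>Divisibility of the group of nonzero complex numbers: if \<open>d\<close> is the least
  positive integer with \<open>d\<close> times \<open>u\<close> in \<open>H\<close>, the value at
  \<open>u\<close> is a \<open>d\<close>-th root of the prescribed value there; if no positive
  multiple lies in \<open>H\<close>, it can be 1.\<close>

lemma lattice_hom_extend_insert:
  assumes H: "lattice_hom H f"
  obtains H' f' where "lattice_hom H' f'" "H \<subseteq> H'" "u \<in> H'" "\<And>h. h \<in> H \<Longrightarrow> f' h = f h"
proof -
  note hom = lattice_homD[OF H]
  have fnz: "f h \<noteq> 0" if "h \<in> H" for h
    using hom(5)[of h "- h"] hom(4) hom(3) that by auto
  obtain z where z: "z \<noteq> 0" "\<And>c. c *s u \<in> H \<Longrightarrow> f (c *s u) = z powi c"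
  proof (cases "\<exists>d>0. int d *s u \<in> H")
    case False
    have "c = 0" if c: "c *s u \<in> H" for c
    proof (rule ccontr)
      assume "c \<noteq> 0"
      have "- (c *s u) = (- c) *s u" by (simp add: vec_eq_iff)
      then have "(- c) *s u \<in> H" using hom(3)[OF c] by simp
      then have "int (nat \<bar>c\<bar>) *s u \<in> H" using c by (cases "c \<ge> 0") auto
      then show False using False \<open>c \<noteq> 0\<close> by (metis zero_less_abs_iff zero_less_nat_eq)
    qed
    then show thesis using that[of 1] hom(4) by force
  next
    case True
    define d where "d = (LEAST d. d > 0 \<and> int d *s u \<in> H)"
    have d: "d > 0" "int d *s u \<in> H"
      using LeastI_ex[OF True] by (auto simp: d_def)
    define z where "z = exp (Ln (f (int d *s u)) / of_nat d)"
    have zd: "z ^ d = f (int d *s u)"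
      using d(1) fnz[OF d(2)] by (simp add: z_def flip: exp_of_nat_mult)
    have "f (c *s u) = z powi c" if c: "c *s u \<in> H" for c
    proof -
      have m: "(- (c div int d)) *s (int d *s u) \<in> H"
        by (rule lattice_hom_powi(1)[OF H d(2)])
      have "c *s u + (- (c div int d)) *s (int d *s u) = (c mod int d) *s u"
        by (simp add: vec_eq_iff minus_div_mult_eq_mod [symmetric] algebra_simps)
      \<comment> \<open>The remainder gives a smaller multiple of \<open>u\<close> in
        \<open>H\<close>, so minimality of \<open>d\<close> forces it to be 0.\<close>
      then have "int (nat (c mod int d)) *s u \<in> H"
        using hom(2)[OF c m] d(1) by simp
      moreover have "nat (c mod int d) < d"
        using d(1) by (simp add: nat_less_iff)
      ultimately have "nat (c mod int d) = 0"
        using not_less_Least[of "nat (c mod int d)" "\<lambda>d. d > 0 \<and> int d *s u \<in> H"]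
        by (auto simp: d_def)
      moreover have "c mod int d \<ge> 0" using d(1) by simp
      ultimately have c': "int d * (c div int d) = c" by auto
      then have "c *s u = (c div int d) *s (int d *s u)"
        by (simp add: vector_smult_assoc mult.commute)
      then have "f (c *s u) = (z ^ d) powi (c div int d)"
        using lattice_hom_powi(2)[OF H d(2)] zd by simp
      also have "\<dots> = z powi (int d * (c div int d))"
        by (simp add: power_int_mult)
      finally show ?thesis using c' by simp
    qed
    then show thesis using that[of z] by (simp add: z_def)
  qed
  define H' where "H' = {h + c *s u | h c. h \<in> H}"
  define f' where "f' w = (let p = (SOME p. fst p \<in> H \<and> w = fst p + snd p *s u) in f (fst p) * z powi (snd p))" for w
  \<comment> \<open>Independence of the chosen representation: two of them differ by a multiple of
    \<open>u\<close> lying in \<open>H\<close>, where \<open>f\<close> already agrees with the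
    powers of \<open>z\<close>.\<close>
  have f': "f' (h + c *s u) = f h * z powi c" if h: "h \<in> H" for h c
  proof -
    define p where "p = (SOME p. fst p \<in> H \<and> h + c *s u = fst p + snd p *s u)"
    have p: "fst p \<in> H \<and> h + c *s u = fst p + snd p *s u"
      unfolding p_def by (rule someI[of _ "(h, c)"]) (simp add: h)
    then have eq: "(c - snd p) *s u = fst p + (- h)"
      by (simp add: vec_eq_iff algebra_simps)
    have ph: "fst p + (- h) \<in> H" using p h by (intro hom(2,3)) auto
    then have "f (fst p + (- h)) = z powi (c - snd p)"
      using z(2)[of "c - snd p"] by (simp only: eq)
    then have "f (fst p) = f h * z powi (c - snd p)"
      using hom(5)[OF h ph] by simp
    then show ?thesis
      using z(1) by (simp add: f'_def Let_def power_int_diff flip: p_def)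
  qed
  have f'_H: "f' h = f h" if "h \<in> H" for h using f'[OF that, of 0] by simp
  have sub: "H \<subseteq> H'"
  proof
    fix h assume "h \<in> H"
    then show "h \<in> H'" unfolding H'_def by (intro CollectI exI[of _ h] exI[of _ 0]) simp
  qed
  have "u \<in> H'"
    unfolding H'_def using hom(1) by (intro CollectI exI[of _ 0] exI[of _ 1]) simp
  have "w + w' \<in> H' \<and> f' (w + w') = f' w * f' w'" if ww: "w \<in> H'" "w' \<in> H'" for w w'
  proof -
    obtain h c h' c' where w: "w = h + c *s u" "w' = h' + c' *s u" "h \<in> H" "h' \<in> H"
      using ww unfolding H'_def by blast
    then have eq: "w + w' = (h + h') + (c + c') *s u" by (simp add: vec_eq_iff algebra_simps)
    have "f' (w + w') = f' w * f' w'"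
      unfolding eq f'[OF hom(2)[OF w(3,4)]] unfolding w(1,2) f'[OF w(3)] f'[OF w(4)]
      using hom(5)[OF w(3,4)] z(1) by (simp add: power_int_add)
    moreover have "w + w' \<in> H'" unfolding eq H'_def using hom(2)[OF w(3,4)] by blast
    ultimately show ?thesis by blast
  qed
  moreover have "- w \<in> H'" if ww: "w \<in> H'" for w
  proof -
    obtain h c where w: "w = h + c *s u" "h \<in> H"
      using ww unfolding H'_def by blast
    then have "- w = (- h) + (- c) *s u" by (simp add: vec_eq_iff)
    then show ?thesis unfolding H'_def using hom(3)[OF w(2)] by blast
  qed
  ultimately have "lattice_hom H' f'"
    using sub hom(1,4) f'_H by (auto simp: lattice_hom_def)
  then show thesis using sub \<open>u \<in> H'\<close> f'_H that by blast
qed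

text \<open>Adjoining the standard basis vectors one by one extends the homomorphism to all of M,
  where it is evaluation at a torus point.\<close>

lemma character_extension:
  assumes "lattice_hom H f"
  obtains t where "t \<in> torus" "\<And>h. h \<in> H \<Longrightarrow> f h = character h t"
proof -
  have "\<exists>H' f'. lattice_hom H' f' \<and> H \<subseteq> H' \<and> (\<forall>i\<in>K. axis i 1 \<in> H') \<and> (\<forall>h\<in>H. f' h = f h)"
    if "finite K" for K :: "'a set"
    using that
  proof induction
    case empty
    show ?case using assms by auto
  next
    case (insert i K)
    then obtain H' f' where H': "lattice_hom H' f'" "H \<subseteq> H'" "\<forall>i\<in>K. axis i 1 \<in> H'" "\<forall>h\<in>H. f' h = f h"
      by blast
    obtain H'' f'' where "lattice_hom H'' f''" "H' \<subseteq> H''" "axis i 1 \<in> H''" "\<And>h. h \<in> H' \<Longrightarrow> f'' h = f' h"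
      by (rule lattice_hom_extend_insert[OF H'(1), of "axis i 1"]) (rule that)
    then show ?case using H' by (intro exI[of _ H''] exI[of _ f'']) auto
  qed
  from this[of UNIV] obtain H' f' where H': "lattice_hom H' f'" "\<And>i. axis i 1 \<in> H'" "\<And>h. h \<in> H \<Longrightarrow> f' h = f h"
    by auto
  note hom = lattice_homD[OF H'(1)]
  have "m \<in> H'" for m
  proof -
    have "(\<Sum>i\<in>K. m $ i *s axis i 1) \<in> H'" for K
      by (induction K rule: infinite_finite_induct)
        (auto intro!: hom(1,2) lattice_hom_powi(1)[OF H'(1)] H'(2))
    then show ?thesis using lattice_vec_expand[of m] by metis
  qed
  then have "f' \<in> affine_chart {0}"
    using hom(4,5) by (simp add: affine_chart_def)
  then obtain t where "t \<in> torus" "f' = torus_point t"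
    by (rule affine_chart_zero_cone)
  then show thesis
    using H'(3) that by (auto simp: torus_point_def)
qed

text \<open>\<open>z\<close> is \<open>x\<close> extended to the localization of the monoid at
  \<open>m1\<close>: its value at \<open>m\<close> is a fraction whose denominator is a power of
  \<open>x m1\<close>, and cross-multiplication shows that it does not depend on the exponent
  used.\<close>

lemma affine_chart_localize:
  assumes x: "x \<in> affine_chart \<sigma>" and m1: "m1 \<in> dual_monoid \<sigma>" "x m1 \<noteq> 0"
  obtains z where "\<And>m. m \<in> dual_monoid \<sigma> \<Longrightarrow> z m = x m"
    "\<And>m m' N N'. m + int N *s m1 \<in> dual_monoid \<sigma> \<Longrightarrow> m' + int N' *s m1 \<in> dual_monoid \<sigma> \<Longrightarrow>
        z (m + m') = z m * z m'"
proof -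
  define z where "z m = (let N = (SOME N. m + int N *s m1 \<in> dual_monoid \<sigma>) in
      x (m + int N *s m1) / x m1 ^ N)" for m
  have z: "z m = x (m + int N *s m1) / x m1 ^ N" if N: "m + int N *s m1 \<in> dual_monoid \<sigma>" for m N
  proof -
    define N' where "N' = (SOME N. m + int N *s m1 \<in> dual_monoid \<sigma>)"
    have N': "m + int N' *s m1 \<in> dual_monoid \<sigma>"
      unfolding N'_def by (rule someI[of _ N]) (rule N)
    have "m + int N *s m1 + int N' *s m1 = m + int N' *s m1 + int N *s m1" by (simp add: algebra_simps)
    moreover have "x (m + int N *s m1 + int N' *s m1) = x (m + int N *s m1) * x m1 ^ N'"
      using affine_chartD(2)[OF x N, of "int N' *s m1"] m1
      by (simp add: affine_chart_scale[OF x] dual_monoid_scale)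
    moreover have "x (m + int N' *s m1 + int N *s m1) = x (m + int N' *s m1) * x m1 ^ N"
      using affine_chartD(2)[OF x N', of "int N *s m1"] m1
      by (simp add: affine_chart_scale[OF x] dual_monoid_scale)
    ultimately have "x (m + int N *s m1) * x m1 ^ N' = x (m + int N' *s m1) * x m1 ^ N"
      by metis
    then show ?thesis
      using m1 by (simp add: z_def Let_def field_simps flip: N'_def)
  qed
  show thesis
  proof (rule that[of z])
    show "z m = x m" if "m \<in> dual_monoid \<sigma>" for m
      using z[of m 0] that by simp
    fix m m' N N' assume N: "m + int N *s m1 \<in> dual_monoid \<sigma>" "m' + int N' *s m1 \<in> dual_monoid \<sigma>"
    have eq: "(m + int N *s m1) + (m' + int N' *s m1) = (m + m') + int (N + N') *s m1"
      by (simp add: vec_eq_iff algebra_simps)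
    then have "(m + m') + int (N + N') *s m1 \<in> dual_monoid \<sigma>"
      using N dual_monoid_add by metis
    then have "z (m + m') = x ((m + m') + int (N + N') *s m1) / x m1 ^ (N + N')"
      by (rule z)
    also have "\<dots> = x (m + int N *s m1) * x (m' + int N' *s m1) / x m1 ^ (N + N')"
      by (simp only: affine_chartD(2)[OF x N] flip: eq)
    finally show "z (m + m') = z m * z m'"
      using z[OF N(1)] z[OF N(2)] by (simp add: power_add)
  qed
qed

text \<open>The point \<open>x\<close> is the limit of \<open>t exp (- s y)\<close> as \<open>s\<close> tends to infinity.\<close>

lemma affine_chart_limit_data:
  assumes "rational_polyhedral_cone \<sigma>" and x: "x \<in> affine_chart \<sigma>"
  obtains t y where "t \<in> torus"
    "\<And>m. m \<in> dual_monoid \<sigma> \<Longrightarrow> x m \<noteq> 0 \<Longrightarrow> rvec m \<bullet> y = 0 \<and> x m = character m t"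
    "\<And>m. m \<in> dual_monoid \<sigma> \<Longrightarrow> x m = 0 \<Longrightarrow> rvec m \<bullet> y > 0"
proof -
  obtain A where A: "finite A" "\<sigma> = convex_cone hull (rvec ` A)"
    using assms(1) unfolding rational_polyhedral_cone_def by blast
  have S: "m \<in> dual_monoid \<sigma> \<longleftrightarrow> (\<forall>a\<in>A. 0 \<le> lpair m a)" for m
    by (simp add: A(2) dual_monoid_hull)
  \<comment> \<open>The characters that do not vanish at \<open>x\<close>. They form a face of the
    dual monoid, shown below to consist of its elements vanishing on the generators in
    \<open>B\<close>.\<close>
  define F where "F = {m\<in>dual_monoid \<sigma>. x m \<noteq> 0}"
  define B where "B = {a\<in>A. \<forall>m\<in>F. lpair m a = 0}"
  have F_add: "m + m' \<in> F" if "m \<in> F" "m' \<in> F" for m m'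
    using that affine_chartD(2)[OF x] by (auto simp: F_def dual_monoid_add)
  have "0 \<in> F" using affine_chartD(1)[OF x] by (simp add: F_def)
  then have F_sum: "(\<Sum>a\<in>K. g a) \<in> F" if "\<And>a. a \<in> K \<Longrightarrow> g a \<in> F" for K and g :: "'a lat \<Rightarrow> 'a lat"
    using that by (induction K rule: infinite_finite_induct) (auto intro: F_add)
  have "\<forall>a\<in>A - B. \<exists>m\<in>F. lpair m a \<noteq> 0" by (auto simp: B_def)
  then obtain g where g: "\<And>a. a \<in> A - B \<Longrightarrow> g a \<in> F \<and> lpair (g a) a \<noteq> 0" by metis
  \<comment> \<open>An element of \<open>F\<close> that is positive on every generator outside
    \<open>B\<close>; adding multiples of it brings all functionals vanishing on \<open>B\<close>
    into the monoid.\<close>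
  define m1 where "m1 = (\<Sum>a\<in>A - B. g a)"
  have m1: "m1 \<in> F" unfolding m1_def using g by (intro F_sum) auto
  have m1_pos: "1 \<le> lpair m1 a" if "a \<in> A - B" for a
  proof -
    have "0 < lpair (g a) a" using g[OF that] that S by (auto simp: F_def less_le)
    also have "\<dots> \<le> (\<Sum>b\<in>A - B. lpair (g b) a)"
      using A(1) that g S by (intro member_le_sum) (auto simp: F_def)
    finally show ?thesis by (simp add: m1_def lpair_sum_left)
  qed
  have big: "\<exists>N. m + int N *s m1 \<in> dual_monoid \<sigma>" if "\<forall>a\<in>B. lpair m a = 0" for m
  proof -
    define N where "N = nat (\<Sum>a\<in>A. \<bar>lpair m a\<bar>)"
    have "0 \<le> lpair (m + int N *s m1) a" if a: "a \<in> A" for a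
    proof (cases "a \<in> B")
      case True
      then show ?thesis using m1 \<open>\<forall>a\<in>B. lpair m a = 0\<close> by (auto simp: B_def lpair_add_left lpair_scale_left)
    next
      case False
      then have "int N * 1 \<le> int N * lpair m1 a"
        using m1_pos[of a] a by (intro mult_left_mono) auto
      moreover have "\<bar>lpair m a\<bar> \<le> (\<Sum>a\<in>A. \<bar>lpair m a\<bar>)"
        using a A(1) by (intro member_le_sum) auto
      ultimately show ?thesis by (simp add: lpair_add_left lpair_scale_left N_def)
    qed
    then show ?thesis using S by blast
  qed
  have F_iff: "m \<in> F \<longleftrightarrow> (\<forall>a\<in>B. lpair m a = 0)" if m: "m \<in> dual_monoid \<sigma>" for m
  proof
    assume "\<forall>a\<in>B. lpair m a = 0"
    \<comment> \<open>Both \<open>m\<close> and \<open>int N *s m1 - m\<close> lie in the monoid,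
      and the product of their values is a power of \<open>x m1\<close>, so neither value is
      0.\<close>
    then obtain N where N: "- m + int N *s m1 \<in> dual_monoid \<sigma>"
      using big[of "- m"] by (auto simp: lpair_minus_left)
    have "x (m + (- m + int N *s m1)) = x m * x (- m + int N *s m1)"
      by (rule affine_chartD(2)[OF x m N])
    then have "x m1 ^ N = x m * x (- m + int N *s m1)"
      using m1 by (simp add: affine_chart_scale[OF x] F_def)
    then have "x m \<noteq> 0" using m1 by (auto simp: F_def)
    then show "m \<in> F" using m by (simp add: F_def)
  qed (auto simp: B_def)
  \<comment> \<open>A sum of nonnegative pairings vanishes only if each of them does, so this
    \<open>y\<close> detects \<open>F\<close>.\<close>
  define y where "y = (\<Sum>a\<in>B. rvec a)"
  have y: "rvec m \<bullet> y = real_of_int (\<Sum>a\<in>B. lpair m a)" for m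
    by (simp add: y_def inner_sum_right inner_rvec)
  have nonneg: "0 \<le> lpair m a" if "m \<in> dual_monoid \<sigma>" "a \<in> B" for m a
    using that S by (auto simp: B_def)
  have finB: "finite B" using A(1) by (simp add: B_def)
  have y0: "rvec m \<bullet> y = 0 \<longleftrightarrow> m \<in> F" if "m \<in> dual_monoid \<sigma>" for m
    unfolding y F_iff[OF that] using nonneg[OF that] finB by (simp add: sum_nonneg_eq_0_iff)
  obtain z where z: "\<And>m. m \<in> dual_monoid \<sigma> \<Longrightarrow> z m = x m"
    "\<And>m m' N N'. m + int N *s m1 \<in> dual_monoid \<sigma> \<Longrightarrow> m' + int N' *s m1 \<in> dual_monoid \<sigma> \<Longrightarrow>
        z (m + m') = z m * z m'"
    using affine_chart_localize[OF x, of m1] m1 by (auto simp: F_def)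
  \<comment> \<open>Every element of \<open>L\<close> enters the monoid after adding a multiple of
    \<open>m1\<close>, so the localized values form a homomorphism on \<open>L\<close>, which
    extends to a torus point.\<close>
  define L where "L = {m. \<forall>a\<in>B. lpair m a = 0}"
  obtain t where t: "t \<in> torus" "\<And>h. h \<in> L \<Longrightarrow> z h = character h t"
  proof (rule character_extension[of L z])
    have "z 0 = 1" using z(1)[of 0] affine_chartD(1)[OF x] by simp
    moreover have "z (h + h') = z h * z h'" if hh: "h \<in> L" "h' \<in> L" for h h'
    proof -
      obtain N N' where "h + int N *s m1 \<in> dual_monoid \<sigma>" "h' + int N' *s m1 \<in> dual_monoid \<sigma>"
        using big[of h] big[of h'] hh unfolding L_def by blast
      then show ?thesis by (rule z(2))
    qed
    ultimately show "lattice_hom L z"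
      by (simp add: lattice_hom_def L_def lpair_add_left lpair_minus_left)
  qed (rule that)
  show thesis
  proof (rule that[OF t(1)])
    fix m assume m: "m \<in> dual_monoid \<sigma>"
    show "rvec m \<bullet> y = 0 \<and> x m = character m t" if "x m \<noteq> 0"
    proof -
      have "m \<in> F" using m that by (simp add: F_def)
      then show ?thesis using y0[OF m] z(1)[OF m] t(2)[of m] F_iff[OF m] by (simp add: L_def)
    qed
    assume "x m = 0"
    then have "rvec m \<bullet> y \<noteq> 0" using y0[OF m] by (simp add: F_def)
    moreover have "rvec m \<bullet> y \<ge> 0"
      unfolding y using nonneg[OF m] by (simp add: sum_nonneg)
    ultimately show "rvec m \<bullet> y > 0" by simp
  qed
qed

section \<open>Completeness of the fan of a compact toric variety\<close>

text \<open>The chart of the face cut out by \<open>m0\<close> is the principal open subset of the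
  chart of \<open>\<sigma>\<close> where the character of \<open>m0\<close> does not vanish, because
  the dual monoid of the face is the localization at \<open>m0\<close>.\<close>

lemma chart_incl_face:
  assumes "rational_polyhedral_cone \<sigma>" and m0: "m0 \<in> dual_monoid \<sigma>"
    and \<tau>: "\<tau> = \<sigma> \<inter> {y. rvec m0 \<bullet> y = 0}"
  shows "m \<in> dual_monoid \<tau> \<Longrightarrow> \<exists>N. m + int N *s m0 \<in> dual_monoid \<sigma>"
    and "x \<in> affine_chart \<sigma> \<Longrightarrow> x m0 \<noteq> 0 \<Longrightarrow> \<exists>z\<in>affine_chart \<tau>. x = chart_incl \<sigma> z"
    and "z \<in> affine_chart \<tau> \<Longrightarrow> z m0 \<noteq> 0"
proof -
  obtain A where A: "finite A" "\<sigma> = convex_cone hull (rvec ` A)"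
    using assms(1) unfolding rational_polyhedral_cone_def by blast
  have sub: "dual_monoid \<sigma> \<subseteq> dual_monoid \<tau>"
    by (rule dual_monoid_antimono) (simp add: \<tau>)
  show big: "\<exists>N. m + int N *s m0 \<in> dual_monoid \<sigma>" if m: "m \<in> dual_monoid \<tau>" for m
  proof -
    define N where "N = nat (\<Sum>a\<in>A. \<bar>lpair m a\<bar>)"
    have "0 \<le> lpair (m + int N *s m0) a" if a: "a \<in> A" for a
    proof (cases "lpair m0 a = 0")
      case True
      then have "rvec a \<in> \<tau>" using a by (simp add: \<tau> A(2) hull_inc inner_rvec)
      then have "0 \<le> lpair m a" using m by (auto simp: dual_monoid_def inner_rvec)
      then show ?thesis using True by (simp add: lpair_add_left lpair_scale_left)
    next
      case False
      then have "lpair m0 a \<ge> 1" using m0 a by (force simp: A(2) dual_monoid_hull)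
      then have "int N * 1 \<le> int N * lpair m0 a" by (intro mult_left_mono) auto
      moreover have "\<bar>lpair m a\<bar> \<le> (\<Sum>a\<in>A. \<bar>lpair m a\<bar>)"
        using a A(1) by (intro member_le_sum) auto
      ultimately show ?thesis by (simp add: lpair_add_left lpair_scale_left N_def)
    qed
    then show ?thesis by (auto simp: A(2) dual_monoid_hull)
  qed
  show "\<exists>z\<in>affine_chart \<tau>. x = chart_incl \<sigma> z" if x: "x \<in> affine_chart \<sigma>" "x m0 \<noteq> 0"
  proof -
    obtain z where z: "\<And>m. m \<in> dual_monoid \<sigma> \<Longrightarrow> z m = x m"
      "\<And>m m' N N'. m + int N *s m0 \<in> dual_monoid \<sigma> \<Longrightarrow> m' + int N' *s m0 \<in> dual_monoid \<sigma> \<Longrightarrow>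
          z (m + m') = z m * z m'"
      using affine_chart_localize[OF x(1) m0 x(2)] by blast
    have mult: "z (m + m') = z m * z m'" if "m \<in> dual_monoid \<tau>" "m' \<in> dual_monoid \<tau>" for m m'
      using big[OF that(1)] big[OF that(2)] z(2) by blast
    define z' where "z' m = (if m \<in> dual_monoid \<tau> then z m else 0)" for m
    have "z' \<in> affine_chart \<tau>"
      using z(1)[of 0] mult affine_chartD(1)[OF x(1)] by (simp add: affine_chart_def z'_def dual_monoid_add)
    moreover have "x = chart_incl \<sigma> z'"
      using z(1) sub affine_chartD(3)[OF x(1)] by (auto simp: chart_incl_def z'_def subset_iff)
    ultimately show ?thesis by blast
  qed
  show "z m0 \<noteq> 0" if z: "z \<in> affine_chart \<tau>"
  proof -
    have "- m0 \<in> dual_monoid \<tau>"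
      by (auto simp: dual_monoid_def \<tau> inner_vec_def sum_negf)
    then have "z m0 * z (- m0) = 1"
      using affine_chartD(1,2)[OF z] m0 sub by (metis add.right_inverse subsetD)
    then show ?thesis by auto
  qed
qed

lemma glue_rel_refl: "\<sigma> \<in> \<Delta> \<Longrightarrow> x \<in> affine_chart \<sigma> \<Longrightarrow> ((\<sigma>, x), (\<sigma>, x)) \<in> glue_rel \<Delta>"
  by (auto simp: glue_rel_def chart_incl_self intro!: bexI[of _ x])

text \<open>In the chart of \<open>\<tau>\<close>, the overlap with the chart of
  \<open>\<sigma>\<close> is the locus where the character of \<open>m0\<close> is nonzero.
  Multiplying by its \<open>N\<close>-th power clears the pole of the character of \<open>m\<close>,
  which turns the bound into an open condition.\<close>

lemma openin_toric_bound:
  assumes "fan \<Delta>" "\<sigma> \<in> \<Delta>" "m \<in> dual_monoid \<sigma>"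
  shows "openin (toric_topology \<Delta>) {C \<in> toric_points \<Delta>. \<exists>x. (\<sigma>, x) \<in> C \<and> cmod (x m) < R}"
    (is "openin _ ?G")
  unfolding openin_toric_topology
proof (intro conjI ballI)
  fix \<tau> assume \<tau>: "\<tau> \<in> \<Delta>"
  have face: "(\<tau> \<inter> \<sigma>) face_of \<tau>" using fan_inter[OF assms(1) \<tau> assms(2)] .
  have "0 \<in> \<tau> \<inter> \<sigma>" using fan_contains_0 assms \<tau> by blast
  then obtain m0 where m0: "m0 \<in> dual_monoid \<tau>" "\<tau> \<inter> \<sigma> = \<tau> \<inter> {y. rvec m0 \<bullet> y = 0}"
    using lattice_exposed_face[OF fanD(1)[OF assms(1) \<tau>] face] by blast
  note incl = chart_incl_face[OF fanD(1)[OF assms(1) \<tau>] m0]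
  have sub: "dual_monoid \<tau> \<subseteq> dual_monoid (\<tau> \<inter> \<sigma>)" "dual_monoid \<sigma> \<subseteq> dual_monoid (\<tau> \<inter> \<sigma>)"
    by (auto intro!: dual_monoid_antimono)
  then obtain N where N: "m + int N *s m0 \<in> dual_monoid \<tau>"
    using incl(1) assms(3) by blast
  let ?O = "{x. x m0 \<noteq> 0 \<and> cmod (x (m + int N *s m0)) < R * cmod (x m0) ^ N}"
  have val: "x m0 \<noteq> 0 \<and> x (m + int N *s m0) = z m * x m0 ^ N"
    if "z \<in> affine_chart (\<tau> \<inter> \<sigma>)" "x = chart_incl \<tau> z" for x z
  proof -
    have "z (m + int N *s m0) = z m * z m0 ^ N"
      using affine_chartD(2)[OF that(1), of m "int N *s m0"] affine_chart_scale[OF that(1), of m0]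
        sub assms(3) m0(1) by (auto simp: dual_monoid_scale subset_iff)
    then show ?thesis
      using that incl(3)[OF that(1)] m0(1) N by (simp add: chart_incl_def)
  qed
  have "(\<exists>x'. ((\<tau>, x), (\<sigma>, x')) \<in> glue_rel \<Delta> \<and> cmod (x' m) < R) \<longleftrightarrow> x \<in> ?O"
    if x: "x \<in> affine_chart \<tau>" for x
  proof
    assume "\<exists>x'. ((\<tau>, x), (\<sigma>, x')) \<in> glue_rel \<Delta> \<and> cmod (x' m) < R"
    then obtain z where z: "z \<in> affine_chart (\<tau> \<inter> \<sigma>)" "x = chart_incl \<tau> z" "cmod (z m) < R"
      using assms(3) by (auto simp: glue_rel_def chart_incl_def)
    then show "x \<in> ?O"
      using val[OF z(1,2)] by (simp add: norm_mult norm_power)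
  next
    assume x': "x \<in> ?O"
    then obtain z where z: "z \<in> affine_chart (\<tau> \<inter> \<sigma>)" "x = chart_incl \<tau> z"
      using incl(2)[OF x] by blast
    have "cmod (z m) < R"
      using val[OF z] x' by (simp add: norm_mult norm_power)
    then show "\<exists>x'. ((\<tau>, x), (\<sigma>, x')) \<in> glue_rel \<Delta> \<and> cmod (x' m) < R"
      using z assms(2,3) \<tau> by (intro exI[of _ "chart_incl \<sigma> z"]) (auto simp: glue_rel_def chart_incl_def)
  qed
  then have "{x \<in> affine_chart \<tau>. glue_rel \<Delta> `` {(\<tau>, x)} \<in> ?G} = affine_chart \<tau> \<inter> ?O"
    using \<tau> by (auto simp: toric_points_def intro!: quotientI)
  moreover have "open ?O"
    by (intro open_Collect_conj open_Collect_neq open_Collect_less continuous_intros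
        continuous_on_product_coordinates)
  ultimately show "openin (top_of_set (affine_chart \<tau>)) {x \<in> affine_chart \<tau>. glue_rel \<Delta> `` {(\<tau>, x)} \<in> ?G}"
    by (simp add: openin_open_Int)
qed blast

lemma topspace_toric_topology: "topspace (toric_topology \<Delta>) = toric_points \<Delta>"
proof
  show "topspace (toric_topology \<Delta>) \<subseteq> toric_points \<Delta>"
    using openin_topspace openin_toric_topology by blast
  have "{x \<in> affine_chart \<sigma>. glue_rel \<Delta> `` {(\<sigma>, x)} \<in> toric_points \<Delta>} = affine_chart \<sigma>"
    if "\<sigma> \<in> \<Delta>" for \<sigma>
    using that by (auto simp: toric_points_def intro!: quotientI)
  then have "openin (toric_topology \<Delta>) (toric_points \<Delta>)"
    by (simp add: openin_toric_topology)
  then show "toric_points \<Delta> \<subseteq> topspace (toric_topology \<Delta>)"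
    by (rule openin_subset)
qed

text \<open>If \<open>y\<close> lies in no cone, then the points \<open>exp (- j y)\<close> of the torus leave every compact
  subset: on each chart some character tends to infinity along them.\<close>

theorem compact_fan_complete:
  assumes "fan \<Delta>" "compact_space (toric_topology \<Delta>)"
  shows "\<Union>\<Delta> = UNIV"
proof (rule ccontr)
  assume "\<Union>\<Delta> \<noteq> UNIV"
  then obtain y where y: "\<And>\<sigma>. \<sigma> \<in> \<Delta> \<Longrightarrow> y \<notin> \<sigma>" by blast
  have "\<exists>m. m \<in> dual_monoid \<sigma> \<and> rvec m \<bullet> y < 0" if "\<sigma> \<in> \<Delta>" for \<sigma>
    using lattice_separation[OF fanD(1)[OF assms(1) that] y[OF that]] by blast
  then obtain s where s: "\<And>\<sigma>. \<sigma> \<in> \<Delta> \<Longrightarrow> s \<sigma> \<in> dual_monoid \<sigma>" "\<And>\<sigma>. \<sigma> \<in> \<Delta> \<Longrightarrow> rvec (s \<sigma>) \<bullet> y < 0"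
    by metis
  define G where "G = (\<lambda>(\<sigma>, N). {C \<in> toric_points \<Delta>. \<exists>x. (\<sigma>, x) \<in> C \<and> cmod (x (s \<sigma>)) < real N})"
  have "toric_points \<Delta> \<subseteq> \<Union>(G ` (\<Delta> \<times> UNIV))"
  proof
    fix C assume C: "C \<in> toric_points \<Delta>"
    then obtain \<sigma> x where x: "\<sigma> \<in> \<Delta>" "x \<in> affine_chart \<sigma>" "C = glue_rel \<Delta> `` {(\<sigma>, x)}"
      by (auto simp: toric_points_def quotient_def)
    obtain N where "cmod (x (s \<sigma>)) < real N" using reals_Archimedean2 by blast
    moreover have "(\<sigma>, x) \<in> C" using x glue_rel_refl by auto
    ultimately have "C \<in> G (\<sigma>, N)" using C by (auto simp: G_def)
    then show "C \<in> \<Union>(G ` (\<Delta> \<times> UNIV))" using x(1) by blast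
  qed
  moreover have "\<forall>U\<in>G ` (\<Delta> \<times> UNIV). openin (toric_topology \<Delta>) U"
    using openin_toric_bound[OF assms(1)] s(1) by (auto simp: G_def)
  ultimately obtain \<F> where "finite \<F>" "\<F> \<subseteq> G ` (\<Delta> \<times> UNIV)" "toric_points \<Delta> \<subseteq> \<Union>\<F>"
    using assms(2) unfolding compact_space_alt topspace_toric_topology by meson
  then obtain P where P: "finite P" "P \<subseteq> \<Delta> \<times> UNIV" "toric_points \<Delta> \<subseteq> \<Union>(G ` P)"
    by (metis finite_subset_image)
  \<comment> \<open>The radii are natural numbers, so their sum over the finite subcover bounds each
    of them.\<close>
  define K where "K = (\<Sum>p\<in>P. snd p)"
  have K: "N \<le> K" if "(\<sigma>, N) \<in> P" for \<sigma> N
    using member_le_sum[of "(\<sigma>, N)" P snd] P(1) that by (simp add: K_def)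
  have "\<forall>\<^sub>F j in sequentially. real K / (- (rvec (s \<sigma>) \<bullet> y)) < real j" for \<sigma>
    using filterlim_real_sequentially by (auto simp: filterlim_at_top_dense)
  then have "\<forall>\<^sub>F j in sequentially. \<forall>\<sigma>\<in>\<Delta>. real K / (- (rvec (s \<sigma>) \<bullet> y)) < real j"
    using assms(1) by (simp add: fan_def eventually_ball_finite)
  then obtain j where j: "\<And>\<sigma>. \<sigma> \<in> \<Delta> \<Longrightarrow> real K / (- (rvec (s \<sigma>) \<bullet> y)) < real j"
    using eventually_happens trivial_limit_sequentially by blast
  define x where "x = torus_point (\<chi> i. exp (- of_real (real j) * of_real (y $ i)))"
  have x: "x \<in> affine_chart {0}"
    unfolding x_def by (intro torus_point_affine_chart torus_exp)
  let ?C = "glue_rel \<Delta> `` {({0}, x)}"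
  have "?C \<in> toric_points \<Delta>"
    using x fan_zero[OF assms(1)] by (auto simp: toric_points_def intro!: quotientI)
  then obtain p where "p \<in> P" "?C \<in> G p" using P(3) by blast
  then obtain \<sigma> N where \<sigma>: "(\<sigma>, N) \<in> P" "?C \<in> G (\<sigma>, N)" by (cases p) blast
  then obtain x' where x': "(({0}, x), (\<sigma>, x')) \<in> glue_rel \<Delta>" "cmod (x' (s \<sigma>)) < real N"
    by (auto simp: G_def)
  have "\<sigma> \<in> \<Delta>" using \<sigma>(1) P(2) by blast
  have "x' (s \<sigma>) = x (s \<sigma>)"
    using x'(1) s(1)[OF \<open>\<sigma> \<in> \<Delta>\<close>] by (auto simp: glue_rel_def chart_incl_def)
  then have "cmod (x' (s \<sigma>)) = exp (real j * (- (rvec (s \<sigma>) \<bullet> y)))"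
    unfolding x_def torus_point_def character_exp by (simp flip: of_real_mult of_real_minus)
  also have "\<dots> \<ge> 1 + real j * (- (rvec (s \<sigma>) \<bullet> y))" by (rule exp_ge_add_one_self)
  moreover have "real j * (- (rvec (s \<sigma>) \<bullet> y)) > real K"
    using j[OF \<open>\<sigma> \<in> \<Delta>\<close>] s(2)[OF \<open>\<sigma> \<in> \<Delta>\<close>] by (simp add: pos_divide_less_eq neg_less_divide_eq field_simps)
  ultimately show False using x'(2) K[OF \<sigma>(1)] by linarith
qed

section \<open>Holomorphic functions on charts\<close>

lemma tendsto_pointwise:
  fixes f :: "'a \<Rightarrow> 'b \<Rightarrow> 'c :: topological_space"
  assumes "\<And>m. ((\<lambda>a. f a m) \<longlongrightarrow> l m) F"
  shows "(f \<longlongrightarrow> l) F"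
proof -
  have "limitin (product_topology (\<lambda>_. euclidean) UNIV) f l F"
    unfolding limitin_componentwise using assms by simp
  then show ?thesis unfolding euclidean_product_topology by simp
qed

lemma tendsto_eval: "((\<lambda>w. w m) \<longlongrightarrow> w m) (nhds (w :: 'a \<Rightarrow> 'c :: topological_space))"
proof -
  have "((\<lambda>w. w m) \<longlongrightarrow> w m) (at w)"
    using continuous_on_product_coordinates[of m] unfolding continuous_on_def by blast
  then show ?thesis
    using tendsto_at_iff_tendsto_nhds[of "\<lambda>w. w m" w] by simp
qed

lemma complex_diff_at_tendsto:
  assumes "complex_diff_at A g w"
  shows "(g \<longlongrightarrow> g w) (nhds w)"
proof -
  obtain c where c: "\<And>\<epsilon>. \<epsilon> > 0 \<Longrightarrow> \<forall>\<^sub>F w' in nhds w.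
      cmod (g w' - g w - (\<Sum>m\<in>A. c m * (w' m - w m))) \<le> \<epsilon> * (\<Sum>m\<in>A. cmod (w' m - w m))"
    using assms unfolding complex_diff_at_def by blast
  define h where "h w' = (\<Sum>m\<in>A. cmod (w' m - w m)) + (\<Sum>m\<in>A. cmod (c m) * cmod (w' m - w m))" for w'
  have "((\<lambda>w'. h w') \<longlongrightarrow> (\<Sum>m\<in>A. cmod (w m - w m)) + (\<Sum>m\<in>A. cmod (c m) * cmod (w m - w m))) (nhds w)"
    unfolding h_def by (intro tendsto_intros tendsto_eval)
  then have h: "(h \<longlongrightarrow> 0) (nhds w)" by simp
  have "\<forall>\<^sub>F w' in nhds w. cmod (g w' - g w) \<le> h w'"
    using c[of 1]
  proof (rule eventually_mono)
    fix w'
    assume 1: "cmod (g w' - g w - (\<Sum>m\<in>A. c m * (w' m - w m))) \<le> 1 * (\<Sum>m\<in>A. cmod (w' m - w m))"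
    have "cmod (\<Sum>m\<in>A. c m * (w' m - w m)) \<le> (\<Sum>m\<in>A. cmod (c m) * cmod (w' m - w m))"
      by (rule order_trans[OF norm_sum]) (simp add: norm_mult)
    moreover have "cmod (g w' - g w) \<le> cmod (g w' - g w - (\<Sum>m\<in>A. c m * (w' m - w m))) +
        cmod (\<Sum>m\<in>A. c m * (w' m - w m))"
      using norm_triangle_ineq[of "g w' - g w - (\<Sum>m\<in>A. c m * (w' m - w m))" "\<Sum>m\<in>A. c m * (w' m - w m)"]
      by simp
    ultimately show "cmod (g w' - g w) \<le> h w'" using 1 by (simp add: h_def)
  qed simp
  then have "((\<lambda>w'. g w' - g w) \<longlongrightarrow> 0) (nhds w)"
    using h by (rule Lim_null_comparison)
  then show ?thesis by (simp add: LIM_zero_iff)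
qed

lemma holo_on_chart_continuous:
  assumes "holo_on_chart \<sigma> f"
  shows "continuous_on (affine_chart \<sigma>) f"
  unfolding continuous_on_def
proof
  fix x assume x: "x \<in> affine_chart \<sigma>"
  then obtain A G g where G: "open G" "x \<in> G" and g: "\<And>w. w \<in> G \<Longrightarrow> complex_diff_at A g w"
    and fg: "\<And>y. y \<in> G \<Longrightarrow> y \<in> affine_chart \<sigma> \<Longrightarrow> f y = g y"
    using assms unfolding holo_on_chart_def by (metis IntI)
  have "(g \<longlongrightarrow> g x) (nhds x)" using complex_diff_at_tendsto g G(2) by blast
  then have "(g \<longlongrightarrow> f x) (at x within affine_chart \<sigma>)"
    using fg[OF G(2) x] by (auto intro: filterlim_mono at_within_le_nhds)
  moreover have "\<forall>\<^sub>F y in at x within affine_chart \<sigma>. g y = f y"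
    using eventually_at_topological fg G by (auto simp: eventually_at_topological)
  ultimately show "(f \<longlongrightarrow> f x) (at x within affine_chart \<sigma>)"
    by (rule Lim_transform_eventually)
qed

text \<open>Chain rule. The remainder of the difference quotient of \<open>f\<close> is at most
  epsilon times the sum of the moduli of the difference quotients of the coordinates in
  \<open>A\<close>; these converge and so remain bounded.\<close>

lemma holo_on_chart_compose:
  assumes f: "holo_on_chart \<sigma> f" and "open D"
    and p: "\<And>z. z \<in> D \<Longrightarrow> p z \<in> affine_chart \<sigma>" "\<And>m. (\<lambda>z. p z m) holomorphic_on D"
  shows "(\<lambda>z. f (p z)) holomorphic_on D"
proof -
  have "\<exists>d. ((\<lambda>z. f (p z)) has_field_derivative d) (at z0)" if z0: "z0 \<in> D" for z0
  proof -
    obtain A G g where A: "finite A" and G: "open G" "p z0 \<in> G"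
      and g: "\<And>w. w \<in> G \<Longrightarrow> complex_diff_at A g w"
      and fg: "\<And>y. y \<in> G \<Longrightarrow> y \<in> affine_chart \<sigma> \<Longrightarrow> f y = g y"
      using f p(1)[OF z0] unfolding holo_on_chart_def by (metis IntI)
    obtain c where c: "\<And>\<epsilon>. \<epsilon> > 0 \<Longrightarrow> \<forall>\<^sub>F w' in nhds (p z0).
        cmod (g w' - g (p z0) - (\<Sum>m\<in>A. c m * (w' m - p z0 m))) \<le> \<epsilon> * (\<Sum>m\<in>A. cmod (w' m - p z0 m))"
      using g[OF G(2)] unfolding complex_diff_at_def by blast
    have der: "((\<lambda>z. p z m) has_field_derivative deriv (\<lambda>z. p z m) z0) (at z0)" for m
      using holomorphic_derivI[OF p(2) \<open>open D\<close> z0] .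
    define Q where "Q z m = (p z m - p z0 m) / (z - z0)" for z m
    have Q: "((\<lambda>z. Q z m) \<longlongrightarrow> deriv (\<lambda>z. p z m) z0) (at z0)" for m
      using der[of m] unfolding has_field_derivative_iff Q_def .
    have pz: "(p \<longlongrightarrow> p z0) (at z0)"
    proof (rule tendsto_pointwise)
      show "((\<lambda>z. p z m) \<longlongrightarrow> p z0 m) (at z0)" for m
        using DERIV_isCont[OF der[of m]] by (simp add: isCont_def)
    qed
    define d where "d = (\<Sum>m\<in>A. c m * deriv (\<lambda>z. p z m) z0)"
    define K where "K = (\<Sum>m\<in>A. cmod (deriv (\<lambda>z. p z m) z0)) + 1"
    have "K > 0" by (simp add: K_def add_nonneg_pos sum_nonneg)
    have "((\<lambda>z. \<Sum>m\<in>A. cmod (Q z m)) \<longlongrightarrow> (\<Sum>m\<in>A. cmod (deriv (\<lambda>z. p z m) z0))) (at z0)"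
      by (intro tendsto_intros Q)
    then have ev_K: "\<forall>\<^sub>F z in at z0. (\<Sum>m\<in>A. cmod (Q z m)) < K"
      by (rule order_tendstoD) (simp add: K_def)
    have ev_D: "\<forall>\<^sub>F z in at z0. z \<in> D \<and> z \<noteq> z0"
      using \<open>open D\<close> z0 by (auto simp: eventually_at_topological)
    have ev_G: "\<forall>\<^sub>F z in at z0. p z \<in> G"
      using pz G by (rule topological_tendstoD)
    define E where "E z = (f (p z) - f (p z0)) / (z - z0) - (\<Sum>m\<in>A. c m * Q z m)" for z
    have "(E \<longlongrightarrow> 0) (at z0)"
    proof (rule tendstoI)
      fix e :: real assume "e > 0"
      have "\<forall>\<^sub>F z in at z0. cmod (g (p z) - g (p z0) - (\<Sum>m\<in>A. c m * (p z m - p z0 m)))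
          \<le> e / K * (\<Sum>m\<in>A. cmod (p z m - p z0 m))"
        using c[of "e / K"] \<open>e > 0\<close> \<open>K > 0\<close> pz by (auto dest: eventually_compose_filterlim)
      then show "\<forall>\<^sub>F z in at z0. dist (E z) 0 < e"
        using ev_K ev_D ev_G
      proof eventually_elim
        case (elim z)
        have "(\<Sum>m\<in>A. c m * Q z m) = (\<Sum>m\<in>A. c m * (p z m - p z0 m)) / (z - z0)"
          by (simp add: Q_def sum_divide_distrib)
        then have "E z = (g (p z) - g (p z0) - (\<Sum>m\<in>A. c m * (p z m - p z0 m))) / (z - z0)"
          using elim(3,4) p(1) z0 G(2) fg
          by (simp add: E_def diff_divide_distrib)
        then have "cmod (E z) = cmod (g (p z) - g (p z0) - (\<Sum>m\<in>A. c m * (p z m - p z0 m))) / cmod (z - z0)"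
          by (simp add: norm_divide)
        also have "\<dots> \<le> e / K * (\<Sum>m\<in>A. cmod (p z m - p z0 m)) / cmod (z - z0)"
          by (intro divide_right_mono elim) simp
        also have "\<dots> = e / K * (\<Sum>m\<in>A. cmod (Q z m))"
          by (simp add: Q_def norm_divide flip: sum_divide_distrib)
        also have "\<dots> < e / K * K"
          using elim(2) \<open>e > 0\<close> \<open>K > 0\<close> by (intro mult_strict_left_mono) auto
        finally show ?case using \<open>K > 0\<close> by simp
      qed
    qed
    moreover have "((\<lambda>z. \<Sum>m\<in>A. c m * Q z m) \<longlongrightarrow> d) (at z0)"
      unfolding d_def by (intro tendsto_intros Q)
    ultimately have "((\<lambda>z. E z + (\<Sum>m\<in>A. c m * Q z m)) \<longlongrightarrow> 0 + d) (at z0)"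
      by (rule tendsto_add)
    then show ?thesis
      unfolding has_field_derivative_iff by (auto simp: E_def)
  qed
  then show ?thesis
    unfolding holomorphic_on_def field_differentiable_def
    by (meson has_field_derivative_at_within)
qed

lemma affine_chart_closed: "closed (affine_chart \<sigma>)"
proof -
  have "affine_chart \<sigma> = {x. x 0 = 1} \<inter>
      (\<Inter>m\<in>dual_monoid \<sigma>. \<Inter>m'\<in>dual_monoid \<sigma>. {x. x (m + m') = x m * x m'}) \<inter>
      (\<Inter>m\<in>- dual_monoid \<sigma>. {x. x m = 0})"
    by (auto simp: affine_chart_def)
  moreover have "closed \<dots>"
    by (intro closed_Int closed_INT ballI closed_Collect_eq continuous_intros continuous_on_product_coordinates)
  ultimately show ?thesis by simp
qed

text \<open>The part of a chart on which every character is bounded is compact, by Tychonoff.\<close>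

lemma holo_on_chart_bounded:
  assumes "holo_on_chart \<sigma> f"
  obtains C where "\<And>x. x \<in> affine_chart \<sigma> \<Longrightarrow> (\<And>m. cmod (x m) \<le> R m) \<Longrightarrow> cmod (f x) \<le> C"
proof -
  let ?P = "PiE UNIV (\<lambda>m. cball (0::complex) (R m))"
  have "compactin (product_topology (\<lambda>_. euclidean) UNIV) ?P"
    unfolding compactin_PiE by simp
  then have "compact ?P"
    unfolding euclidean_product_topology compactin_euclidean_iff .
  then have "compact (?P \<inter> affine_chart \<sigma>)"
    using affine_chart_closed compact_Int_closed by blast
  moreover have "continuous_on (?P \<inter> affine_chart \<sigma>) f"
    using holo_on_chart_continuous[OF assms] by (rule continuous_on_subset) simp
  ultimately have "bounded (f ` (?P \<inter> affine_chart \<sigma>))"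
    by (intro compact_imp_bounded compact_continuous_image)
  then obtain C where C: "\<And>x. x \<in> ?P \<inter> affine_chart \<sigma> \<Longrightarrow> cmod (f x) \<le> C"
    unfolding bounded_iff by blast
  show thesis
    by (rule that[of C], rule C) auto
qed

text \<open>The torus is dense in every chart: multiplying \<open>t\<close> by the points exp (- j
  y) gives torus points that converge to \<open>x\<close> in every coordinate.\<close>

lemma holo_on_chart_eqI:
  assumes "rational_polyhedral_cone \<sigma>" "holo_on_chart \<sigma> f" "holo_on_chart \<sigma> g"
    and eq: "\<And>t. t \<in> torus \<Longrightarrow> f (chart_incl \<sigma> (torus_point t)) = g (chart_incl \<sigma> (torus_point t))"
    and x: "x \<in> affine_chart \<sigma>"
  shows "f x = g x"
proof -
  obtain t y where t: "t \<in> torus"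
    and ty: "\<And>m. m \<in> dual_monoid \<sigma> \<Longrightarrow> x m \<noteq> 0 \<Longrightarrow> rvec m \<bullet> y = 0 \<and> x m = character m t"
      "\<And>m. m \<in> dual_monoid \<sigma> \<Longrightarrow> x m = 0 \<Longrightarrow> rvec m \<bullet> y > 0"
    using affine_chart_limit_data[OF assms(1) x] by blast
  define s where "s j = (\<chi> i. t $ i * (\<chi> i. exp (- of_nat j * complex_of_real (y $ i))) $ i)" for j
  have s: "s j \<in> torus" for j
    unfolding s_def by (intro torus_mult t torus_exp)
  have cs: "character m (s j) = character m t * exp (- of_nat j * of_real (rvec m \<bullet> y))" for m j
    unfolding s_def character_mult character_exp ..
  define p where "p j = chart_incl \<sigma> (torus_point (s j))" for j
  have "(\<lambda>j. p j m) \<longlonglongrightarrow> x m" for m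
  proof (cases "m \<in> dual_monoid \<sigma>")
    case m: True
    show ?thesis
    proof (cases "x m = 0")
      case True
      then have pos: "rvec m \<bullet> y > 0" using ty(2) m by blast
      have "(\<lambda>j. cmod (character m t) * exp (- (rvec m \<bullet> y)) ^ j) \<longlonglongrightarrow> cmod (character m t) * 0"
        using pos by (intro tendsto_intros LIMSEQ_power_zero) simp
      moreover have "cmod (p j m) = cmod (character m t) * exp (- (rvec m \<bullet> y)) ^ j" for j
      proof -
        have "p j m = character m t * exp (- of_nat j * of_real (rvec m \<bullet> y))"
          using m by (simp add: p_def chart_incl_def torus_point_def cs)
        then have "cmod (p j m) = cmod (character m t) * exp (real j * (- (rvec m \<bullet> y)))"
          by (simp only: norm_mult norm_exp_eq_Re) simp
        then show ?thesis by (simp only: exp_of_nat_mult)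
      qed
      ultimately have "(\<lambda>j. cmod (p j m)) \<longlonglongrightarrow> cmod (character m t) * 0"
        by presburger
      then have "(\<lambda>j. p j m) \<longlonglongrightarrow> 0"
        unfolding mult_zero_right by (rule tendsto_norm_zero_cancel)
      then show ?thesis using True by simp
    next
      case False
      then have "p j m = x m" for j
        using ty(1)[OF m] m by (simp add: p_def chart_incl_def torus_point_def cs)
      then show ?thesis by simp
    qed
  next
    case False
    then show ?thesis
      using affine_chartD(3)[OF x] by (simp add: p_def chart_incl_def)
  qed
  then have px: "p \<longlonglongrightarrow> x" by (rule tendsto_pointwise)
  have p: "p j \<in> affine_chart \<sigma>" for j
  proof -
    have "0 \<in> \<sigma>"
      using assms(1) by (auto simp: rational_polyhedral_cone_def convex_cone_hull_contains_0)
    then show ?thesis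
      unfolding p_def by (intro chart_incl_affine_chart[OF torus_point_affine_chart[OF s]]) auto
  qed
  have "(\<lambda>j. f (p j)) \<longlonglongrightarrow> f x" "(\<lambda>j. g (p j)) \<longlonglongrightarrow> g x"
    using continuous_on_tendsto_compose[OF holo_on_chart_continuous px x] p assms(2,3) by auto
  moreover have "f (p j) = g (p j)" for j
    unfolding p_def by (rule eq[OF s])
  ultimately show ?thesis by (simp add: LIMSEQ_unique)
qed

section \<open>Laurent polynomials\<close>

text \<open>Linear independence of characters, in the form of functionals isolating one of them.\<close>

lemma character_projection:
  fixes h :: "'i \<Rightarrow> 't \<Rightarrow> complex" and op :: "'t \<Rightarrow> 't \<Rightarrow> 't"
  assumes "finite B" "i \<notin> B" and e: "e \<in> T" "\<And>j. h j e = 1"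
    and op: "\<And>s t. s \<in> T \<Longrightarrow> t \<in> T \<Longrightarrow> op s t \<in> T"
      "\<And>j s t. s \<in> T \<Longrightarrow> t \<in> T \<Longrightarrow> h j (op s t) = h j s * h j t"
    and sep: "\<And>j. j \<noteq> i \<Longrightarrow> \<exists>t\<in>T. h i t \<noteq> h j t"
  shows "\<exists>xs. snd ` set xs \<subseteq> T \<and> (\<Sum>(c, s)\<leftarrow>xs. c * h i s) = 1 \<and>
           (\<forall>j\<in>B. (\<Sum>(c, s)\<leftarrow>xs. c * h j s) = 0)"
  using assms(1,2)
proof induction
  case empty
  show ?case using e by (intro exI[of _ "[(1, e)]"]) auto
next
  case (insert k B)
  then obtain xs where xs: "snd ` set xs \<subseteq> T" "(\<Sum>(c, s)\<leftarrow>xs. c * h i s) = 1"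
    "\<And>j. j \<in> B \<Longrightarrow> (\<Sum>(c, s)\<leftarrow>xs. c * h j s) = 0" by auto
  obtain t where t: "t \<in> T" "h i t \<noteq> h k t" using sep[of k] insert.prems by auto
  define d where "d = h i t - h k t"
  \<comment> \<open>Translate by \<open>t\<close> and subtract \<open>h k t\<close> times the old
    functional: the value at \<open>j\<close> is multiplied by \<open>h j t - h k t\<close>, which
    kills \<open>k\<close>, preserves the earlier zeros, and equals \<open>d\<close> at
    \<open>i\<close>.\<close>
  define ys where "ys = map (\<lambda>(c, s). (c / d, op s t)) xs @ map (\<lambda>(c, s). (- (c * h k t) / d, s)) xs"
  have ys: "(\<Sum>(c, s)\<leftarrow>ys. c * h j s) = (\<Sum>(c, s)\<leftarrow>xs. c * h j s) * ((h j t - h k t) / d)" for j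
  proof -
    have 1: "(\<Sum>(c, s)\<leftarrow>map (\<lambda>(c, s). (c / d, op s t)) xs. c * h j s) = (\<Sum>(c, s)\<leftarrow>xs. c * h j s) * h j t / d"
      using xs(1) t(1) by (induction xs) (auto simp: op(2) add_divide_distrib ring_distribs)
    have 2: "(\<Sum>(c, s)\<leftarrow>map (\<lambda>(c, s). (- (c * h k t) / d, s)) xs. c * h j s) =
        - ((\<Sum>(c, s)\<leftarrow>xs. c * h j s) * h k t / d)"
      by (induction xs) (auto simp: add_divide_distrib ring_distribs)
    show ?thesis
      unfolding ys_def map_append sum_list_append 1 2 by (simp add: diff_divide_distrib right_diff_distrib)
  qed
  have "snd ` set ys \<subseteq> T" using xs(1) t(1) op(1) by (auto simp: ys_def)
  moreover have "(\<Sum>(c, s)\<leftarrow>ys. c * h i s) = 1"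
    using t(2) by (simp add: ys xs(2) d_def)
  moreover have "(\<Sum>(c, s)\<leftarrow>ys. c * h j s) = 0" if "j \<in> insert k B" for j
    using that by (auto simp: ys xs(3))
  ultimately show ?case by blast
qed

lemma two_powi_eq_iff: "(2 :: real) powi i = 2 powi j \<longleftrightarrow> i = j"
  using power_int_strict_increasing[of i j "2 :: real"] power_int_strict_increasing[of j i "2 :: real"]
  by (metis less_irrefl linorder_neqE one_less_numeral_iff semiring_norm(76))

text \<open>The list \<open>xs\<close> does not depend on the coefficients, so a bound on the values
  at the torus points in \<open>xs\<close> bounds the extracted coefficient as well.\<close>

lemma torus_character_projection:
  assumes "finite B" "I \<in> B"
  obtains xs where "snd ` set xs \<subseteq> (torus :: (complex ^ 'n::finite) set)"
    "\<And>a. (\<Sum>(c, s)\<leftarrow>xs. c * (\<Sum>J\<in>B. a J * character J s)) = a I"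
proof -
  let ?m = "\<lambda>s t. \<chi> i. s $ i * t $ i :: complex ^ 'n"
  have "\<exists>t\<in>torus. character I t \<noteq> character J t" if JI: "J \<noteq> I" for J :: "'n lat"
  proof -
    obtain i where i: "J $ i \<noteq> I $ i" using JI by (auto simp: vec_eq_iff)
    \<comment> \<open>The coordinate where the exponents differ is set to 2; distinct powers of 2
      have distinct moduli.\<close>
    define t :: "complex ^ 'n" where "t = (\<chi> l. if l = i then 2 else 1)"
    have "character J' t = 2 powi (J' $ i)" for J'
      by (simp add: character_def t_def if_distrib[of "\<lambda>z. z powi _"] prod.delta cong: if_cong)
    moreover have "cmod (2 powi (I $ i)) \<noteq> cmod (2 powi (J $ i))"
      using i by (simp add: norm_power_int two_powi_eq_iff)
    ultimately show ?thesis by (intro bexI[of _ t]) (auto simp: torus_def t_def)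
  qed
  then obtain xs where xs: "snd ` set xs \<subseteq> torus" "(\<Sum>(c, s)\<leftarrow>xs. c * character I s) = 1"
    "\<And>J. J \<in> B - {I} \<Longrightarrow> (\<Sum>(c, s)\<leftarrow>xs. c * character J s) = 0"
    using character_projection[of "B - {I}" I "\<chi> i. 1" torus character ?m] assms(1)
    by (auto simp: torus_one torus_mult character_mult)
  have "(\<Sum>(c, s)\<leftarrow>xs. c * (\<Sum>J\<in>B. a J * character J s)) = (\<Sum>J\<in>B. a J * (\<Sum>(c, s)\<leftarrow>xs. c * character J s))" for a
    by (induction xs) (auto simp: sum_distrib_left sum.distrib ring_distribs mult_ac)
  moreover have "(\<Sum>J\<in>B. a J * (\<Sum>(c, s)\<leftarrow>xs. c * character J s)) = a I" for a
    using assms xs(2,3) by (subst sum.remove[of B I]) auto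
  ultimately show thesis using xs(1) that by simp
qed

lemma character_independent:
  assumes "finite B" "\<And>t. t \<in> torus \<Longrightarrow> (\<Sum>J\<in>B. a J * character J t) = 0" "I \<in> B"
  shows "a I = 0"
proof -
  obtain xs where xs: "snd ` set xs \<subseteq> (torus :: (complex ^ 'a) set)"
    "\<And>a. (\<Sum>(c, s)\<leftarrow>xs. c * (\<Sum>J\<in>B. a J * character J s)) = a I"
    by (rule torus_character_projection[OF assms(1,3)]) (rule that)
  have "(\<Sum>(c, s)\<leftarrow>xs. c * (\<Sum>J\<in>B. a J * character J s)) = 0"
    using xs(1) assms(2) by (induction xs) auto
  then show ?thesis using xs(2)[of a] by simp
qed

text \<open>The interpolation data \<open>ys\<close> depend only on the exponent set
  \<open>J\<close> and not on \<open>f\<close>. This allows the same nodes and weights when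
  \<open>f\<close> varies with further coordinates.\<close>

lemma power_int_interpolation:
  assumes "finite J"
  shows "\<exists>ys :: (complex \<times> int \<times> complex) list. (\<forall>(c, j, s)\<in>set ys. s \<noteq> 0) \<and>
    (\<forall>f a. (\<forall>z. z \<noteq> 0 \<longrightarrow> f z = (\<Sum>j\<in>J. a j * z powi j)) \<longrightarrow>
       (\<forall>z. z \<noteq> 0 \<longrightarrow> f z = (\<Sum>(c, j, s)\<leftarrow>ys. c * z powi j * f s)))"
proof -
  have "\<exists>xs. snd ` set xs \<subseteq> - {0} \<and> (\<Sum>(c, s)\<leftarrow>xs. c * s powi i) = (1 :: complex) \<and>
      (\<forall>j\<in>J - {i}. (\<Sum>(c, s)\<leftarrow>xs. c * s powi j) = 0)" for i :: int
  proof (rule character_projection[of "J - {i}" i 1 "- {0 :: complex}" "\<lambda>j z. z powi j" "(*)"])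
    fix j assume "j \<noteq> i"
    then have "cmod (2 powi i) \<noteq> cmod (2 powi j)"
      by (simp add: norm_power_int two_powi_eq_iff)
    then show "\<exists>t\<in>- {0}. t powi i \<noteq> (t powi j :: complex)" by (intro bexI[of _ 2]) auto
  qed (auto simp: assms power_int_mult_distrib)
  then obtain xs where xs: "\<And>i. snd ` set (xs i) \<subseteq> - {0}" "\<And>i. (\<Sum>(c, s)\<leftarrow>xs i. c * s powi i) = 1"
    "\<And>i j. j \<in> J - {i} \<Longrightarrow> (\<Sum>(c, s)\<leftarrow>xs i. c * s powi j) = (0 :: complex)"
    by metis
  obtain js where js: "set js = J" "distinct js" using finite_distinct_list assms by blast
  define ys where "ys = concat (map (\<lambda>i. map (\<lambda>(c, s). (c, i, s)) (xs i)) js)"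
  show ?thesis
  proof (intro exI[of _ ys] conjI allI impI)
    show "\<forall>(c, j, s)\<in>set ys. s \<noteq> 0"
      using xs(1) by (fastforce simp: ys_def)
    fix f :: "complex \<Rightarrow> complex" and a and z :: complex
    assume "\<forall>z. z \<noteq> 0 \<longrightarrow> f z = (\<Sum>j\<in>J. a j * z powi j)" and "z \<noteq> 0"
    then have f: "\<And>z. z \<noteq> 0 \<Longrightarrow> f z = (\<Sum>j\<in>J. a j * z powi j)" by blast
    have coeff: "(\<Sum>(c, s)\<leftarrow>xs i. c * f s) = a i" if i: "i \<in> J" for i
    proof -
      have "(\<Sum>(c, s)\<leftarrow>ps. c * f s) = (\<Sum>j\<in>J. a j * (\<Sum>(c, s)\<leftarrow>ps. c * s powi j))"
        if "snd ` set ps \<subseteq> - {0}" for ps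
        using that by (induction ps) (auto simp: f sum_distrib_left sum.distrib ring_distribs mult_ac)
      from this[OF xs(1)] have "(\<Sum>(c, s)\<leftarrow>xs i. c * f s) = (\<Sum>j\<in>J. a j * (\<Sum>(c, s)\<leftarrow>xs i. c * s powi j))" .
      also have "\<dots> = a i"
        using i assms xs(2,3) by (subst sum.remove[of J i]) auto
      finally show ?thesis .
    qed
    have inner: "(\<Sum>(c, j, s)\<leftarrow>map (\<lambda>(c, s). (c, i, s)) ps. c * z powi j * f s) = z powi i * (\<Sum>(c, s)\<leftarrow>ps. c * f s)" for i ps
      by (induction ps) (auto simp: ring_distribs mult_ac)
    have "(\<Sum>(c, j, s)\<leftarrow>ys. c * z powi j * f s) = (\<Sum>i\<leftarrow>js. z powi i * (\<Sum>(c, s)\<leftarrow>xs i. c * f s))"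
      unfolding ys_def by (induction js) (simp_all add: inner del: map_map)
    also have "\<dots> = (\<Sum>i\<in>J. z powi i * (\<Sum>(c, s)\<leftarrow>xs i. c * f s))"
      using js by (simp add: sum_list_distinct_conv_sum_set)
    also have "\<dots> = f z"
      using coeff f[OF \<open>z \<noteq> 0\<close>] by (simp add: mult.commute)
    finally show "f z = (\<Sum>(c, j, s)\<leftarrow>ys. c * z powi j * f s)" by simp
  qed
qed

text \<open>Multiplication by the power \<open>N + 1\<close> of \<open>z\<close>, one more than the
  bound on the pole order, gives a function that tends to 0 at the origin and so extends
  holomorphically. Its growth of degree \<open>2 * N + 1\<close> makes it a polynomial, and dividing
  back gives the range of exponents.\<close>

lemma laurent_Liouville:
  assumes holo: "f holomorphic_on - {0}"
    and bound: "\<And>z. z \<noteq> 0 \<Longrightarrow> cmod (f z) \<le> C * max (cmod z) (1 / cmod z) ^ N"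
  shows "\<exists>a. \<forall>z. z \<noteq> 0 \<longrightarrow> f z = (\<Sum>j\<in>{- int N - 1..int N}. a j * z powi j)"
proof -
  have "cmod (f 1) \<le> C" using bound[of 1] by simp
  then have "C \<ge> 0" using norm_ge_zero[of "f 1"] by linarith
  define h where "h z = (if z = 0 then 0 else z ^ (N + 1) * f z)" for z
  have h_small: "cmod (h z) \<le> C * cmod z" if "cmod z \<le> 1" for z
  proof (cases "z = 0")
    case False
    then have mx: "max (cmod z) (1 / cmod z) = 1 / cmod z"
      using that by (simp add: max_def field_simps) (metis mult_le_one norm_ge_zero order_antisym)
    have "cmod (f z) \<le> C / cmod z ^ N"
      using bound[OF False] unfolding mx by (simp add: power_one_over)
    then have "cmod z ^ (N + 1) * cmod (f z) \<le> cmod z ^ (N + 1) * (C / cmod z ^ N)"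
      by (intro mult_left_mono) auto
    then show ?thesis using False by (simp add: h_def norm_mult norm_power field_simps)
  qed (simp add: h_def)
  have h_big: "cmod (h z) \<le> C * cmod z ^ (2 * N + 1)" if "1 \<le> cmod z" for z
  proof -
    have "z \<noteq> 0" using that by auto
    have "1 / cmod z \<le> 1" using that by (simp add: divide_le_eq_1)
    then have "max (cmod z) (1 / cmod z) = cmod z"
      using that by linarith
    then have "cmod z ^ (N + 1) * cmod (f z) \<le> cmod z ^ (N + 1) * (C * cmod z ^ N)"
      using bound[OF \<open>z \<noteq> 0\<close>] by (intro mult_left_mono) auto
    also have "\<dots> = C * cmod z ^ (2 * N + 1)"
      by (simp add: mult_2 power_add)
    finally show ?thesis using \<open>z \<noteq> 0\<close> by (simp add: h_def norm_mult norm_power)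
  qed
  have h_holo: "h holomorphic_on - {0}"
  proof (rule holomorphic_transform)
    show "(\<lambda>z. z ^ (N + 1) * f z) holomorphic_on - {0}"
      by (intro holomorphic_intros holo)
  qed (simp add: h_def)
  have "isCont h 0"
  proof -
    have "\<forall>\<^sub>F z in at 0. cmod (h z) \<le> C * cmod z"
      using h_small by (auto simp: eventually_at dist_norm intro!: exI[of _ 1])
    moreover have "((\<lambda>z. C * cmod z) \<longlongrightarrow> C * cmod 0) (at 0)" by (intro tendsto_intros)
    ultimately have "(h \<longlongrightarrow> 0) (at 0)"
      using Lim_null_comparison by fastforce
    then show ?thesis by (simp add: isCont_def h_def)
  qed
  moreover have "isCont h z" if "z \<noteq> 0" for z
    using holomorphic_on_imp_continuous_on[OF h_holo] that
    by (simp add: continuous_on_eq_continuous_at open_Compl)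
  ultimately have "continuous_on UNIV h"
    by (metis continuous_at_imp_continuous_on)
  then have h_UNIV: "h holomorphic_on UNIV"
    using no_isolated_singularity[of UNIV h "{0}"] h_holo by (simp add: Compl_eq_Diff_UNIV)
  define b where "b k = (deriv ^^ k) h 0 / fact k" for k
  have h_poly: "h z = (\<Sum>k\<le>2 * N + 1. b k * z ^ k)" for z
    unfolding b_def by (rule Liouville_polynomial[OF h_UNIV h_big])
  have "f z = (\<Sum>j\<in>{- int N - 1..int N}. b (nat (j + int N + 1)) * z powi j)" if "z \<noteq> 0" for z
  proof -
    have "f z = h z / z ^ (N + 1)" using that by (simp add: h_def)
    also have "\<dots> = (\<Sum>k\<le>2 * N + 1. b k * (z ^ k / z ^ (N + 1)))"
      unfolding h_poly by (simp only: sum_divide_distrib times_divide_eq_right)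
    also have "\<dots> = (\<Sum>k\<le>2 * N + 1. b k * z powi (int k - int N - 1))"
    proof (rule sum.cong[OF refl])
      fix k
      have "z powi (int k - int (N + 1)) = z ^ k / z ^ (N + 1)"
        by (subst power_int_diff, use that in blast, simp only: power_int_of_nat)
      then show "b k * (z ^ k / z ^ (N + 1)) = b k * z powi (int k - int N - 1)"
        by (simp add: algebra_simps)
    qed
    also have "\<dots> = (\<Sum>j\<in>{- int N - 1..int N}. b (nat (j + int N + 1)) * z powi j)"
      by (rule sum.reindex_bij_witness[of _ "\<lambda>j. nat (j + int N + 1)" "\<lambda>k. int k - int N - 1"]) auto
    finally show ?thesis .
  qed
  then show ?thesis by (intro exI[of _ "\<lambda>j. b (nat (j + int N + 1))"]) blast
qed

definition laurent_poly :: "(complex ^ 'n::finite \<Rightarrow> complex) \<Rightarrow> bool" where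
  "laurent_poly F \<longleftrightarrow> (\<exists>B c. finite B \<and> (\<forall>t\<in>torus. F t = (\<Sum>I\<in>B. c I * character I t)))"

lemma laurent_poly_add_monomial:
  assumes "laurent_poly F"
  shows "laurent_poly (\<lambda>t. a * character I t + F t)"
proof -
  obtain B c where B: "finite B" "\<And>t. t \<in> torus \<Longrightarrow> F t = (\<Sum>I\<in>B. c I * character I t)"
    using assms unfolding laurent_poly_def by blast
  define c' where "c' J = (if J \<in> B then c J else 0) + (if J = I then a else 0)" for J
  have "(\<Sum>J\<in>insert I B. c' J * character J t) =
      (\<Sum>J\<in>insert I B. (if J \<in> B then c J else 0) * character J t) +
      (\<Sum>J\<in>insert I B. (if J = I then a else 0) * character J t)" for t
    by (simp add: c'_def ring_distribs sum.distrib)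
  moreover have "(\<Sum>J\<in>insert I B. (if J \<in> B then c J else 0) * character J t) = (\<Sum>J\<in>B. c J * character J t)" for t
    using B(1) by (intro sum.mono_neutral_cong_right) auto
  moreover have "(\<Sum>J\<in>insert I B. (if J = I then a else 0) * character J t) = a * character I t" for t
    using B(1) by (subst sum.remove[of _ I]) (auto intro!: sum.neutral)
  ultimately have "\<forall>t\<in>torus. a * character I t + F t = (\<Sum>J\<in>insert I B. c' J * character J t)"
    using B(2) by simp
  then show ?thesis
    unfolding laurent_poly_def using B(1) by blast
qed

text \<open>Interpolation in one variable after the other reduces a separately Laurent polynomial
  function with bounded exponents to its values at finitely many points.\<close>

theorem laurent_poly_if_bounded_growth:
  fixes F :: "complex ^ 'n::finite \<Rightarrow> complex"
  assumes holo: "\<And>t i. t \<in> torus \<Longrightarrow> (\<lambda>z. F (\<chi> l. if l = i then z else t $ l)) holomorphic_on - {0}"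
    and bound: "\<And>t. t \<in> torus \<Longrightarrow> cmod (F t) \<le> C * (\<Prod>i\<in>UNIV. max (cmod (t $ i)) (1 / cmod (t $ i))) ^ N"
  shows "laurent_poly F"
proof -
  obtain ys :: "(complex \<times> int \<times> complex) list" where ys: "\<forall>(c, j, s)\<in>set ys. s \<noteq> 0"
    "\<forall>f a. (\<forall>z. z \<noteq> 0 \<longrightarrow> f z = (\<Sum>j\<in>{- int N - 1..int N}. a j * z powi j)) \<longrightarrow>
       (\<forall>z. z \<noteq> 0 \<longrightarrow> f z = (\<Sum>(c, j, s)\<leftarrow>ys. c * z powi j * f s))"
    using power_int_interpolation[of "{- int N - 1..int N}"] by auto
  \<comment> \<open>The growth constant \<open>C * M ^ N\<close> depends on the remaining
    coordinates, but the exponent range and hence \<open>ys\<close> do not.\<close>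
  have step: "F t = (\<Sum>(c, j, s)\<leftarrow>ys. c * (t $ i) powi j * F (\<chi> l. if l = i then s else t $ l))"
    if t: "t \<in> torus" for t i
  proof -
    define f where "f z = F (\<chi> l. if l = i then z else t $ l)" for z
    define M where "M = (\<Prod>l\<in>UNIV - {i}. max (cmod (t $ l)) (1 / cmod (t $ l)))"
    have "cmod (f z) \<le> (C * M ^ N) * max (cmod z) (1 / cmod z) ^ N" if "z \<noteq> 0" for z
    proof -
      let ?u = "\<chi> l. if l = i then z else t $ l"
      have "?u \<in> torus" using t that by (auto simp: torus_def)
      then have "cmod (f z) \<le> C * (\<Prod>l\<in>UNIV. max (cmod (?u $ l)) (1 / cmod (?u $ l))) ^ N"
        unfolding f_def by (rule bound)
      also have "(\<Prod>l\<in>UNIV. max (cmod (?u $ l)) (1 / cmod (?u $ l))) = max (cmod z) (1 / cmod z) * M"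
        unfolding M_def by (subst prod.remove[of UNIV i]) (auto intro!: prod.cong)
      finally show ?thesis by (simp add: power_mult_distrib mult_ac)
    qed
    moreover have "f holomorphic_on - {0}" unfolding f_def by (rule holo[OF t])
    ultimately obtain a where a: "\<forall>z. z \<noteq> 0 \<longrightarrow> f z = (\<Sum>j\<in>{- int N - 1..int N}. a j * z powi j)"
      using laurent_Liouville[of f "C * M ^ N" N] by blast
    have "t $ i \<noteq> 0" using t by (simp add: torus_def)
    with ys(2)[rule_format, of f a, OF a[rule_format]] have "f (t $ i) = (\<Sum>(c, j, s)\<leftarrow>ys. c * (t $ i) powi j * f s)" by simp
    moreover have "(\<chi> l. if l = i then t $ i else t $ l) = t" by (simp add: vec_eq_iff)
    ultimately show ?thesis by (simp add: f_def)
  qed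
  \<comment> \<open>The coordinates in \<open>K\<close> of the argument of \<open>F\<close> have
    been replaced by fixed nodes; once \<open>K\<close> is everything, only constants multiply the
    characters.\<close>
  have "\<exists>xs. (\<forall>(c, I, s)\<in>set xs. s \<in> torus) \<and>
      (\<forall>t\<in>torus. F t = (\<Sum>(c, I, s)\<leftarrow>xs. c * character I t * F (\<chi> l. if l \<in> K then s $ l else t $ l)))"
    if "finite K" for K :: "'n set"
    using that
  proof induction
    case empty
    show ?case
      by (intro exI[of _ "[(1, 0, \<chi> i. 1)]"]) (auto simp: torus_one)
  next
    case (insert k K)
    then obtain xs where xs: "\<forall>(c, I, s)\<in>set xs. s \<in> torus"
      "\<And>t. t \<in> torus \<Longrightarrow> F t = (\<Sum>(c, I, s)\<leftarrow>xs. c * character I t * F (\<chi> l. if l \<in> K then s $ l else t $ l))"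
      by auto
    \<comment> \<open>Composition of two interpolations: the weights multiply, the new exponent
      enters the character, and the node is stored in coordinate \<open>k\<close>.\<close>
    define upd where "upd = (\<lambda>(c :: complex, I :: 'n lat, s :: complex ^ 'n) (c', j, s' :: complex). (c * c', I + j *s axis k 1, \<chi> l. if l = k then s' else s $ l))"
    define zs where "zs = concat (map (\<lambda>x. map (upd x) ys) xs)"
    have char: "character (I + j *s axis k 1) t = character I t * (t $ k) powi j" if "t \<in> torus" for I j t
    proof -
      have "character (j *s axis k 1) t = (t $ k) powi j"
        by (simp add: character_def axis_def if_distrib prod.delta cong: if_cong)
      then show ?thesis using character_add[OF that] by simp
    qed
    have zs: "F t = (\<Sum>(c, I, s)\<leftarrow>zs. c * character I t * F (\<chi> l. if l \<in> insert k K then s $ l else t $ l))"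
      if t: "t \<in> torus" for t
    proof -
      have "c * character I t * F (\<chi> l. if l \<in> K then s $ l else t $ l) =
          (\<Sum>(c, I, s)\<leftarrow>map (upd (c, I, s)) ys. c * character I t * F (\<chi> l. if l \<in> insert k K then s $ l else t $ l))"
        if s: "s \<in> torus" for c I s
      proof -
        let ?u = "\<chi> l. if l \<in> K then s $ l else t $ l"
        have u: "?u \<in> torus" using s t by (auto simp: torus_def)
        have k: "?u $ k = t $ k" using insert.hyps by simp
        have eq: "(\<chi> l. if l = k then s' else ?u $ l) =
            (\<chi> l. if l \<in> insert k K then (\<chi> l. if l = k then s' else s $ l) $ l else t $ l)" for s'
          by (auto simp: vec_eq_iff)
        have "F ?u = (\<Sum>(c, j, s')\<leftarrow>ys. c * (t $ k) powi j * F (\<chi> l. if l = k then s' else ?u $ l))"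
          using step[OF u, of k] unfolding k .
        then have "c * character I t * F ?u = c * character I t *
            (\<Sum>(c, j, s')\<leftarrow>ys. c * (t $ k) powi j * F (\<chi> l. if l = k then s' else ?u $ l))" by simp
        also have "\<dots> = (\<Sum>(c, I, s)\<leftarrow>map (upd (c, I, s)) ys.
            c * character I t * F (\<chi> l. if l \<in> insert k K then s $ l else t $ l))"
          unfolding eq by (induction ys) (auto simp: upd_def char[OF t] ring_distribs mult_ac)
        finally show ?thesis .
      qed
      then have "(\<Sum>(c, I, s)\<leftarrow>xs. c * character I t * F (\<chi> l. if l \<in> K then s $ l else t $ l)) =
          (\<Sum>(c, I, s)\<leftarrow>zs. c * character I t * F (\<chi> l. if l \<in> insert k K then s $ l else t $ l))"
        unfolding zs_def using xs(1) by (induction xs) (auto split: prod.splits)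
      then show ?thesis using xs(2)[OF t] by simp
    qed
    moreover have "\<forall>(c, I, s)\<in>set zs. s \<in> torus"
    proof
      fix p assume "p \<in> set zs"
      then obtain x y where xy: "x \<in> set xs" "y \<in> set ys" "p = upd x y"
        unfolding zs_def by auto
      obtain c I s c' j s' where eq: "x = (c, I, s)" "y = (c', j, s')"
        by (metis prod_cases3)
      have "s \<in> torus" "s' \<noteq> 0"
        using xs(1) ys(1) xy(1,2) unfolding eq by auto
      then show "case p of (c, I, s) \<Rightarrow> s \<in> torus"
        unfolding xy(3) eq upd_def by (simp add: torus_def)
    qed
    ultimately show ?case by blast
  qed
  from this[of UNIV] obtain xs where
    xs: "\<And>t. t \<in> torus \<Longrightarrow> F t = (\<Sum>(c, I, s)\<leftarrow>xs. c * character I t * F (\<chi> l. s $ l))"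
    by auto
  have "laurent_poly (\<lambda>t. \<Sum>(c, I, s)\<leftarrow>ps. c * character I t * F (\<chi> l. s $ l))" for ps
  proof (induction ps)
    case Nil
    show ?case unfolding laurent_poly_def by (intro exI[of _ "{}"]) simp
  next
    case (Cons p ps)
    obtain c I s where [simp]: "p = (c, I, s)" by (cases p)
    show ?case
      using laurent_poly_add_monomial[OF Cons, of "c * F (\<chi> l. s $ l)" I] by (simp add: mult_ac)
  qed
  from this[of xs] show ?thesis
    using xs by (simp add: laurent_poly_def)
qed

section \<open>The polytope of a complete fan\<close>

lemma finite_rays: "fan \<Delta> \<Longrightarrow> finite (rays \<Delta>)"
  by (simp add: fan_def rays_def)

lemma lattice_point_polytope_iff:
  "rvec I \<in> polytope_of \<Delta> \<longleftrightarrow> (\<forall>\<alpha>\<in>rays \<Delta>. - 1 \<le> lpair I (prim_gen \<alpha>))"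
proof -
  have "(- 1 \<le> real_of_int (lpair I u)) \<longleftrightarrow> (- 1 \<le> lpair I u)" for u by linarith
  then show ?thesis by (simp add: polytope_of_def inner_rvec)
qed

text \<open>The directions in which the polytope is bounded below form a convex cone that contains
  the ray generators, hence every cone of the fan, hence all vectors. Applied to the coordinate
  directions and their negatives, this leaves finitely many lattice points.\<close>

lemma finite_polytope_lattice_points:
  assumes "fan \<Delta>" "\<Union>\<Delta> = UNIV"
  shows "finite {I. rvec I \<in> polytope_of (\<Delta> :: (real ^ 'n::finite) set set)}"
proof -
  let ?Q = "{y. \<exists>K. \<forall>I\<in>polytope_of \<Delta>. - K \<le> I \<bullet> y}"
  have Q: "convex_cone ?Q"
  proof (rule convex_cone_iff[THEN iffD2], intro conjI ballI allI impI)
    show "0 \<in> ?Q" by (auto intro!: exI[of _ 0])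
    fix y assume "y \<in> ?Q"
    then obtain K where K: "\<forall>I\<in>polytope_of \<Delta>. - K \<le> I \<bullet> y" by blast
    show "c *\<^sub>R y \<in> ?Q" if "c \<ge> 0" for c
    proof (intro CollectI exI[of _ "c * K"] ballI)
      fix I assume "I \<in> polytope_of \<Delta>"
      then have "c * - K \<le> c * (I \<bullet> y)" using K that by (intro mult_left_mono) auto
      then show "- (c * K) \<le> I \<bullet> c *\<^sub>R y" by simp
    qed
    fix y' assume "y' \<in> ?Q"
    then obtain K' where K': "\<forall>I\<in>polytope_of \<Delta>. - K' \<le> I \<bullet> y'" by blast
    show "y + y' \<in> ?Q"
    proof (intro CollectI exI[of _ "K + K'"] ballI)
      fix I assume "I \<in> polytope_of \<Delta>"
      then have "- K \<le> I \<bullet> y" "- K' \<le> I \<bullet> y'" using K K' by blast+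
      then show "- (K + K') \<le> I \<bullet> (y + y')" by (simp add: inner_add_right)
    qed
  qed
  have ray: "rvec (prim_gen \<alpha>) \<in> ?Q" if "\<alpha> \<in> rays \<Delta>" for \<alpha>
    using that by (auto simp: polytope_of_def intro!: exI[of _ 1])
  have "y \<in> ?Q" for y
  proof -
    obtain \<sigma> where \<sigma>: "\<sigma> \<in> \<Delta>" "y \<in> \<sigma>" using assms(2) by blast
    have "convex_cone hull (rvec ` prim_gen ` {\<alpha>\<in>rays \<Delta>. \<alpha> \<subseteq> \<sigma>}) \<subseteq> ?Q"
      by (rule hull_minimal[of _ _ convex_cone, OF _ Q]) (use ray in blast)
    then show ?thesis
      using fan_cone_generated_by_rays[OF assms(1) \<sigma>(1)] \<sigma>(2) by blast
  qed
  then have "\<exists>K. \<forall>I\<in>polytope_of \<Delta>. - K \<le> I \<bullet> y" for y by blast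
  then obtain K where K: "\<And>y I. I \<in> polytope_of \<Delta> \<Longrightarrow> - K y \<le> I \<bullet> y" by metis
  define N where "N = (\<Sum>i\<in>UNIV. \<bar>K (axis i 1)\<bar> + \<bar>K (- axis i 1)\<bar>)"
  have bound: "\<bar>I $ i\<bar> \<le> \<lfloor>N\<rfloor>" if "rvec I \<in> polytope_of \<Delta>" for I :: "'n lat" and i
  proof -
    have "- K (axis i 1) \<le> real_of_int (I $ i)" "- K (- axis i 1) \<le> - real_of_int (I $ i)"
      using K[OF that, of "axis i 1"] K[OF that, of "- axis i 1"]
      by (simp_all add: inner_axis)
    moreover have "\<bar>K (axis i 1)\<bar> + \<bar>K (- axis i 1)\<bar> \<le> N"
      unfolding N_def by (rule member_le_sum) auto
    ultimately have "real_of_int \<bar>I $ i\<bar> \<le> N" by linarith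
    then show ?thesis by (simp add: le_floor_iff)
  qed
  have "{I. rvec I \<in> polytope_of \<Delta>} \<subseteq> vec_lambda ` (PiE UNIV (\<lambda>_. {- \<lfloor>N\<rfloor>..\<lfloor>N\<rfloor>}))"
  proof
    fix I assume "I \<in> {I. rvec I \<in> polytope_of \<Delta>}"
    then have "\<bar>I $ i\<bar> \<le> \<lfloor>N\<rfloor>" for i using bound by blast
    then have "vec_nth I \<in> PiE UNIV (\<lambda>_. {- \<lfloor>N\<rfloor>..\<lfloor>N\<rfloor>})" by (auto simp: abs_le_iff) (metis minus_le_iff)
    then show "I \<in> vec_lambda ` (PiE UNIV (\<lambda>_. {- \<lfloor>N\<rfloor>..\<lfloor>N\<rfloor>}))"
      by (metis image_eqI vec_nth_inverse)
  qed
  then show ?thesis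
    by (rule finite_subset) (auto intro!: finite_imageI finite_PiE)
qed

lemma polyhedron_polytope_of:
  assumes "fan \<Delta>"
  shows "polyhedron (polytope_of \<Delta>)"
proof -
  have "polytope_of \<Delta> = \<Inter>((\<lambda>\<alpha>. {I. rvec (prim_gen \<alpha>) \<bullet> I \<ge> - 1}) ` rays \<Delta>)"
    by (auto simp: polytope_of_def inner_commute)
  then show ?thesis
    using finite_rays[OF assms] polyhedron_halfspace_ge by (auto intro!: polyhedron_Inter)
qed

text \<open>For a lattice point of the polytope this is the codimension of the face through it, read
  off from the active rays without naming the face.\<close>

definition lattice_rank :: "'n::finite cone set \<Rightarrow> 'n lat \<Rightarrow> nat" where
  "lattice_rank \<Delta> I = dim (rvec ` E_set \<Delta> I)"

text \<open>The face whose relative interior contains a given lattice point is cut out by the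
  inequalities that are equalities at this point.\<close>

lemma lattice_point_face:
  fixes \<Delta> :: "(real ^ 'n::finite) set set"
  assumes "fan \<Delta>" "rvec I \<in> polytope_of \<Delta>"
  obtains F where "F face_of polytope_of \<Delta>" "rvec I \<in> rel_interior F"
    "aff_dim F = int (CARD('n) - lattice_rank \<Delta> I)"
proof -
  let ?P = "polytope_of \<Delta>"
  define R where "R = {\<alpha>\<in>rays \<Delta>. lpair I (prim_gen \<alpha>) = - 1}"
  define L where "L = {y. \<forall>\<alpha>\<in>R. y \<bullet> rvec (prim_gen \<alpha>) = - 1}"
  define T where "T = (\<Inter>\<alpha>\<in>rays \<Delta> - R. {y. y \<bullet> rvec (prim_gen \<alpha>) > - 1})"
  define T' where "T' = {y. \<forall>\<alpha>\<in>rays \<Delta> - R. y \<bullet> rvec (prim_gen \<alpha>) \<ge> - 1}"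
  define F where "F = L \<inter> T'"
  have finR: "finite (rays \<Delta>)" by (rule finite_rays[OF assms(1)])
  have PL: "F = ?P \<inter> L"
    by (auto simp: F_def L_def T'_def polytope_of_def R_def)
  have "convex ?P" using polyhedron_polytope_of[OF assms(1)] polyhedron_imp_convex by blast
  \<comment> \<open>Including the polytope itself keeps the family nonempty when no ray is
    active.\<close>
  define \<F> where "\<F> = insert ?P ((\<lambda>\<alpha>. ?P \<inter> {y. rvec (prim_gen \<alpha>) \<bullet> y = - 1}) ` R)"
  have "\<Inter>\<F> face_of ?P"
  proof (rule face_of_Inter)
    fix S assume "S \<in> \<F>"
    then consider "S = ?P" | \<alpha> where "\<alpha> \<in> R" "S = ?P \<inter> {y. rvec (prim_gen \<alpha>) \<bullet> y = - 1}"
      by (auto simp: \<F>_def)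
    then show "S face_of ?P"
    proof cases
      case 2
      show ?thesis unfolding 2(2)
        by (rule face_of_Int_supporting_hyperplane_ge[OF \<open>convex ?P\<close>])
          (use 2(1) in \<open>auto simp: polytope_of_def R_def inner_commute\<close>)
    qed (simp add: face_of_refl \<open>convex ?P\<close>)
  qed (simp add: \<F>_def)
  moreover have "\<Inter>\<F> = F" by (auto simp: \<F>_def PL L_def inner_commute)
  ultimately have face: "F face_of ?P" by simp
  have IL: "rvec I \<in> L" by (auto simp: L_def R_def inner_rvec)
  have IT: "rvec I \<in> T"
    using assms(2) by (auto simp: T_def R_def inner_rvec lattice_point_polytope_iff less_le)
  have openT: "open T"
    unfolding T_def using finR by (intro open_INT) (auto intro!: open_Collect_less continuous_intros)
  have TT': "T \<subseteq> T'" by (auto simp: T_def T'_def less_imp_le)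
  have "rvec I \<in> interior T'" using openT IT TT' interior_maximal by blast
  then have "L \<inter> interior T' \<noteq> {}" using IL by blast
  moreover have affL: "affine L"
    unfolding affine_def L_def by (auto simp: inner_add_left distrib_right[symmetric])
  \<comment> \<open>The inactive inequalities hold in a neighbourhood of the point, so they do not
    shrink the affine hull.\<close>
  ultimately have "affine hull F = affine hull L"
    unfolding F_def by (intro affine_hull_affine_Int_nonempty_interior)
  also have "\<dots> = L" unfolding affine_hull_eq by (rule affL)
  finally have hull: "affine hull F = L" .
  have "rvec I \<in> rel_interior F"
    unfolding mem_rel_interior hull using openT IT IL TT' by (intro exI[of _ T]) (auto simp: F_def)
  moreover have "aff_dim F = int (CARD('n) - lattice_rank \<Delta> I)"
  proof -
    define E where "E = rvec ` E_set \<Delta> I"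
    define V where "V = {y \<in> UNIV. \<forall>x\<in>span E. orthogonal x y}"
    have "subspace V"
      unfolding V_def by (auto simp: subspace_def orthogonal_def inner_add_right)
    have "L = (+) (rvec I) ` V"
    proof
      show "L \<subseteq> (+) (rvec I) ` V"
      proof
        fix y assume y: "y \<in> L"
        have "orthogonal (y - rvec I) x" if "x \<in> E" for x
          using y IL that by (auto simp: L_def R_def E_def E_set_def orthogonal_def inner_diff_left)
        then have "orthogonal x (y - rvec I)" if "x \<in> span E" for x
          using orthogonal_to_span[OF that] orthogonal_commute by blast
        then have "y - rvec I \<in> V" by (simp add: V_def)
        then show "y \<in> (+) (rvec I) ` V" by (intro image_eqI[of _ _ "y - rvec I"]) auto
      qed
      show "(+) (rvec I) ` V \<subseteq> L"
      proof
        fix y assume "y \<in> (+) (rvec I) ` V"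
        then obtain v where v: "y = rvec I + v" "v \<in> V" by blast
        have "v \<bullet> rvec (prim_gen \<alpha>) = 0" if "\<alpha> \<in> R" for \<alpha>
        proof -
          have "rvec (prim_gen \<alpha>) \<in> span E"
            using that by (intro span_base) (auto simp: E_def E_set_def R_def)
          then show ?thesis using v(2) by (auto simp: V_def orthogonal_def inner_commute)
        qed
        then show "y \<in> L" using IL v(1) by (auto simp: L_def inner_add_left)
      qed
    qed
    then have "aff_dim L = int (dim V)"
      by (simp add: aff_dim_translation_eq aff_dim_subspace \<open>subspace V\<close>)
    moreover have "dim V + dim (span E) = CARD('n)"
      unfolding V_def using dim_subspace_orthogonal_to_vectors[of "span E" UNIV] by simp
    ultimately show ?thesis
      using hull aff_dim_affine_hull[of F] by (simp add: lattice_rank_def E_def)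
  qed
  ultimately show thesis using face that by blast
qed

lemma lattice_rank_le: "lattice_rank (\<Delta> :: (real ^ 'n::finite) set set) I \<le> CARD('n)"
  unfolding lattice_rank_def using dim_subset_UNIV[of "rvec ` E_set \<Delta> I"] by simp

text \<open>Two faces whose relative interiors share a point coincide, so \<open>F\<close> must be
  the face found in \<open>lattice_point_face\<close>.\<close>

lemma polytope_face_lattice_rank:
  fixes \<Delta> :: "(real ^ 'n::finite) set set"
  assumes "fan \<Delta>" "F \<in> polytope_faces \<Delta> d" "I \<in> int_lattice F"
  shows "rvec I \<in> polytope_of \<Delta>" "d = CARD('n) - lattice_rank \<Delta> I"
proof -
  have F: "F face_of polytope_of \<Delta>" "aff_dim F = int d" "rvec I \<in> rel_interior F"
    using assms(2,3) by (auto simp: polytope_faces_def int_lattice_def)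
  then show P: "rvec I \<in> polytope_of \<Delta>"
    using face_of_imp_subset rel_interior_subset by blast
  obtain F' where F': "F' face_of polytope_of \<Delta>" "rvec I \<in> rel_interior F'"
    "aff_dim F' = int (CARD('n) - lattice_rank \<Delta> I)"
    by (rule lattice_point_face[OF assms(1) P])
  have "F = F'" using face_of_eq[OF F(1) F'(1)] F(3) F'(2) by blast
  then show "d = CARD('n) - lattice_rank \<Delta> I" using F(2) F'(3) by simp
qed

lemma codim_lattice_iff:
  fixes \<Delta> :: "(real ^ 'n::finite) set set"
  assumes "fan \<Delta>" "i \<le> CARD('n)"
  shows "I \<in> codim_lattice \<Delta> i \<longleftrightarrow> rvec I \<in> polytope_of \<Delta> \<and> lattice_rank \<Delta> I = i"
proof
  assume "I \<in> codim_lattice \<Delta> i"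
  then obtain F where "F \<in> polytope_faces \<Delta> (CARD('n) - i)" "I \<in> int_lattice F"
    by (auto simp: codim_lattice_def)
  from polytope_face_lattice_rank[OF assms(1) this]
  show "rvec I \<in> polytope_of \<Delta> \<and> lattice_rank \<Delta> I = i"
    using assms(2) lattice_rank_le[of \<Delta> I] by simp
next
  assume I: "rvec I \<in> polytope_of \<Delta> \<and> lattice_rank \<Delta> I = i"
  then obtain F where "F face_of polytope_of \<Delta>" "rvec I \<in> rel_interior F"
    "aff_dim F = int (CARD('n) - lattice_rank \<Delta> I)"
    using lattice_point_face[OF assms(1), of I] by metis
  then show "I \<in> codim_lattice \<Delta> i"
    using I by (auto simp: codim_lattice_def polytope_faces_def int_lattice_def)
qed

lemma codim_of_eq:
  assumes "fan \<Delta>" "rvec I \<in> polytope_of \<Delta>"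
  shows "codim_of \<Delta> I = lattice_rank \<Delta> I"
  unfolding codim_of_def
  by (rule the_equality) (use codim_lattice_iff[OF assms(1)] lattice_rank_le assms(2) in auto)

lemma S_upto_iff:
  fixes \<Delta> :: "(real ^ 'n::finite) set set"
  assumes "fan \<Delta>" "k \<le> CARD('n)"
  shows "I \<in> S_upto \<Delta> k \<longleftrightarrow> rvec I \<in> polytope_of \<Delta> \<and> lattice_rank \<Delta> I \<le> k"
  using codim_lattice_iff[OF assms(1)] assms(2) by (fastforce simp: S_upto_def)

lemma sum_card_int_lattice:
  fixes \<Delta> :: "(real ^ 'n::finite) set set"
  assumes "fan \<Delta>" "\<Union>\<Delta> = UNIV"
  shows "(\<Sum>F\<in>polytope_faces \<Delta> d. card (int_lattice F)) = card (\<Union>F\<in>polytope_faces \<Delta> d. int_lattice F)"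
proof (rule card_UN_disjoint[symmetric])
  have "polytope_faces \<Delta> d \<subseteq> {F. F face_of polytope_of \<Delta>}" by (auto simp: polytope_faces_def)
  then show "finite (polytope_faces \<Delta> d)"
    using finite_polyhedron_faces[OF polyhedron_polytope_of[OF assms(1)]] finite_subset by blast
  have "int_lattice F \<subseteq> {I. rvec I \<in> polytope_of \<Delta>}" if "F \<in> polytope_faces \<Delta> d" for F
    using polytope_face_lattice_rank(1)[OF assms(1) that] by blast
  then show "\<forall>F\<in>polytope_faces \<Delta> d. finite (int_lattice F)"
    using finite_polytope_lattice_points[OF assms] finite_subset by blast
  show "\<forall>F\<in>polytope_faces \<Delta> d. \<forall>F'\<in>polytope_faces \<Delta> d. F \<noteq> F' \<longrightarrow> int_lattice F \<inter> int_lattice F' = {}"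
    using face_of_eq by (fastforce simp: polytope_faces_def int_lattice_def)
qed

section \<open>Multivectors with prescribed divisibility\<close>

lemma cpair_add_right: "cpair u (m + m') = cpair u m + cpair u m'"
  by (simp add: cpair_def ring_distribs sum.distrib)

lemma cpair_cvec: "cpair (cvec u) m = of_int (lpair m u)"
  by (simp add: cpair_def cvec_def lpair_def)

lemma cpair_scale: "cpair (c *s u) m = c * cpair u m"
  by (simp add: cpair_def sum_distrib_left mult_ac)

lemma additive_scale:
  fixes D :: "'n::finite lat \<Rightarrow> complex"
  assumes "\<And>m m'. D (m + m') = D m + D m'"
  shows "D (c *s m) = of_int c * D m"
proof -
  have D0: "D 0 = 0" using assms[of 0 0] by simp
  have nat: "D (int N *s m) = of_nat N * D m" for N m
  proof (induction N)
    case (Suc N)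
    have "int (Suc N) *s m = m + int N *s m" by (simp add: vec_eq_iff algebra_simps)
    then show ?case using Suc assms by (simp add: algebra_simps)
  qed (simp add: D0)
  show ?thesis
  proof (cases "c \<ge> 0")
    case True
    then show ?thesis using nat[of "nat c" m] by simp
  next
    case False
    have "c *s m + int (nat (- c)) *s m = 0" using False by (simp add: vec_eq_iff)
    then have "D (c *s m) + D (int (nat (- c)) *s m) = 0" using assms D0 by metis
    moreover have "of_nat (nat (- c)) = - (of_int c :: complex)" using False by (simp add: of_nat_nat)
    ultimately show ?thesis unfolding nat by (simp add: add_eq_0_iff2)
  qed
qed

lemma additive_sum:
  fixes D :: "'n::finite lat \<Rightarrow> complex"
  assumes "\<And>m m'. D (m + m') = D m + D m'"
  shows "D (\<Sum>i\<in>K. f i) = (\<Sum>i\<in>K. D (f i))"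
  using assms[of 0 0] by (induction K rule: infinite_finite_induct) (auto simp: assms)

text \<open>An additive function on M is determined by its values on the standard basis, so the
  complexified lattice is all of Hom(M, C). Membership thus becomes a condition that can be checked
  slot by slot.\<close>

lemma range_cpair_iff: "D \<in> range cpair \<longleftrightarrow> (\<forall>m m'. D (m + m') = D m + D m')"
proof
  assume "\<forall>m m'. D (m + m') = D m + D m'"
  then have add: "\<And>m m'. D (m + m') = D m + D m'" by blast
  have "D m = cpair (\<chi> i. D (axis i 1)) m" for m
  proof -
    have "D m = (\<Sum>i\<in>UNIV. D (m $ i *s axis i 1))"
      using additive_sum[of D, OF add] lattice_vec_expand[of m] by metis
    then show ?thesis by (simp add: additive_scale[of D, OF add] cpair_def)
  qed
  then show "D \<in> range cpair" by blast
qed (auto simp: cpair_add_right)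

lemma range_cpair_span:
  "range cpair = cfun.span (range (\<lambda>i::'n::finite. cpair (axis i 1)))"
proof
  have "cpair u = (\<Sum>i\<in>UNIV. cscale (u $ i) (cpair (axis i 1)))" for u :: "complex ^ 'n"
    by (auto simp: fun_eq_iff sum_fun_apply cscale_apply cpair_def axis_def if_distrib mult.commute
        cong: if_cong)
  moreover have "(\<Sum>i\<in>UNIV. cscale (u $ i) (cpair (axis i 1))) \<in> cfun.span (range (\<lambda>i::'n. cpair (axis i 1)))" for u
    by (intro cfun.span_sum cfun.span_scale cfun.span_base rangeI)
  ultimately show "range cpair \<subseteq> cfun.span (range (\<lambda>i::'n. cpair (axis i 1)))"
    by (metis (no_types, lifting) image_subsetI)
  have "cfun.subspace (range (cpair :: complex ^ 'n \<Rightarrow> _))"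
    unfolding cfun_subspace_alt by (auto simp: range_cpair_iff cscale_apply algebra_simps)
  then show "cfun.span (range (\<lambda>i::'n. cpair (axis i 1))) \<subseteq> range cpair"
    by (intro cfun.span_minimal) auto
qed

lemma ext_power_cpair_iff:
  "a \<in> ext_power k (range (cpair :: complex ^ 'n::finite \<Rightarrow> _)) \<longleftrightarrow> alternating k a \<and>
     (\<forall>ms i m m'. length ms = k \<longrightarrow> i < k \<longrightarrow> a (ms[i := m + m']) = a (ms[i := m]) + a (ms[i := m']))"
  by (subst ext_power_iff[OF range_cpair_span]) (auto simp: range_cpair_iff)

text \<open>The multivectors \<open>a\<close> such that \<open>\<chi>\<^sup>I a\<close> is regular along the divisor of each ray.\<close>

definition regular_multivectors ::
    "'n::finite cone set \<Rightarrow> nat \<Rightarrow> 'n lat \<Rightarrow> ('n lat list \<Rightarrow> complex) set" where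
  "regular_multivectors \<Delta> k I = {a \<in> ext_power k (range cpair).
     \<forall>\<alpha>\<in>rays \<Delta>. \<forall>ms. (\<forall>m\<in>set ms. 0 \<le> lpair m (prim_gen \<alpha>)) \<longrightarrow>
       lpair (I + sum_list ms) (prim_gen \<alpha>) < 0 \<longrightarrow> a ms = 0}"

lemma regular_multivectors_subspace: "cfun.subspace (regular_multivectors \<Delta> k I)"
proof -
  have "cfun.subspace (ext_power k (range cpair))" by (simp add: ext_power_def)
  then show ?thesis
    unfolding regular_multivectors_def cfun_subspace_alt by (auto simp: cscale_apply)
qed

lemma sum_list_lpair_eq_0_iff:
  assumes "\<And>m. m \<in> set ms \<Longrightarrow> 0 \<le> lpair m u"
  shows "lpair (sum_list ms) u \<ge> 0" "lpair (sum_list ms) u = 0 \<longleftrightarrow> (\<forall>m\<in>set ms. lpair m u = 0)"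
proof -
  have "lpair (sum_list ms) u \<ge> 0 \<and> (lpair (sum_list ms) u = 0 \<longleftrightarrow> (\<forall>m\<in>set ms. lpair m u = 0))"
    using assms
  proof (induction ms)
    case (Cons m ms)
    then have "lpair (sum_list ms) u \<ge> 0 \<and> (lpair (sum_list ms) u = 0 \<longleftrightarrow> (\<forall>m\<in>set ms. lpair m u = 0))"
      "0 \<le> lpair m u" by auto
    then show ?case by (auto simp: lpair_add_left)
  qed simp
  then show "lpair (sum_list ms) u \<ge> 0" "lpair (sum_list ms) u = 0 \<longleftrightarrow> (\<forall>m\<in>set ms. lpair m u = 0)" by auto
qed

text \<open>When all entries are orthogonal to \<open>e\<close>, the exponent
  \<open>I + sum_list ms\<close> pairs to -1 with \<open>e\<close>. Vanishing on such lists is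
  divisibility by \<open>e\<close> in terms of values.\<close>

lemma regular_multivectors_E_set:
  assumes "a \<in> regular_multivectors \<Delta> k I" "e \<in> E_set \<Delta> I" "\<And>m. m \<in> set ms \<Longrightarrow> lpair m e = 0"
  shows "a ms = 0"
proof -
  obtain \<alpha> where \<alpha>: "\<alpha> \<in> rays \<Delta>" "e = prim_gen \<alpha>" "lpair I e = - 1"
    using assms(2) by (auto simp: E_set_def)
  have "lpair (sum_list ms) e = 0"
    using sum_list_lpair_eq_0_iff(2)[of ms e] assms(3) by simp
  then show ?thesis
    using assms(1,3) \<alpha> by (auto simp: regular_multivectors_def lpair_add_left)
qed

text \<open>In the lattice, \<open>d *s m\<close> is the combination of the \<open>q j\<close> with
  coefficients \<open>lpair m (bs ! j)\<close>. Division by \<open>d\<close> takes place only after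
  applying \<open>D\<close>.\<close>

lemma cpair_dual_expansion:
  fixes bs :: "'n::finite lat list"
  assumes d: "d \<noteq> 0" and len: "length bs = CARD('n)"
    and dual: "\<And>i j. i < CARD('n) \<Longrightarrow> j < CARD('n) \<Longrightarrow> lpair (q i) (bs ! j) = (if i = j then d else 0)"
    and span: "span (rvec ` set bs) = UNIV"
    and D: "D \<in> range (cpair :: complex ^ 'n \<Rightarrow> _)"
  shows "D m = (\<Sum>j<CARD('n). cpair ((1 / of_int d) *s cvec (bs ! j)) m * D (q j))"
proof -
  let ?n = "CARD('n)"
  have "(rvec (d *s m) - rvec (\<Sum>j<?n. lpair m (bs ! j) *s q j)) \<bullet> b = 0" if b: "b \<in> rvec ` set bs" for b
  proof -
    obtain i where i: "i < ?n" "b = rvec (bs ! i)"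
      using b len by (auto simp: in_set_conv_nth)
    have "lpair (\<Sum>j<?n. lpair m (bs ! j) *s q j) (bs ! i) = (\<Sum>j<?n. lpair m (bs ! j) * (if j = i then d else 0))"
      unfolding lpair_sum_left lpair_scale_left using dual i(1) by (intro sum.cong) auto
    also have "\<dots> = lpair m (bs ! i) * d" using i(1) by (simp add: if_distrib cong: if_cong)
    finally show ?thesis
      unfolding i(2) by (simp add: inner_diff_left inner_rvec lpair_scale_left)
  qed
  then have "orthogonal (rvec (d *s m) - rvec (\<Sum>j<?n. lpair m (bs ! j) *s q j)) y" for y
    using orthogonal_to_span[of y "rvec ` set bs"] span by (auto simp: orthogonal_def)
  then have "rvec (d *s m) = rvec (\<Sum>j<?n. lpair m (bs ! j) *s q j)"
    using orthogonal_self right_minus_eq by blast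
  then have eq: "d *s m = (\<Sum>j<?n. lpair m (bs ! j) *s q j)" by (simp only: rvec_eq_iff)
  have add: "\<And>m m'. D (m + m') = D m + D m'" using D by (simp add: range_cpair_iff)
  have "of_int d * D m = D (d *s m)" by (simp only: additive_scale[of D, OF add])
  also have "\<dots> = (\<Sum>j<?n. of_int (lpair m (bs ! j)) * D (q j))"
    unfolding eq additive_sum[of D, OF add] additive_scale[of D, OF add] ..
  finally have "D m = (\<Sum>j<?n. of_int (lpair m (bs ! j)) * D (q j)) / of_int d"
    using d by (simp add: field_simps)
  then show ?thesis
    by (simp add: cpair_scale cpair_cvec sum_divide_distrib)
qed

section \<open>Divisibility by the wedge of the active ray generators\<close>

lemma E_basis_props:
  fixes \<Delta> :: "(real ^ 'n::finite) set set"
  shows "distinct (E_basis \<Delta> I)" "set (E_basis \<Delta> I) \<subseteq> E_set \<Delta> I"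
    "independent (rvec ` set (E_basis \<Delta> I))" "span (rvec ` set (E_basis \<Delta> I)) = span (rvec ` E_set \<Delta> I)"
    "length (E_basis \<Delta> I) = lattice_rank \<Delta> I"
proof -
  obtain B where B: "B \<subseteq> rvec ` E_set \<Delta> I" "independent B" "rvec ` E_set \<Delta> I \<subseteq> span B"
    using maximal_independent_subset by blast
  have "finite (rvec -` B)"
    using B(2) inj_rvec by (intro finite_vimageI) (auto simp: finiteI_independent)
  then obtain es where es: "set es = rvec -` B" "distinct es"
    using finite_distinct_list by blast
  have im: "rvec ` set es = B" using B(1) es(1) by auto
  have "span B = span (rvec ` E_set \<Delta> I)"
    using B(1,3) by (meson span_mono span_minimal subspace_span subset_antisym)
  then have "\<exists>es. distinct es \<and> set es \<subseteq> E_set \<Delta> I \<and> independent (rvec ` set es) \<and>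
      span (rvec ` set es) = F_perp \<Delta> I"
    using B(1,2) es im by (intro exI[of _ es]) (auto simp: F_perp_def)
  from someI_ex[OF this]
  have props: "distinct (E_basis \<Delta> I)" "set (E_basis \<Delta> I) \<subseteq> E_set \<Delta> I"
    "independent (rvec ` set (E_basis \<Delta> I))" "span (rvec ` set (E_basis \<Delta> I)) = F_perp \<Delta> I"
    unfolding E_basis_def by blast+
  then show "distinct (E_basis \<Delta> I)" "set (E_basis \<Delta> I) \<subseteq> E_set \<Delta> I"
    "independent (rvec ` set (E_basis \<Delta> I))" "span (rvec ` set (E_basis \<Delta> I)) = span (rvec ` E_set \<Delta> I)"
    by (auto simp: F_perp_def)
  have "length (E_basis \<Delta> I) = card (rvec ` set (E_basis \<Delta> I))"
    using props(1) by (simp add: card_image inj_rvec distinct_card)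
  also have "\<dots> = dim (rvec ` set (E_basis \<Delta> I))"
    using props(3) by (simp add: dim_eq_card_independent)
  also have "\<dots> = lattice_rank \<Delta> I"
    unfolding lattice_rank_def
    using props(4) by (metis F_perp_def dim_span)
  finally show "length (E_basis \<Delta> I) = lattice_rank \<Delta> I" .
qed

text \<open>Negative order along a ray requires \<open>lpair I\<close> to be -1 on its generator and
  all of \<open>ms\<close> to be orthogonal to it. The generator is a nontrivial combination of
  \<open>E_basis\<close>, so the corresponding factors of the wedge are dependent on
  \<open>ms\<close>.\<close>

lemma N_space_subset_regular:
  fixes \<Delta> :: "(real ^ 'n::finite) set set"
  assumes "fan \<Delta>" "rvec I \<in> polytope_of \<Delta>"
  shows "N_space \<Delta> k I \<subseteq> regular_multivectors \<Delta> k I"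
proof (cases "codim_of \<Delta> I \<le> k")
  case True
  define es where "es = E_basis \<Delta> I"
  have len: "length es = codim_of \<Delta> I"
    using E_basis_props(5)[of \<Delta> I] codim_of_eq[OF assms] by (simp add: es_def)
  have "wedge (map cpair (map cvec es @ us)) \<in> regular_multivectors \<Delta> k I"
    if us: "length us = k - codim_of \<Delta> I" for us
  proof -
    let ?Ds = "map cpair (map cvec es @ us)"
    have lenDs: "length ?Ds = k" using us len True by simp
    have "wedge ?Ds ms = 0"
      if \<alpha>: "\<alpha> \<in> rays \<Delta>" and nonneg: "\<forall>m\<in>set ms. 0 \<le> lpair m (prim_gen \<alpha>)"
        and neg: "lpair (I + sum_list ms) (prim_gen \<alpha>) < 0" for \<alpha> ms
    proof (cases "length ms = k")
      case lenms: True
      let ?e = "prim_gen \<alpha>"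
      have ge: "lpair (sum_list ms) ?e \<ge> 0" using sum_list_lpair_eq_0_iff(1) nonneg by blast
      have ge1: "lpair I ?e \<ge> - 1" using assms(2) \<alpha> by (auto simp: lattice_point_polytope_iff)
      then have I: "lpair I ?e = - 1" and sum0: "lpair (sum_list ms) ?e = 0"
        using neg ge by (auto simp: lpair_add_left)
      then have perp: "\<And>m. m \<in> set ms \<Longrightarrow> lpair m ?e = 0"
        using sum_list_lpair_eq_0_iff(2)[of ms ?e] nonneg by blast
      have "?e \<in> E_set \<Delta> I" using \<alpha> I by (auto simp: E_set_def)
      then have "rvec ?e \<in> span (rvec ` set es)"
        unfolding es_def E_basis_props(4) by (intro span_base imageI)
      moreover have "finite (rvec ` set es)" by simp
      ultimately obtain c where c: "rvec ?e = (\<Sum>v\<in>rvec ` set es. c v *\<^sub>R v)"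
        unfolding span_finite[OF \<open>finite (rvec ` set es)\<close>] by (meson rangeE)
      have "(\<Sum>v\<in>rvec ` set es. c v *\<^sub>R v) = (\<Sum>u\<in>set es. c (rvec u) *\<^sub>R rvec u)"
        by (subst sum.reindex[OF inj_rvec]) simp
      also have "\<dots> = (\<Sum>l<length es. c (rvec (es ! l)) *\<^sub>R rvec (es ! l))"
        using E_basis_props(1)[of \<Delta> I] bij_betw_nth[of es "{..<length es}" "set es"]
        by (subst sum.reindex_bij_betw[symmetric, of "(!) es" "{..<length es}"]) (auto simp: es_def)
      finally have e: "rvec ?e = (\<Sum>l<length es. c (rvec (es ! l)) *\<^sub>R rvec (es ! l))"
        using c by simp
      have "rvec ?e \<noteq> 0" using prim_gen_nonzero[OF assms(1) \<alpha>] by simp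
      then obtain l0 where l0: "l0 < length es" "c (rvec (es ! l0)) \<noteq> 0"
        using e by (metis (no_types, lifting) lessThan_iff scale_zero_left sum.neutral)
      show ?thesis
      proof (rule wedge_dependent[where r = "length es" and c = "\<lambda>l. of_real (c (rvec (es ! l)))" and ?l0.0 = l0])
        fix m assume "m \<in> set ms"
        then have "rvec m \<bullet> rvec ?e = 0" using perp by (simp add: inner_rvec)
        then have "(\<Sum>l<length es. c (rvec (es ! l)) * of_int (lpair m (es ! l))) = 0"
          unfolding e by (simp add: inner_sum_right inner_rvec)
        then have "(\<Sum>l<length es. complex_of_real (c (rvec (es ! l)) * of_int (lpair m (es ! l)))) = 0"
          by (simp only: of_real_sum[symmetric] of_real_0)
        then show "(\<Sum>l<length es. of_real (c (rvec (es ! l))) * (?Ds ! l) m) = 0"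
          by (simp add: nth_append cpair_cvec)
      qed (use l0 lenms lenDs in auto)
    next
      case False
      then show ?thesis
        by (intro alternating_length[OF alternating_wedge]) (use lenDs in simp)
    qed
    moreover have "wedge ?Ds \<in> ext_power k (range cpair)"
      unfolding ext_power_def using lenDs by (intro cfun.span_base CollectI exI[of _ ?Ds]) auto
    ultimately show ?thesis by (simp add: regular_multivectors_def)
  qed
  then have "{wedge (map cpair (map cvec es @ us)) | us. length us = k - codim_of \<Delta> I}
      \<subseteq> regular_multivectors \<Delta> k I" by blast
  from cfun.span_minimal[OF this regular_multivectors_subspace] show ?thesis
    using True unfolding N_space_def es_def by simp
next
  case False
  then show ?thesis
    using cfun.subspace_0[OF regular_multivectors_subspace] by (simp add: N_space_def)
qed

text \<open>Extend \<open>E_basis\<close> to a basis of the whole space. The wedges that contain all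
  \<open>i\<close> active vectors and \<open>k - i\<close> of the remaining ones form a basis, which
  is the origin of the binomial coefficient. Values at the lists \<open>p K\<close> serve as
  coordinates.\<close>

theorem regular_multivectors_basis:
  fixes \<Delta> :: "(real ^ 'n::finite) set set"
  assumes "fan \<Delta>" "rvec I \<in> polytope_of \<Delta>" and rank: "codim_of \<Delta> I \<le> k"
  obtains X :: "nat set set" and w p where "finite X"
    "card X = (CARD('n) - codim_of \<Delta> I) choose (k - codim_of \<Delta> I)"
    "\<And>K. K \<in> X \<Longrightarrow> w K \<in> N_space \<Delta> k I"
    "\<And>K K'. K \<in> X \<Longrightarrow> K' \<in> X \<Longrightarrow> w K (p K') = (if K = K' then 1 else 0)"
    "\<And>a. a \<in> regular_multivectors \<Delta> k I \<Longrightarrow> a = (\<Sum>K\<in>X. cscale (a (p K)) (w K))"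
proof -
  let ?n = "CARD('n)"
  define i where "i = codim_of \<Delta> I"
  define es where "es = E_basis \<Delta> I"
  have len_es: "length es = i"
    using E_basis_props(5)[of \<Delta> I] codim_of_eq[OF assms(1,2)] by (simp add: es_def i_def)
  obtain es' q d where len: "length (es @ es') = ?n" and d: "d \<noteq> 0"
    and dual: "\<And>i j. i < ?n \<Longrightarrow> j < ?n \<Longrightarrow> lpair (q i) ((es @ es') ! j) = (if i = j then d else 0)"
    and span: "span (rvec ` set (es @ es')) = UNIV"
    using lattice_dual_basis[OF E_basis_props(1,3)[of \<Delta> I], folded es_def] by metis
  define u where "u j = (1 / of_int d) *s cvec ((es @ es') ! j)" for j
  define b where "b j = cpair (u j)" for j
  have b_dual: "b j (q l) = (if j = l then 1 else 0)" if "j < ?n" "l < ?n" for j l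
    using dual[OF that(2,1)] d by (simp add: b_def u_def cpair_scale cpair_cvec)
  have expand: "D m = (\<Sum>j<?n. b j m * D (q j))" if "D \<in> range cpair" for D m
    unfolding b_def u_def by (rule cpair_dual_expansion[OF d len dual span that])
  \<comment> \<open>Indices below \<open>i\<close> belong to \<open>E_basis\<close> and occur in
    every wedge, so \<open>K\<close> selects only among the others.\<close>
  define X where "X = {K. K \<subseteq> {i..<?n} \<and> card K = k - i}"
  define J where "J K = [0..<i] @ sorted_list_of_set K" for K
  have "i \<le> ?n" using len len_es by simp
  have finK: "finite K" if "K \<in> X" for K using that finite_subset by (auto simp: X_def)
  have J: "set (J K) = {0..<i} \<union> K" "distinct (J K)" "length (J K) = k" if "K \<in> X" for K
    using that finK[OF that] rank by (auto simp: J_def X_def i_def)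
  have J_less: "j < ?n" if "K \<in> X" "j \<in> set (J K)" for K j
    using that J(1)[OF that(1)] \<open>i \<le> ?n\<close> by (auto simp: X_def)
  define w where "w K = wedge (map b (J K))" for K
  define p where "p K = map q (J K)" for K
  have w_p: "w K (p K') = (if K = K' then 1 else 0)" if K: "K \<in> X" "K' \<in> X" for K K'
  proof (cases "K = K'")
    case True
    have "wedge (map b (J K)) (map q (J K)) = 1"
      by (rule wedge_dual_same) (use J[OF K(1)] J_less[OF K(1)] b_dual in auto)
    then show ?thesis using True by (simp add: w_def p_def)
  next
    case False
    have "K \<inter> {0..<i} = {}" "K' \<inter> {0..<i} = {}" using K by (auto simp: X_def)
    then have "set (J K) \<noteq> set (J K')"
      using False J(1)[OF K(1)] J(1)[OF K(2)] by blast
    then have "wedge (map b (J K)) (map q (J K')) = 0"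
      by (intro wedge_dual_other) (use J[OF K(1)] J[OF K(2)] J_less K b_dual in auto)
    then show ?thesis using False by (simp add: w_def p_def)
  qed
  have w_N: "w K \<in> N_space \<Delta> k I" if K: "K \<in> X" for K
  proof -
    define vs where "vs = map u (sorted_list_of_set K)"
    have len_vs: "length vs = k - i" using K finK[OF K] by (simp add: vs_def X_def)
    \<comment> \<open>The scalar \<open>1 / of_int d\<close> contained in each \<open>b j\<close> is
      removed from every factor, so that the first \<open>i\<close> factors are literally those in
      \<open>N_space\<close>; it reappears as a \<open>k\<close>-th power.\<close>
    let ?Ds = "map cpair (map cvec es @ map (\<lambda>v. of_int d *s v) vs)"
    have scale: "map b (J K) ! l = cscale (1 / of_int d) (?Ds ! l)" if l: "l < k" for l
    proof (cases "l < i")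
      case True
      then show ?thesis
        using len_es by (auto simp: J_def nth_append b_def u_def cscale_apply cpair_scale fun_eq_iff)
    next
      case False
      then show ?thesis
        using l len_es len_vs rank finK[OF K] d K
        by (auto simp: J_def nth_append b_def vs_def cscale_apply cpair_scale fun_eq_iff i_def X_def)
    qed
    have len_Ds: "length ?Ds = k" using len_es len_vs rank by (simp add: i_def)
    have "w K ms = cscale ((1 / of_int d) ^ k) (wedge ?Ds) ms" for ms
    proof (cases "length ms = k")
      case True
      have "(\<Prod>l<k. (map b (J K) ! l) (ms ! r l)) = (1 / of_int d) ^ k * (\<Prod>l<k. (?Ds ! l) (ms ! r l))" for r
      proof -
        have "(\<Prod>l<k. (map b (J K) ! l) (ms ! r l)) = (\<Prod>l<k. (1 / of_int d) * (?Ds ! l) (ms ! r l))"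
          using scale by (intro prod.cong) (auto simp: cscale_apply)
        then show ?thesis by (simp only: prod.distrib prod_constant card_lessThan)
      qed
      moreover have "w K ms = (\<Sum>r | r permutes {..<k}. of_int (sign r) * (\<Prod>l<k. (map b (J K) ! l) (ms ! r l)))"
        using True J(3)[OF K] by (simp add: w_def wedge_def)
      moreover have "wedge ?Ds ms = (\<Sum>r | r permutes {..<k}. of_int (sign r) * (\<Prod>l<k. (?Ds ! l) (ms ! r l)))"
        unfolding wedge_def len_Ds using True by simp
      ultimately show ?thesis
        by (simp only: cscale_apply sum_distrib_left mult.left_commute)
    next
      case False
      then show ?thesis using J(3)[OF K] len_Ds by (simp add: w_def wedge_def cscale_apply)
    qed
    then have "w K = cscale ((1 / of_int d) ^ k) (wedge ?Ds)" by blast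
    moreover have "wedge ?Ds \<in> N_space \<Delta> k I"
      unfolding N_space_def using rank len_vs
      by (auto simp: es_def i_def intro!: cfun.span_base exI[of _ "map (\<lambda>v. of_int d *s v) vs"])
    moreover have "cfun.subspace (N_space \<Delta> k I)"
      using rank by (simp add: N_space_def)
    ultimately show ?thesis using cfun.subspace_scale by metis
  qed
  have "a = (\<Sum>K\<in>X. cscale (a (p K)) (w K))" if a: "a \<in> regular_multivectors \<Delta> k I" for a
  proof -
    note sub = regular_multivectors_subspace[of \<Delta> k I]
    have finX: "finite X" by (simp add: X_def)
    \<comment> \<open>The remainder vanishes at all \<open>p K\<close>; regularity and alternation
      then make it vanish at every list of nodes.\<close>
    define a' where "a' = a - (\<Sum>K\<in>X. cscale (a (p K)) (w K))"
    have a': "a' \<in> regular_multivectors \<Delta> k I"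
      unfolding a'_def using w_N N_space_subset_regular[OF assms(1,2)] a
      by (intro cfun.subspace_diff[OF sub] cfun.subspace_sum[OF sub] cfun.subspace_scale[OF sub]) auto
    have alt: "alternating k a'"
      and slots: "\<And>ms l. length ms = k \<Longrightarrow> l < k \<Longrightarrow> (\<lambda>m. a' (ms[l := m])) \<in> range cpair"
      using a' by (auto simp: regular_multivectors_def ext_power_cpair_iff range_cpair_iff)
    have "a' (p K) = 0" if K: "K \<in> X" for K
    proof -
      have "(\<Sum>K'\<in>X. a (p K') * w K' (p K)) = (\<Sum>K'\<in>X. if K' = K then a (p K') else 0)"
        using K w_p by (intro sum.cong) auto
      also have "\<dots> = a (p K)" using K finX by simp
      finally show ?thesis by (simp add: a'_def sum_fun_apply cscale_apply)
    qed
    have "a' (map q f) = 0" if f: "set f \<subseteq> {..<?n}" "length f = k" for f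
    \<comment> \<open>A distinct list with all indices below \<open>i\<close> is a permutation of
      some \<open>J K\<close>; a list missing one of them gives vectors orthogonal to an active ray
      generator.\<close>
    proof (cases "distinct f \<and> {0..<i} \<subseteq> set f")
      case True
      define K where "K = set f - {0..<i}"
      have "card K = k - i"
        using True f(2) by (simp add: K_def card_Diff_subset distinct_card)
      then have K: "K \<in> X" using f(1) by (auto simp: K_def X_def)
      have "set (J K) = set f" using J(1)[OF K] True by (auto simp: K_def)
      then have "mset f = mset (J K)"
        using True J(2)[OF K] by (simp add: set_eq_iff_mset_eq_distinct)
      then have "mset (map q f) = mset (p K)" by (simp add: p_def)
      then obtain r where "r permutes {..<length (p K)}" "permute_list r (p K) = map q f"
        by (rule mset_eq_permutation)
      moreover have "length (p K) = k" using J(3)[OF K] by (simp add: p_def)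
      ultimately show ?thesis
        using alternating_permute[OF alt, of r "p K"] \<open>\<And>K. K \<in> X \<Longrightarrow> a' (p K) = 0\<close>[OF K] by simp
    next
      case False
      then have "\<not> distinct f \<or> (\<exists>j<i. j \<notin> set f)" by (auto simp: subset_iff)
      then consider "\<not> distinct f" | j where "j < i" "j \<notin> set f" by blast
      then show ?thesis
      proof cases
        case 1
        then show ?thesis
          using alternating_not_distinct[OF alt, of "map q f"] by (simp add: distinct_map)
      next
        case 2
        show ?thesis
        proof (rule regular_multivectors_E_set[OF a', of "es ! j"])
          show "es ! j \<in> E_set \<Delta> I"
            using E_basis_props(2)[of \<Delta> I] 2(1) len_es nth_mem by (fastforce simp: es_def)
          fix m assume "m \<in> set (map q f)"
          then obtain l where l: "l \<in> set f" "m = q l" by auto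
          then show "lpair m (es ! j) = 0"
            using dual[of l j] f(1) 2 len_es \<open>i \<le> ?n\<close> by (auto simp: nth_append)
        qed
      qed
    qed
    moreover have "a' = (\<Sum>f | set f \<subseteq> {..<?n} \<and> length f = k. cscale (a' (map q f) / fact k) (wedge (map b f)))"
      using alt slots expand by (intro alternating_expansion) blast+
    ultimately have "a' = (\<Sum>f | set f \<subseteq> {..<?n} \<and> length f = k. cscale 0 (wedge (map b f)))"
      by simp
    then have "a' = 0" by (simp add: cfun.scale_zero_left)
    then show ?thesis by (simp add: a'_def)
  qed
  moreover have "card X = (?n - i) choose (k - i)"
    unfolding X_def by (subst n_subsets) auto
  ultimately show thesis
    using that[of X w p] w_N w_p by (auto simp: i_def X_def)
qed

lemma N_space_eq_regular:
  fixes \<Delta> :: "(real ^ 'n::finite) set set"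
  assumes "fan \<Delta>" "rvec I \<in> polytope_of \<Delta>" "codim_of \<Delta> I \<le> k"
  shows "N_space \<Delta> k I = regular_multivectors \<Delta> k I"
proof
  show "regular_multivectors \<Delta> k I \<subseteq> N_space \<Delta> k I"
  proof
    fix a assume a: "a \<in> regular_multivectors \<Delta> k I"
    obtain X :: "nat set set" and w p where X: "finite X"
      "card X = (CARD('n) - codim_of \<Delta> I) choose (k - codim_of \<Delta> I)"
      "\<And>K. K \<in> X \<Longrightarrow> w K \<in> N_space \<Delta> k I"
      "\<And>K K'. K \<in> X \<Longrightarrow> K' \<in> X \<Longrightarrow> w K (p K') = (if K = K' then 1 else 0)"
      "\<And>a. a \<in> regular_multivectors \<Delta> k I \<Longrightarrow> a = (\<Sum>K\<in>X. cscale (a (p K)) (w K))"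
      by (rule regular_multivectors_basis[OF assms]) (rule that)
    have sub: "cfun.subspace (N_space \<Delta> k I)" using assms(3) by (simp add: N_space_def)
    have "(\<Sum>K\<in>X. cscale (a (p K)) (w K)) \<in> N_space \<Delta> k I"
      by (intro cfun.subspace_sum[OF sub] cfun.subspace_scale[OF sub] X(3))
    then show "a \<in> N_space \<Delta> k I" using X(5)[OF a] by simp
  qed
qed (rule N_space_subset_regular[OF assms(1,2)])

text \<open>A multivector has poles of order at most one along the divisor of a ray, so no multiple of
  it is regular when \<open>\<chi>\<^sup>I\<close> has a pole of higher order; and a nonzero one of degree \<open>k\<close> is divisible
  by at most \<open>k\<close> independent vectors.\<close>

lemma regular_multivectors_zero:
  fixes \<Delta> :: "(real ^ 'n::finite) set set"
  assumes "fan \<Delta>" and a: "a \<in> regular_multivectors \<Delta> k I" "a \<noteq> 0"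
  shows "rvec I \<in> polytope_of \<Delta>" "lattice_rank \<Delta> I \<le> k"
proof -
  let ?n = "CARD('n)"
  have alt: "alternating k a"
    and slots: "\<And>ms l. length ms = k \<Longrightarrow> l < k \<Longrightarrow> (\<lambda>m. a (ms[l := m])) \<in> range cpair"
    using a by (auto simp: regular_multivectors_def ext_power_cpair_iff range_cpair_iff)
  \<comment> \<open>A nonzero alternating function cannot vanish at all lists of dual vectors, and
    lists with repeated entries give 0.\<close>
  have nz: "\<exists>f. set f \<subseteq> {..<?n} \<and> length f = k \<and> distinct f \<and> a (map q f) \<noteq> 0"
    if d: "d \<noteq> 0" and len: "length bs = ?n"
      and dual: "\<And>i j. i < ?n \<Longrightarrow> j < ?n \<Longrightarrow> lpair (q i) (bs ! j) = (if i = j then d else 0)"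
      and span: "span (rvec ` set bs) = UNIV" for q bs d
  proof (rule ccontr)
    assume none: "\<not> ?thesis"
    have "a (map q f) = 0" if "set f \<subseteq> {..<?n}" "length f = k" for f
      using none that alternating_not_distinct[OF alt, of "map q f"] by (auto simp: distinct_map)
    moreover have "a = (\<Sum>f | set f \<subseteq> {..<?n} \<and> length f = k. cscale (a (map q f) / fact k)
        (wedge (map (\<lambda>j. cpair ((1 / of_int d) *s cvec (bs ! j))) f)))"
      using alt slots cpair_dual_expansion[OF d len dual span]
      by (intro alternating_expansion) blast+
    ultimately have "a = (\<Sum>f | set f \<subseteq> {..<?n} \<and> length f = k. cscale 0
        (wedge (map (\<lambda>j. cpair ((1 / of_int d) *s cvec (bs ! j))) f)))"
      by simp
    then show False using a(2) by (simp add: cfun.scale_zero_left)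
  qed
  show "rvec I \<in> polytope_of \<Delta>"
  proof (rule ccontr)
    assume "rvec I \<notin> polytope_of \<Delta>"
    then obtain \<alpha> where \<alpha>: "\<alpha> \<in> rays \<Delta>" "lpair I (prim_gen \<alpha>) \<le> - 2"
      by (force simp: lattice_point_polytope_iff)
    define e where "e = prim_gen \<alpha>"
    obtain m0 where m0: "lpair m0 e = 1" using fan_rayE[OF assms(1) \<alpha>(1)] unfolding e_def by blast
    have "e \<noteq> 0" using m0 by auto
    obtain es' q d where B: "length ([e] @ es') = ?n" "d \<noteq> 0"
      "\<And>i j. i < ?n \<Longrightarrow> j < ?n \<Longrightarrow> lpair (q i) (([e] @ es') ! j) = (if i = j then d else 0)"
      "span (rvec ` set ([e] @ es')) = UNIV"
      using lattice_dual_basis[of "[e]"] \<open>e \<noteq> 0\<close> by (metis (no_types, lifting) distinct_singleton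
          dependent_single empty_set image_empty image_insert list.simps(15) rvec_eq_0_iff)
    obtain f where f: "set f \<subseteq> {..<?n}" "length f = k" "distinct f" "a (map q f) \<noteq> 0"
      using nz[OF B(2,1,3,4)] by blast
    \<comment> \<open>Since \<open>I\<close> pairs with \<open>e\<close> to at most -2, the total
      exponent stays negative for these lists.\<close>
    have zero: "a ms = 0" if "\<And>m. m \<in> set ms \<Longrightarrow> 0 \<le> lpair m e" "lpair (sum_list ms) e \<le> 1" for ms
      using a(1) \<alpha> that by (auto simp: regular_multivectors_def lpair_add_left e_def)
    have q: "lpair (q l) e = (if l = 0 then d else 0)" if "l < ?n" for l
      using B(3)[OF that, of 0] by simp
    have sum0: "lpair (sum_list ms) e = 0" if "\<And>m. m \<in> set ms \<Longrightarrow> lpair m e = 0" for ms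
      using sum_list_lpair_eq_0_iff(2)[of ms e] that by simp
    have "0 \<in> set f"
    proof (rule ccontr)
      assume "0 \<notin> set f"
      then have "lpair m e = 0" if "m \<in> set (map q f)" for m
        using that q f(1) by (auto split: if_splits)
      then have "a (map q f) = 0" using sum0[of "map q f"] by (intro zero) auto
      then show False using f(4) by simp
    qed
    then obtain i where i: "i < k" "f ! i = 0" using f(2) by (auto simp: in_set_conv_nth)
    define ms where "ms = map q f"
    have len: "length ms = k" using f(2) by (simp add: ms_def)
    have perp: "lpair (ms ! l) e = 0" if "l < k" "l \<noteq> i" for l
    proof -
      have "f ! l \<noteq> 0" using f(2,3) i that nth_eq_iff_index_eq[of f l i] by auto
      moreover have "f ! l < ?n" using f(1,2) that nth_mem by fastforce
      ultimately show ?thesis using that f(2) q by (simp add: ms_def)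
    qed
    have upd: "a (ms[i := m]) = 0" if m: "lpair m e = 0 \<or> m = m0" for m
    proof (rule zero)
      have mem: "lpair m' e = 0 \<or> m' = m0" if m': "m' \<in> set (ms[i := m])" for m'
      proof -
        obtain l where "l < k" "m' = ms[i := m] ! l"
          using m' len by (auto simp: in_set_conv_nth)
        then show ?thesis using m perp len by (cases "l = i") auto
      qed
      then show "0 \<le> lpair m' e" if "m' \<in> set (ms[i := m])" for m'
        using that m0 by fastforce
      have "ms[i := m] = take i ms @ m # drop (Suc i) ms"
        using i(1) len by (simp add: upd_conv_take_nth_drop)
      moreover have "lpair (sum_list (take i ms)) e = 0" "lpair (sum_list (drop (Suc i) ms)) e = 0"
        using perp len i(1) by (auto intro!: sum0 simp: in_set_conv_nth)
      ultimately show "lpair (sum_list (ms[i := m])) e \<le> 1"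
        using m m0 by (auto simp: lpair_add_left)
    qed
    have D: "(\<lambda>m. a (ms[i := m])) \<in> range cpair" using slots[OF len i(1)] .
    then have add: "\<And>m m'. a (ms[i := m + m']) = a (ms[i := m]) + a (ms[i := m'])"
      by (simp add: range_cpair_iff)
    \<comment> \<open>\<open>q 0\<close> pairs to \<open>d\<close> with \<open>e\<close>, which may
      be negative or exceed 1. It is split into a part orthogonal to \<open>e\<close> and a multiple
      of \<open>m0\<close>; at either of these vectors the slot function is 0.\<close>
    have "q 0 = (q 0 - d *s m0) + d *s m0" by simp
    then have "a (ms[i := q 0]) = a (ms[i := q 0 - d *s m0]) + a (ms[i := d *s m0])"
      using add by metis
    also have "a (ms[i := d *s m0]) = of_int d * a (ms[i := m0])"
      using additive_scale[of "\<lambda>m. a (ms[i := m])", OF add] .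
    also have "lpair (q 0 - d *s m0) e = 0"
      using q[of 0] m0 by (simp add: lpair_diff_left lpair_scale_left)
    then have "a (ms[i := q 0 - d *s m0]) = 0" by (intro upd) blast
    also have "a (ms[i := m0]) = 0" by (intro upd) blast
    finally have "a (ms[i := q 0]) = 0" by simp
    moreover have "ms[i := q 0] = map q f"
      using i f(2) by (simp add: ms_def map_update[symmetric]) (metis list_update_id)
    ultimately show False using f(4) by simp
  qed
  define es where "es = E_basis \<Delta> I"
  have es: "distinct es" "independent (rvec ` set es)" "set es \<subseteq> E_set \<Delta> I" "length es = lattice_rank \<Delta> I"
    using E_basis_props[of \<Delta> I] by (auto simp: es_def)
  obtain es' q d where B: "length (es @ es') = ?n" "d \<noteq> 0"
    "\<And>i j. i < ?n \<Longrightarrow> j < ?n \<Longrightarrow> lpair (q i) ((es @ es') ! j) = (if i = j then d else 0)"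
    "span (rvec ` set (es @ es')) = UNIV"
    using lattice_dual_basis[OF es(1,2)] by metis
  obtain f where f: "set f \<subseteq> {..<?n}" "length f = k" "distinct f" "a (map q f) \<noteq> 0"
    using nz[OF B(2,1,3,4)] by blast
  have "{..<length es} \<subseteq> set f"
  proof (rule ccontr)
    assume "\<not> {..<length es} \<subseteq> set f"
    then obtain j where j: "j < length es" "j \<notin> set f" by auto
    have "a (map q f) = 0"
    proof (rule regular_multivectors_E_set[OF a(1), of "es ! j"])
      show "es ! j \<in> E_set \<Delta> I" using es(3) j(1) nth_mem by blast
      fix m assume "m \<in> set (map q f)"
      then obtain l where l: "l \<in> set f" "m = q l" by auto
      then show "lpair m (es ! j) = 0"
        using B(3)[of l j] B(1) f(1) j by (auto simp: nth_append)
    qed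
    then show False using f(4) by simp
  qed
  then have "card {..<length es} \<le> card (set f)" by (intro card_mono) auto
  then show "lattice_rank \<Delta> I \<le> k"
    using es(4) f(2,3) by (simp add: distinct_card)
qed

section \<open>Multivector fields on the torus\<close>

lemma sum_list_update_group:
  fixes ms :: "'a::ab_group_add list"
  assumes "i < length ms"
  shows "sum_list (ms[i := m]) = sum_list (ms[i := 0]) + m"
  using assms by (simp add: upd_conv_take_nth_drop add_ac)

lemma sum_list_permute:
  fixes ms :: "'a::comm_monoid_add list"
  assumes "p permutes {..<length ms}"
  shows "sum_list (permute_list p ms) = sum_list ms"
  using mset_permute_list[OF assms] by (metis sum_mset_sum_list)

lemma tangent_space_subspace: "cfun.subspace (tangent_space \<sigma> x)"
  unfolding tangent_space_def cfun_subspace_alt by (auto simp: cscale_apply algebra_simps)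

text \<open>\<open>cfun.dim\<close> is the cardinality of a basis, which is 0 for an infinite one;
  since \<open>CARD('n)\<close> is positive, smoothness provides a finite basis.\<close>

lemma tangent_space_finite_dim:
  assumes "toric_smooth \<Delta>" "\<sigma> \<in> \<Delta>" "x \<in> affine_chart \<sigma>"
  obtains B where "finite B" "tangent_space \<sigma> x = cfun.span B"
proof -
  obtain B where B: "B \<subseteq> tangent_space \<sigma> x" "cfun.independent B" "tangent_space \<sigma> x \<subseteq> cfun.span B"
    "card B = cfun.dim (tangent_space \<sigma> x)"
    by (rule cfun.basis_exists)
  have "card B > 0" using assms B(4) by (simp add: toric_smooth_def)
  then have "finite B" by (simp add: card_gt_0_iff)
  moreover have "cfun.span B \<subseteq> tangent_space \<sigma> x"
    by (rule cfun.span_minimal[OF B(1) tangent_space_subspace])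
  ultimately show thesis using B(3) that by blast
qed

lemma ext_power_tangent_iff:
  assumes "toric_smooth \<Delta>" "\<sigma> \<in> \<Delta>" "x \<in> affine_chart \<sigma>"
  shows "\<phi> \<in> ext_power k (tangent_space \<sigma> x) \<longleftrightarrow> alternating k \<phi> \<and>
    (\<forall>ms i. length ms = k \<longrightarrow> i < k \<longrightarrow> (\<lambda>m. \<phi> (ms[i := m])) \<in> tangent_space \<sigma> x)"
proof -
  obtain B where "finite B" "tangent_space \<sigma> x = cfun.span B"
    by (rule tangent_space_finite_dim[OF assms])
  then show ?thesis using ext_power_iff by blast
qed

lemma multivector_fieldsD:
  assumes "v \<in> multivector_fields \<Delta> k"
  shows "\<sigma> \<in> \<Delta> \<Longrightarrow> x \<in> affine_chart \<sigma> \<Longrightarrow> (\<lambda>ms. v (\<sigma>, x, ms)) \<in> ext_power k (tangent_space \<sigma> x)"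
    and "\<sigma> \<in> \<Delta> \<Longrightarrow> set ms \<subseteq> dual_monoid \<sigma> \<Longrightarrow> holo_on_chart \<sigma> (\<lambda>x. v (\<sigma>, x, ms))"
    and "\<sigma> \<in> \<Delta> \<Longrightarrow> \<tau> \<in> \<Delta> \<Longrightarrow> \<tau> \<subseteq> \<sigma> \<Longrightarrow> x \<in> affine_chart \<tau> \<Longrightarrow> set ms \<subseteq> dual_monoid \<sigma> \<Longrightarrow>
          v (\<sigma>, chart_incl \<sigma> x, ms) = v (\<tau>, x, ms)"
    and "\<not> (\<sigma> \<in> \<Delta> \<and> x \<in> affine_chart \<sigma>) \<Longrightarrow> v (\<sigma>, x, ms) = 0"
proof -
  note v = assms[unfolded multivector_fields_def, THEN CollectD]
  show "\<sigma> \<in> \<Delta> \<Longrightarrow> x \<in> affine_chart \<sigma> \<Longrightarrow> (\<lambda>ms. v (\<sigma>, x, ms)) \<in> ext_power k (tangent_space \<sigma> x)"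
    using v[THEN conjunct1] by simp
  show "\<sigma> \<in> \<Delta> \<Longrightarrow> set ms \<subseteq> dual_monoid \<sigma> \<Longrightarrow> holo_on_chart \<sigma> (\<lambda>x. v (\<sigma>, x, ms))"
    using v[THEN conjunct2, THEN conjunct1] by simp
  show "\<sigma> \<in> \<Delta> \<Longrightarrow> \<tau> \<in> \<Delta> \<Longrightarrow> \<tau> \<subseteq> \<sigma> \<Longrightarrow> x \<in> affine_chart \<tau> \<Longrightarrow> set ms \<subseteq> dual_monoid \<sigma> \<Longrightarrow>
      v (\<sigma>, chart_incl \<sigma> x, ms) = v (\<tau>, x, ms)"
    using v[THEN conjunct2, THEN conjunct2, THEN conjunct1] by simp
  show "\<not> (\<sigma> \<in> \<Delta> \<and> x \<in> affine_chart \<sigma>) \<Longrightarrow> v (\<sigma>, x, ms) = 0"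
    using v[THEN conjunct2, THEN conjunct2, THEN conjunct2] by simp
qed

section \<open>Holomorphic functions on a chart and multivector fields as vector spaces\<close>

lemma complex_diff_at_mono:
  assumes "complex_diff_at A g w" "A \<subseteq> A'" "finite A'"
  shows "complex_diff_at A' g w"
proof -
  obtain c where c: "\<And>\<epsilon>. \<epsilon> > 0 \<Longrightarrow> \<forall>\<^sub>F w' in nhds w.
      cmod (g w' - g w - (\<Sum>m\<in>A. c m * (w' m - w m))) \<le> \<epsilon> * (\<Sum>m\<in>A. cmod (w' m - w m))"
    using assms(1) unfolding complex_diff_at_def by blast
  define c' where "c' m = (if m \<in> A then c m else 0)" for m
  have eq: "(\<Sum>m\<in>A'. c' m * (w' m - w m)) = (\<Sum>m\<in>A. c m * (w' m - w m))" for w'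
    using assms(2,3) by (intro sum.mono_neutral_cong_right) (auto simp: c'_def)
  show ?thesis
    unfolding complex_diff_at_def
  proof (intro exI[of _ c'] allI impI)
    fix \<epsilon> :: real assume "\<epsilon> > 0"
    show "\<forall>\<^sub>F w' in nhds w. cmod (g w' - g w - (\<Sum>m\<in>A'. c' m * (w' m - w m)))
        \<le> \<epsilon> * (\<Sum>m\<in>A'. cmod (w' m - w m))"
      using c[OF \<open>\<epsilon> > 0\<close>]
    proof eventually_elim
      case (elim w')
      have "(\<Sum>m\<in>A. cmod (w' m - w m)) \<le> (\<Sum>m\<in>A'. cmod (w' m - w m))"
        using assms(2,3) by (intro sum_mono2) auto
      then have "\<epsilon> * (\<Sum>m\<in>A. cmod (w' m - w m)) \<le> \<epsilon> * (\<Sum>m\<in>A'. cmod (w' m - w m))"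
        using \<open>\<epsilon> > 0\<close> by (intro mult_left_mono) auto
      then show ?case using elim unfolding eq by linarith
    qed
  qed
qed

lemma complex_diff_at_add:
  assumes "complex_diff_at A g w" "complex_diff_at A h w"
  shows "complex_diff_at A (\<lambda>w. g w + h w) w"
proof -
  obtain c where c: "\<And>\<epsilon>. \<epsilon> > 0 \<Longrightarrow> \<forall>\<^sub>F w' in nhds w.
      cmod (g w' - g w - (\<Sum>m\<in>A. c m * (w' m - w m))) \<le> \<epsilon> * (\<Sum>m\<in>A. cmod (w' m - w m))"
    using assms(1) unfolding complex_diff_at_def by blast
  obtain d where d: "\<And>\<epsilon>. \<epsilon> > 0 \<Longrightarrow> \<forall>\<^sub>F w' in nhds w.
      cmod (h w' - h w - (\<Sum>m\<in>A. d m * (w' m - w m))) \<le> \<epsilon> * (\<Sum>m\<in>A. cmod (w' m - w m))"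
    using assms(2) unfolding complex_diff_at_def by blast
  show ?thesis
    unfolding complex_diff_at_def
  proof (intro exI[of _ "\<lambda>m. c m + d m"] allI impI)
    fix \<epsilon> :: real assume "\<epsilon> > 0"
    then have "\<epsilon> / 2 > 0" by simp
    show "\<forall>\<^sub>F w' in nhds w. cmod (g w' + h w' - (g w + h w) - (\<Sum>m\<in>A. (c m + d m) * (w' m - w m)))
        \<le> \<epsilon> * (\<Sum>m\<in>A. cmod (w' m - w m))"
      using c[OF \<open>\<epsilon> / 2 > 0\<close>] d[OF \<open>\<epsilon> / 2 > 0\<close>]
    proof eventually_elim
      case (elim w')
      have eq: "g w' + h w' - (g w + h w) - (\<Sum>m\<in>A. (c m + d m) * (w' m - w m)) =
          (g w' - g w - (\<Sum>m\<in>A. c m * (w' m - w m))) + (h w' - h w - (\<Sum>m\<in>A. d m * (w' m - w m)))"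
        by (simp add: ring_distribs(2) sum.distrib)
      show ?case
        unfolding eq
        using elim norm_triangle_ineq[of "g w' - g w - (\<Sum>m\<in>A. c m * (w' m - w m))"
            "h w' - h w - (\<Sum>m\<in>A. d m * (w' m - w m))"] by linarith
    qed
  qed
qed

lemma complex_diff_at_linear: "complex_diff_at {m0} (\<lambda>w. a * w m0) w"
  unfolding complex_diff_at_def
  by (rule exI[of _ "\<lambda>_. a"]) (auto simp: right_diff_distrib intro!: always_eventually)

lemma complex_diff_at_scale:
  assumes "complex_diff_at A g w"
  shows "complex_diff_at A (\<lambda>w. a * g w) w"
proof (cases "a = 0")
  case True
  then show ?thesis
    unfolding complex_diff_at_def
    by (intro exI[of _ "\<lambda>_. 0"]) (auto intro!: always_eventually mult_nonneg_nonneg sum_nonneg)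
next
  case False
  obtain c where c: "\<And>\<epsilon>. \<epsilon> > 0 \<Longrightarrow> \<forall>\<^sub>F w' in nhds w.
      cmod (g w' - g w - (\<Sum>m\<in>A. c m * (w' m - w m))) \<le> \<epsilon> * (\<Sum>m\<in>A. cmod (w' m - w m))"
    using assms(1) unfolding complex_diff_at_def by blast
  show ?thesis
    unfolding complex_diff_at_def
  proof (intro exI[of _ "\<lambda>m. a * c m"] allI impI)
    fix \<epsilon> :: real assume "\<epsilon> > 0"
    then have "\<epsilon> / cmod a > 0" using False by simp
    from c[OF this] show "\<forall>\<^sub>F w' in nhds w. cmod (a * g w' - a * g w - (\<Sum>m\<in>A. a * c m * (w' m - w m)))
        \<le> \<epsilon> * (\<Sum>m\<in>A. cmod (w' m - w m))"
    proof eventually_elim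
      case (elim w')
      have eq: "a * g w' - a * g w - (\<Sum>m\<in>A. a * c m * (w' m - w m)) =
          a * (g w' - g w - (\<Sum>m\<in>A. c m * (w' m - w m)))"
        by (simp add: right_diff_distrib sum_distrib_left mult.assoc)
      have "cmod a * cmod (g w' - g w - (\<Sum>m\<in>A. c m * (w' m - w m)))
          \<le> cmod a * (\<epsilon> / cmod a * (\<Sum>m\<in>A. cmod (w' m - w m)))"
        by (intro mult_left_mono elim) simp
      also have "\<dots> = \<epsilon> * (\<Sum>m\<in>A. cmod (w' m - w m))" using False by simp
      finally show ?case unfolding eq norm_mult .
    qed
  qed
qed

lemma holo_on_chart_add:
  assumes "holo_on_chart \<sigma> f" "holo_on_chart \<sigma> f'"
  shows "holo_on_chart \<sigma> (\<lambda>x. f x + f' x)"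
  unfolding holo_on_chart_def
proof
  fix x assume x: "x \<in> affine_chart \<sigma>"
  obtain A G g where 1: "finite A" "A \<subseteq> dual_monoid \<sigma>" "open G" "x \<in> G"
    "\<And>w. w \<in> G \<Longrightarrow> complex_diff_at A g w" "\<And>y. y \<in> G \<inter> affine_chart \<sigma> \<Longrightarrow> f y = g y"
    using assms(1) x unfolding holo_on_chart_def by metis
  obtain A' G' g' where 2: "finite A'" "A' \<subseteq> dual_monoid \<sigma>" "open G'" "x \<in> G'"
    "\<And>w. w \<in> G' \<Longrightarrow> complex_diff_at A' g' w" "\<And>y. y \<in> G' \<inter> affine_chart \<sigma> \<Longrightarrow> f' y = g' y"
    using assms(2) x unfolding holo_on_chart_def by metis
  have "complex_diff_at (A \<union> A') (\<lambda>w. g w + g' w) w" if "w \<in> G \<inter> G'" for w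
    using that 1(1) 2(1)
    by (intro complex_diff_at_add complex_diff_at_mono[OF 1(5)] complex_diff_at_mono[OF 2(5)]) auto
  then show "\<exists>A G g. finite A \<and> A \<subseteq> dual_monoid \<sigma> \<and> open G \<and> x \<in> G \<and>
      (\<forall>w\<in>G. complex_diff_at A g w) \<and> (\<forall>y\<in>G \<inter> affine_chart \<sigma>. f y + f' y = g y)"
    using 1 2 by (intro exI[of _ "A \<union> A'"] exI[of _ "G \<inter> G'"] exI[of _ "\<lambda>w. g w + g' w"]) auto
qed

lemma holo_on_chart_scale:
  assumes "holo_on_chart \<sigma> f"
  shows "holo_on_chart \<sigma> (\<lambda>x. a * f x)"
  unfolding holo_on_chart_def
proof
  fix x assume x: "x \<in> affine_chart \<sigma>"
  obtain A G g where 1: "finite A" "A \<subseteq> dual_monoid \<sigma>" "open G" "x \<in> G"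
    "\<And>w. w \<in> G \<Longrightarrow> complex_diff_at A g w" "\<And>y. y \<in> G \<inter> affine_chart \<sigma> \<Longrightarrow> f y = g y"
    using assms(1) x unfolding holo_on_chart_def by metis
  then show "\<exists>A G g. finite A \<and> A \<subseteq> dual_monoid \<sigma> \<and> open G \<and> x \<in> G \<and>
      (\<forall>w\<in>G. complex_diff_at A g w) \<and> (\<forall>y\<in>G \<inter> affine_chart \<sigma>. a * f y = g y)"
    by (intro exI[of _ A] exI[of _ G] exI[of _ "\<lambda>w. a * g w"]) (auto intro: complex_diff_at_scale)
qed

text \<open>For \<open>m\<close> outside the dual monoid the coordinate \<open>x m\<close> is 0 on
  the whole chart, so every exponent gives a holomorphic function.\<close>

lemma holo_on_chart_monomial: "holo_on_chart \<sigma> (\<lambda>x. a * x m)"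
proof (cases "m \<in> dual_monoid \<sigma>")
  case True
  then show ?thesis
    unfolding holo_on_chart_def
    by (intro ballI exI[of _ "{m}"] exI[of _ UNIV] exI[of _ "\<lambda>x. a * x m"]) (auto simp: complex_diff_at_linear)
next
  case False
  have "complex_diff_at {} (\<lambda>_. 0) w" for w :: "'a point"
    unfolding complex_diff_at_def by simp
  then show ?thesis
    unfolding holo_on_chart_def using False
    by (intro ballI exI[of _ "{}"] exI[of _ UNIV] exI[of _ "\<lambda>_. 0"]) (auto simp: affine_chartD(3))
qed

lemma multivector_fields_subspace: "cfun.subspace (multivector_fields \<Delta> k)"
proof -
  have ext: "cfun.subspace (ext_power k V)" for V :: "('a lat \<Rightarrow> complex) set"
    by (simp add: ext_power_def)
  have zero: "holo_on_chart \<sigma> (\<lambda>x. 0)" for \<sigma> :: "'a cone"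
    using holo_on_chart_monomial[of \<sigma> 0] by simp
  show ?thesis
    unfolding cfun_subspace_alt
  proof (intro conjI ballI allI)
    show "0 \<in> multivector_fields \<Delta> k"
      using cfun.subspace_0[OF ext] zero by (simp add: multivector_fields_def zero_fun_def)
    fix u v assume u: "u \<in> multivector_fields \<Delta> k"
    note uD = multivector_fieldsD[OF u]
    show "cscale c u \<in> multivector_fields \<Delta> k" for c
      unfolding multivector_fields_def
    proof (intro CollectI conjI ballI allI impI)
      fix \<sigma> x assume "\<sigma> \<in> \<Delta>" "x \<in> affine_chart \<sigma>"
      then have "cscale c (\<lambda>ms. u (\<sigma>, x, ms)) \<in> ext_power k (tangent_space \<sigma> x)"
        by (intro cfun.subspace_scale[OF ext] uD)
      then show "(\<lambda>ms. cscale c u (\<sigma>, x, ms)) \<in> ext_power k (tangent_space \<sigma> x)"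
        by (simp add: cscale_def)
    next
      fix \<sigma> ms assume "\<sigma> \<in> \<Delta>" "set ms \<subseteq> dual_monoid \<sigma>"
      then show "holo_on_chart \<sigma> (\<lambda>x. cscale c u (\<sigma>, x, ms))"
        unfolding cscale_apply by (intro holo_on_chart_scale uD)
    qed (simp_all add: cscale_apply uD)
    assume v: "v \<in> multivector_fields \<Delta> k"
    note vD = multivector_fieldsD[OF v]
    show "u + v \<in> multivector_fields \<Delta> k"
      unfolding multivector_fields_def
    proof (intro CollectI conjI ballI allI impI)
      fix \<sigma> x assume "\<sigma> \<in> \<Delta>" "x \<in> affine_chart \<sigma>"
      then have "(\<lambda>ms. u (\<sigma>, x, ms)) + (\<lambda>ms. v (\<sigma>, x, ms)) \<in> ext_power k (tangent_space \<sigma> x)"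
        by (intro cfun.subspace_add[OF ext] uD vD)
      then show "(\<lambda>ms. (u + v) (\<sigma>, x, ms)) \<in> ext_power k (tangent_space \<sigma> x)"
        by (simp add: plus_fun_def)
    next
      fix \<sigma> ms assume "\<sigma> \<in> \<Delta>" "set ms \<subseteq> dual_monoid \<sigma>"
      then show "holo_on_chart \<sigma> (\<lambda>x. (u + v) (\<sigma>, x, ms))"
        unfolding plus_fun_apply by (intro holo_on_chart_add uD vD)
    qed (simp_all add: uD vD)
  qed
qed

text \<open>On lists from the dual monoid, density of the torus applies. On other lists holomorphy
  says nothing; there the tangent condition in the offending slot, or the length condition, gives
  0.\<close>

lemma multivector_fields_eqI:
  assumes "fan \<Delta>" "u \<in> multivector_fields \<Delta> k" "v \<in> multivector_fields \<Delta> k" "toric_smooth \<Delta>"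
    and eq: "\<And>t ms. t \<in> torus \<Longrightarrow> u ({0}, torus_point t, ms) = v ({0}, torus_point t, ms)"
  shows "u = v"
proof -
  have "u (\<sigma>, x, ms) = v (\<sigma>, x, ms)" for \<sigma> x ms
  proof (cases "\<sigma> \<in> \<Delta> \<and> x \<in> affine_chart \<sigma>")
    case True
    then have \<sigma>: "\<sigma> \<in> \<Delta>" and x: "x \<in> affine_chart \<sigma>" by auto
    show ?thesis
    proof (cases "set ms \<subseteq> dual_monoid \<sigma>")
      case ms: True
      have "{0} \<subseteq> \<sigma>" using fan_contains_0[OF assms(1) \<sigma>] by simp
      show ?thesis
      proof (rule holo_on_chart_eqI[OF fanD(1)[OF assms(1) \<sigma>] _ _ _ x])
        show "holo_on_chart \<sigma> (\<lambda>x. u (\<sigma>, x, ms))" "holo_on_chart \<sigma> (\<lambda>x. v (\<sigma>, x, ms))"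
          using multivector_fieldsD(2) assms(2,3) \<sigma> ms by blast+
        fix t :: "complex ^ 'a" assume t: "t \<in> torus"
        show "u (\<sigma>, chart_incl \<sigma> (torus_point t), ms) = v (\<sigma>, chart_incl \<sigma> (torus_point t), ms)"
          using multivector_fieldsD(3)[OF assms(2) \<sigma> fan_zero[OF assms(1)] \<open>{0} \<subseteq> \<sigma>\<close> torus_point_affine_chart[OF t] ms]
            multivector_fieldsD(3)[OF assms(3) \<sigma> fan_zero[OF assms(1)] \<open>{0} \<subseteq> \<sigma>\<close> torus_point_affine_chart[OF t] ms]
            eq[OF t] by simp
      qed
    next
      case False
      have vanish: "w (\<sigma>, x, ms) = 0" if w: "w \<in> multivector_fields \<Delta> k" for w
      proof (cases "length ms = k")
        case True
        obtain i where i: "i < k" "ms ! i \<notin> dual_monoid \<sigma>"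
          using False True by (auto simp: in_set_conv_nth subset_iff)
        have "(\<lambda>m. w (\<sigma>, x, ms[i := m])) \<in> tangent_space \<sigma> x"
          using multivector_fieldsD(1)[OF w \<sigma> x] True i(1)
          unfolding ext_power_tangent_iff[OF assms(4) \<sigma> x] by blast
        then have "w (\<sigma>, x, ms[i := ms ! i]) = 0"
          using i(2) unfolding tangent_space_def by blast
        then show ?thesis by simp
      next
        case False
        then show ?thesis
          using multivector_fieldsD(1)[OF w \<sigma> x] alternating_length
          unfolding ext_power_tangent_iff[OF assms(4) \<sigma> x] by blast
      qed
      show ?thesis using vanish[OF assms(2)] vanish[OF assms(3)] by simp
    qed
  next
    case False
    then show ?thesis using multivector_fieldsD(4) assms(2,3) by metis
  qed
  then show ?thesis by auto
qed

text \<open>The value at the torus point \<open>t\<close> in the invariant frame of the tangent bundle of the torus.\<close>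

definition log_part ::
    "('n::finite cone \<times> 'n point \<times> 'n lat list \<Rightarrow> complex) \<Rightarrow> complex ^ 'n \<Rightarrow> 'n lat list \<Rightarrow> complex" where
  "log_part v t ms = v ({0}, torus_point t, ms) / character (sum_list ms) t"

lemma torus_value_log_part:
  "t \<in> torus \<Longrightarrow> v ({0}, torus_point t, ms) = log_part v t ms * character (sum_list ms) t"
  by (simp add: log_part_def character_nonzero)

text \<open>Divided by the character of \<open>m + m'\<close>, the Leibniz rule at a torus point
  becomes additivity in \<open>m\<close>. This carries multivectors at any torus point into one
  fixed space.\<close>

lemma log_part_ext_power:
  assumes "fan \<Delta>" "toric_smooth \<Delta>" "v \<in> multivector_fields \<Delta> k" "t \<in> torus"
  shows "log_part v t \<in> ext_power k (range cpair)"
proof -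
  let ?x = "torus_point t"
  have x: "?x \<in> affine_chart {0}" by (rule torus_point_affine_chart[OF assms(4)])
  have v: "alternating k (\<lambda>ms. v ({0}, ?x, ms))"
    "\<And>ms i. length ms = k \<Longrightarrow> i < k \<Longrightarrow> (\<lambda>m. v ({0}, ?x, ms[i := m])) \<in> tangent_space {0} ?x"
    using multivector_fieldsD(1)[OF assms(3) fan_zero[OF assms(1)] x]
    unfolding ext_power_tangent_iff[OF assms(2) fan_zero[OF assms(1)] x] by blast+
  show ?thesis
    unfolding ext_power_cpair_iff
  proof (intro conjI allI impI)
    show "alternating k (log_part v t)"
      unfolding alternating_def
    proof (intro conjI allI impI)
      show "log_part v t ms = 0" if "length ms \<noteq> k" for ms
        using alternating_length[OF v(1) that] by (simp add: log_part_def)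
      fix p and ms :: "'a lat list" assume p: "p permutes {..<k}" "length ms = k"
      then show "log_part v t (permute_list p ms) = of_int (sign p) * log_part v t ms"
        using alternating_permute[OF v(1) p] sum_list_permute[of p ms] by (simp add: log_part_def)
    qed
    fix ms :: "'a lat list" and i m m' assume i: "length ms = k" "i < k"
    have "v ({0}, ?x, ms[i := m + m']) =
        character m t * v ({0}, ?x, ms[i := m']) + character m' t * v ({0}, ?x, ms[i := m])"
      using v(2)[OF i] by (simp add: tangent_space_def torus_point_def)
    moreover define s0 where "s0 = sum_list (ms[i := 0])"
    have "sum_list (ms[i := n]) = s0 + n" for n
      unfolding s0_def using sum_list_update_group i by blast
    ultimately show "log_part v t (ms[i := m + m']) = log_part v t (ms[i := m]) + log_part v t (ms[i := m'])"
      using character_nonzero[OF assms(4)]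
      by (simp add: log_part_def character_add[OF assms(4)] field_simps)
  qed
qed

lemma log_part_additive:
  assumes "fan \<Delta>" "toric_smooth \<Delta>" "v \<in> multivector_fields \<Delta> k" "t \<in> torus" "length ms = k" "i < k"
  shows "log_part v t (ms[i := m + m']) = log_part v t (ms[i := m]) + log_part v t (ms[i := m'])"
  using log_part_ext_power[OF assms(1-4)] assms(5,6) unfolding ext_power_cpair_iff by blast

text \<open>Never less than 1 on the torus and large as soon as one coordinate approaches 0 or
  infinity, so a power of it dominates every character, including those with negative
  exponents.\<close>

definition torus_height :: "complex ^ 'n::finite \<Rightarrow> real" where
  "torus_height t = (\<Prod>i\<in>UNIV. max (cmod (t $ i)) (1 / cmod (t $ i)))"

lemma max_inverse_ge_1: "(r::real) > 0 \<Longrightarrow> 1 \<le> max r (1 / r)"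
  by (cases "r \<ge> 1") (auto simp: le_max_iff_disj)

lemma torus_height_ge_1: "t \<in> torus \<Longrightarrow> 1 \<le> torus_height t"
  unfolding torus_height_def by (intro prod_ge_1 max_inverse_ge_1) (auto simp: torus_def)

lemma norm_character_le:
  assumes "t \<in> torus"
  shows "cmod (character m t) \<le> torus_height t ^ nat (\<Sum>i\<in>UNIV. \<bar>m $ i\<bar>)"
proof -
  define N where "N = nat (\<Sum>i\<in>UNIV. \<bar>m $ i\<bar>)"
  have "cmod (t $ i) powi m $ i \<le> max (cmod (t $ i)) (1 / cmod (t $ i)) ^ N" for i
  proof -
    let ?r = "cmod (t $ i)" let ?M = "max ?r (1 / ?r)"
    have r: "?r > 0" using assms by (simp add: torus_def)
    have M: "1 \<le> ?M" by (rule max_inverse_ge_1[OF r])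
    have "?r powi m $ i \<le> ?M ^ nat \<bar>m $ i\<bar>"
    proof (cases "m $ i \<ge> 0")
      case True
      then show ?thesis using r by (auto simp: power_int_def intro!: power_mono)
    next
      case False
      then have "?r powi m $ i = (1 / ?r) ^ nat \<bar>m $ i\<bar>" by (simp add: power_int_def inverse_eq_divide)
      also have "\<dots> \<le> ?M ^ nat \<bar>m $ i\<bar>" using r by (intro power_mono) auto
      finally show ?thesis .
    qed
    also have "nat \<bar>m $ i\<bar> \<le> N"
      unfolding N_def by (intro nat_mono member_le_sum) auto
    then have "?M ^ nat \<bar>m $ i\<bar> \<le> ?M ^ N" using M by (intro power_increasing)
    finally show ?thesis .
  qed
  then have "cmod (character m t) \<le> (\<Prod>i\<in>UNIV. max (cmod (t $ i)) (1 / cmod (t $ i)) ^ N)"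
    unfolding norm_character by (intro prod_mono) auto
  then show ?thesis by (simp add: torus_height_def prod_power_distrib N_def)
qed

definition moderate_growth :: "(complex ^ 'n::finite) set \<Rightarrow> (complex ^ 'n \<Rightarrow> complex) \<Rightarrow> bool" where
  "moderate_growth R F \<longleftrightarrow> (\<exists>C N. \<forall>t\<in>R. cmod (F t) \<le> C * torus_height t ^ N)"

lemma moderate_growth_diff:
  assumes "moderate_growth R F" "moderate_growth R G" "R \<subseteq> torus"
  shows "moderate_growth R (\<lambda>t. F t - G t)"
proof -
  obtain C N where F: "\<And>t. t \<in> R \<Longrightarrow> cmod (F t) \<le> C * torus_height t ^ N"
    using assms(1) unfolding moderate_growth_def by blast
  obtain C' N' where G: "\<And>t. t \<in> R \<Longrightarrow> cmod (G t) \<le> C' * torus_height t ^ N'"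
    using assms(2) unfolding moderate_growth_def by blast
  have "cmod (F t - G t) \<le> (\<bar>C\<bar> + \<bar>C'\<bar>) * torus_height t ^ (N + N')" if "t \<in> R" for t
  proof -
    have h: "1 \<le> torus_height t" using torus_height_ge_1 assms(3) that by blast
    have "C * torus_height t ^ N \<le> \<bar>C\<bar> * torus_height t ^ (N + N')"
      "C' * torus_height t ^ N' \<le> \<bar>C'\<bar> * torus_height t ^ (N + N')"
      using h by (auto intro!: mult_mono power_increasing)
    then show ?thesis
      using F[OF that] G[OF that] norm_triangle_ineq4[of "F t" "G t"] by (simp add: ring_distribs)
  qed
  then show ?thesis unfolding moderate_growth_def by blast
qed

lemma moderate_growth_UN:
  assumes "finite S" "\<And>s. s \<in> S \<Longrightarrow> moderate_growth (R s) F" "(\<Union>s\<in>S. R s) \<subseteq> torus"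
  shows "moderate_growth (\<Union>s\<in>S. R s) F"
proof -
  obtain C N where F: "\<And>s t. s \<in> S \<Longrightarrow> t \<in> R s \<Longrightarrow> cmod (F t) \<le> C s * torus_height t ^ N s"
    using assms(2) unfolding moderate_growth_def by metis
  have "cmod (F t) \<le> (\<Sum>s\<in>S. \<bar>C s\<bar>) * torus_height t ^ (\<Sum>s\<in>S. N s)" if s: "s \<in> S" "t \<in> R s" for s t
  proof -
    have h: "1 \<le> torus_height t" using torus_height_ge_1 assms(3) s by blast
    have "C s \<le> (\<Sum>s\<in>S. \<bar>C s\<bar>)"
      using member_le_sum[of s S "\<lambda>s. \<bar>C s\<bar>"] assms(1) s by auto
    moreover have "N s \<le> (\<Sum>s\<in>S. N s)" using assms(1) s by (intro member_le_sum) auto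
    ultimately have "C s * torus_height t ^ N s \<le> (\<Sum>s\<in>S. \<bar>C s\<bar>) * torus_height t ^ (\<Sum>s\<in>S. N s)"
      using h by (intro mult_mono power_increasing) (auto intro: sum_nonneg)
    then show ?thesis using F[OF s] by linarith
  qed
  then show ?thesis unfolding moderate_growth_def by blast
qed

text \<open>Completeness covers the torus by the regions on which a field is bounded in some chart.\<close>

lemma log_part_moderate_growth:
  assumes "fan \<Delta>" "\<Union>\<Delta> = UNIV" "toric_smooth \<Delta>" "v \<in> multivector_fields \<Delta> k"
  shows "moderate_growth torus (\<lambda>t. log_part v t ms)"
proof (cases "length ms = k")
  case len: True
  \<comment> \<open>On the part of the torus where the vector of the
    \<open>- ln (cmod (t $ i))\<close> lies in \<open>\<sigma>\<close>, every character in the dual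
    monoid has modulus at most 1.\<close>
  define R :: "'a cone \<Rightarrow> (complex ^ 'a) set" where
    "R \<sigma> = {t \<in> torus. (\<chi> i. - ln (cmod (t $ i))) \<in> \<sigma>}" for \<sigma>
  have "moderate_growth (R \<sigma>) (\<lambda>t. log_part v t ms)" if \<sigma>: "\<sigma> \<in> \<Delta>" for \<sigma>
  proof -
    have base: "moderate_growth (R \<sigma>) (\<lambda>t. log_part v t ms)" if ms: "set ms \<subseteq> dual_monoid \<sigma>" for ms
    proof -
      obtain C where C: "\<And>x. x \<in> affine_chart \<sigma> \<Longrightarrow> (\<And>m. cmod (x m) \<le> 1) \<Longrightarrow> cmod (v (\<sigma>, x, ms)) \<le> C"
        using holo_on_chart_bounded[OF multivector_fieldsD(2)[OF assms(4) \<sigma> ms], of "\<lambda>_. 1"] by metis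
      have "cmod (log_part v t ms) \<le> C * torus_height t ^ nat (\<Sum>i\<in>UNIV. \<bar>(- sum_list ms) $ i\<bar>)"
        if t: "t \<in> R \<sigma>" for t
      proof -
        have tor: "t \<in> torus" using t by (simp add: R_def)
        have sub: "{0} \<subseteq> \<sigma>" using fan_contains_0[OF assms(1) \<sigma>] by simp
        define x where "x = chart_incl \<sigma> (torus_point t)"
        have x: "x \<in> affine_chart \<sigma>"
          unfolding x_def by (rule chart_incl_affine_chart[OF torus_point_affine_chart[OF tor] sub])
        have "cmod (x m) \<le> 1" for m
        proof (cases "m \<in> dual_monoid \<sigma>")
          case True
          have "t $ i \<noteq> 0" for i using tor by (simp add: torus_def)
          then have "cmod (character m t) = (\<Prod>i\<in>UNIV. exp (ln (cmod (t $ i))) powi m $ i)"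
            by (simp add: norm_character)
          also have "\<dots> = exp (- (rvec m \<bullet> (\<chi> i. - ln (cmod (t $ i)))))"
            by (simp add: exp_power_int exp_sum[symmetric] inner_vec_def sum_negf)
          also have "\<dots> \<le> 1" using t True by (auto simp: R_def dual_monoid_def)
          finally show ?thesis using True by (simp add: x_def chart_incl_def torus_point_def)
        qed (simp add: x_def chart_incl_def)
        then have "cmod (v (\<sigma>, x, ms)) \<le> C" by (rule C[OF x])
        then have le: "cmod (v ({0}, torus_point t, ms)) \<le> C"
          using multivector_fieldsD(3)[OF assms(4) \<sigma> fan_zero[OF assms(1)] sub torus_point_affine_chart[OF tor] ms]
          by (simp add: x_def)
        then have "C \<ge> 0" using norm_ge_zero order_trans by blast
        have "cmod (log_part v t ms) = cmod (v ({0}, torus_point t, ms)) * cmod (character (- sum_list ms) t)"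
          by (simp add: log_part_def character_minus norm_mult divide_inverse)
        also have "\<dots> \<le> C * torus_height t ^ nat (\<Sum>i\<in>UNIV. \<bar>(- sum_list ms) $ i\<bar>)"
          by (intro mult_mono le norm_character_le[OF tor] \<open>C \<ge> 0\<close>) auto
        finally show ?thesis .
      qed
      then show ?thesis unfolding moderate_growth_def by blast
    qed
    \<comment> \<open>Induction on the number \<open>j\<close> of leading entries allowed to lie
      outside the dual monoid; each is written as a difference of two elements of the
      monoid.\<close>
    have "moderate_growth (R \<sigma>) (\<lambda>t. log_part v t ms)"
      if "j \<le> k" "length ms = k" "\<And>i. j \<le> i \<Longrightarrow> i < k \<Longrightarrow> ms ! i \<in> dual_monoid \<sigma>" for j ms
      using that
    proof (induction j arbitrary: ms)
      case 0
      then have "set ms \<subseteq> dual_monoid \<sigma>" by (auto simp: in_set_conv_nth)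
      then show ?case by (rule base)
    next
      case (Suc j)
      obtain a b where ab: "a \<in> dual_monoid \<sigma>" "b \<in> dual_monoid \<sigma>" "ms ! j = a - b"
        by (rule dual_monoid_generates[OF fanD(1,2)[OF assms(1) \<sigma>]])
      have grow: "moderate_growth (R \<sigma>) (\<lambda>t. log_part v t (ms[j := c]))" if "c \<in> dual_monoid \<sigma>" for c
        using Suc.prems that by (intro Suc.IH) (auto simp: nth_list_update)
      have eq: "log_part v t ms = log_part v t (ms[j := a]) - log_part v t (ms[j := b])" if "t \<in> R \<sigma>" for t
      proof -
        have "t \<in> torus" using that by (simp add: R_def)
        then have "log_part v t (ms[j := ms ! j + b]) = log_part v t (ms[j := ms ! j]) + log_part v t (ms[j := b])"
          using Suc.prems by (intro log_part_additive[OF assms(1,3,4)]) auto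
        then show ?thesis using ab(3) list_update_id[of ms j] by simp
      qed
      have "moderate_growth (R \<sigma>) (\<lambda>t. log_part v t (ms[j := a]) - log_part v t (ms[j := b]))"
        by (intro moderate_growth_diff grow ab) (auto simp: R_def)
      then show ?case unfolding moderate_growth_def using eq by simp
    qed
    from this[of k ms] show ?thesis using len by simp
  qed
  then have "moderate_growth (\<Union>\<sigma>\<in>\<Delta>. R \<sigma>) (\<lambda>t. log_part v t ms)"
    using assms(1) by (intro moderate_growth_UN) (auto simp: fan_def R_def)
  moreover have "(\<Union>\<sigma>\<in>\<Delta>. R \<sigma>) = torus"
    using assms(2) by (auto simp: R_def)
  ultimately show ?thesis by simp
next
  case False
  have "log_part v t ms = 0" if "t \<in> torus" for t
    using log_part_ext_power[OF assms(1,3,4) that] alternating_length False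
    unfolding ext_power_cpair_iff by blast
  then show ?thesis
    unfolding moderate_growth_def by (intro exI[of _ 0]) simp
qed

lemma log_part_laurent_poly:
  assumes "fan \<Delta>" "\<Union>\<Delta> = UNIV" "toric_smooth \<Delta>" "v \<in> multivector_fields \<Delta> k"
  shows "laurent_poly (\<lambda>t. log_part v t ms)"
proof -
  obtain C N where CN: "\<And>t. t \<in> torus \<Longrightarrow> cmod (log_part v t ms) \<le> C * torus_height t ^ N"
    using log_part_moderate_growth[OF assms] unfolding moderate_growth_def by blast
  show ?thesis
  proof (rule laurent_poly_if_bounded_growth)
    show "cmod (log_part v t ms) \<le> C * (\<Prod>i\<in>UNIV. max (cmod (t $ i)) (1 / cmod (t $ i))) ^ N"
      if "t \<in> torus" for t
      using CN[OF that] by (simp add: torus_height_def)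
    fix t :: "complex ^ 'a" and i assume t: "t \<in> torus"
    let ?u = "\<lambda>z. \<chi> l. if l = i then z else t $ l"
    have u: "?u z \<in> torus" if "z \<in> - {0}" for z using t that by (auto simp: torus_def)
    have char: "(\<lambda>z. character m (?u z)) holomorphic_on - {0}" for m
    proof -
      have "character m (?u z) = z powi (m $ i) * (\<Prod>l\<in>UNIV - {i}. t $ l powi m $ l)" for z
        unfolding character_def by (subst prod.remove[of _ i]) (auto intro!: prod.cong)
      moreover have "(\<lambda>z. z powi (m $ i) * (\<Prod>l\<in>UNIV - {i}. t $ l powi m $ l)) holomorphic_on - {0}"
        by (intro holomorphic_intros) auto
      ultimately show ?thesis by simp
    qed
    have "(\<lambda>z. v ({0}, torus_point (?u z), ms)) holomorphic_on - {0}"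
    proof (rule holo_on_chart_compose[where p = "\<lambda>z. torus_point (?u z)"])
      show "holo_on_chart {0} (\<lambda>x. v ({0}, x, ms))"
        by (rule multivector_fieldsD(2)[OF assms(4) fan_zero[OF assms(1)]]) simp
      show "(\<lambda>z. torus_point (?u z) m) holomorphic_on - {0}" for m
        unfolding torus_point_def by (rule char)
    qed (use u torus_point_affine_chart in auto)
    then show "(\<lambda>z. log_part v (?u z) ms) holomorphic_on - {0}"
      unfolding log_part_def using u character_nonzero by (intro holomorphic_on_divide char) auto
  qed
qed

text \<open>The Laurent expansions for different \<open>ms\<close> may involve different exponents,
  and there are infinitely many \<open>ms\<close>. Expanding in finitely many lists of dual vectors
  yields one finite set of exponents and shows that each coefficient is a multivector.\<close>

theorem log_part_expansion:
  fixes \<Delta> :: "(real ^ 'n::finite) set set"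
  assumes "fan \<Delta>" "\<Union>\<Delta> = UNIV" "toric_smooth \<Delta>" "v \<in> multivector_fields \<Delta> k"
  obtains B a where "finite B" "\<And>I. a I \<in> ext_power k (range cpair)"
    "\<And>t ms. t \<in> torus \<Longrightarrow> log_part v t ms = (\<Sum>I\<in>B. a I ms * character I t)"
proof -
  let ?n = "CARD('n)"
  have "distinct ([] :: 'n lat list)" "independent (rvec ` set ([] :: 'n lat list))"
    by (simp_all add: independent_empty)
  then obtain bs q d where "length ([] @ bs) = ?n" and d: "d \<noteq> 0"
    and "\<And>i j. i < ?n \<Longrightarrow> j < ?n \<Longrightarrow> lpair (q i) (([] @ bs) ! j) = (if i = j then d else 0)"
    and "span (rvec ` set ([] @ bs :: 'n lat list)) = UNIV"
    by (rule lattice_dual_basis) (rule that)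
  then have B: "length bs = ?n" "d \<noteq> 0"
    "\<And>i j. i < ?n \<Longrightarrow> j < ?n \<Longrightarrow> lpair (q i) (bs ! j) = (if i = j then d else 0)"
    "span (rvec ` set bs) = UNIV"
    unfolding append_Nil by blast+
  define b where "b j = cpair ((1 / of_int d) *s cvec (bs ! j))" for j
  let ?L = "{f. set f \<subseteq> {..<?n} \<and> length f = k}"
  have finL: "finite ?L" by (rule finite_lists_length_eq) simp
  have expand: "log_part v t = (\<Sum>f\<in>?L. cscale (log_part v t (map q f) / fact k) (wedge (map b f)))"
    if t: "t \<in> torus" for t
  proof (rule alternating_expansion)
    have w: "log_part v t \<in> ext_power k (range cpair)"
      by (rule log_part_ext_power[OF assms(1,3,4) t])
    then show "alternating k (log_part v t)" unfolding ext_power_cpair_iff by blast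
    fix ms :: "'n lat list" and i m assume "length ms = k" "i < k"
    then have slot: "(\<lambda>m. log_part v t (ms[i := m])) \<in> range cpair"
      using w unfolding ext_power_cpair_iff range_cpair_iff by blast
    show "log_part v t (ms[i := m]) = (\<Sum>j<?n. b j m * log_part v t (ms[i := q j]))"
      unfolding b_def by (rule cpair_dual_expansion[OF B(2,1,3,4) slot])
  qed
  have "\<exists>B c. finite B \<and> (\<forall>t\<in>torus. log_part v t ms = (\<Sum>I\<in>B. c I * character I t))" for ms
    using log_part_laurent_poly[OF assms] unfolding laurent_poly_def .
  then obtain E c where E: "\<And>ms. finite (E ms)"
    "\<And>ms t. t \<in> torus \<Longrightarrow> log_part v t ms = (\<Sum>I\<in>E ms. c ms I * character I t)"
    by metis
  define S where "S = (\<Union>f\<in>?L. E (map q f))"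
  define c' where "c' f I = (if I \<in> E (map q f) then c (map q f) I else 0)" for f I
  have finS: "finite S" using finL E(1) by (auto simp: S_def)
  have c': "log_part v t (map q f) = (\<Sum>I\<in>S. c' f I * character I t)" if "t \<in> torus" "f \<in> ?L" for t f
  proof -
    have "(\<Sum>I\<in>S. c' f I * character I t) = (\<Sum>I\<in>E (map q f). c (map q f) I * character I t)"
      using finS that(2) by (intro sum.mono_neutral_cong_right) (auto simp: c'_def S_def)
    then show ?thesis using E(2)[OF that(1)] by simp
  qed
  define a where "a I = (\<Sum>f\<in>?L. cscale (c' f I / fact k) (wedge (map b f)))" for I
  have "a I \<in> ext_power k (range cpair)" for I
    unfolding a_def ext_power_def
  proof (intro cfun.span_sum cfun.span_scale cfun.span_base)
    fix f assume "f \<in> ?L"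
    then show "wedge (map b f) \<in> {wedge Ds |Ds. length Ds = k \<and> set Ds \<subseteq> range cpair}"
      by (intro CollectI exI[of _ "map b f"]) (auto simp: b_def)
  qed
  moreover have "log_part v t ms = (\<Sum>I\<in>S. a I ms * character I t)" if t: "t \<in> torus" for t ms
  proof -
    have "log_part v t ms = (\<Sum>f\<in>?L. log_part v t (map q f) / fact k * wedge (map b f) ms)"
      by (subst expand[OF t]) (simp add: sum_fun_apply cscale_apply)
    also have "\<dots> = (\<Sum>f\<in>?L. \<Sum>I\<in>S. c' f I * character I t / fact k * wedge (map b f) ms)"
      using c'[OF t] by (intro sum.cong) (auto simp: sum_distrib_right sum_divide_distrib)
    also have "\<dots> = (\<Sum>I\<in>S. a I ms * character I t)"
      by (subst sum.swap) (auto simp: a_def sum_fun_apply cscale_apply sum_distrib_left sum_distrib_right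
          intro!: sum.cong)
    finally show ?thesis .
  qed
  ultimately show thesis using that[of S a] finS by blast
qed

text \<open>Approaching the divisor of a ray along its one-parameter subgroup, a component of negative
  order would be unbounded; the components are separated by translations of the torus.\<close>

theorem log_part_coefficient_regular:
  fixes \<Delta> :: "(real ^ 'n::finite) set set"
  assumes "fan \<Delta>" "v \<in> multivector_fields \<Delta> k"
    and B: "finite B" "I \<in> B" "a I \<in> ext_power k (range cpair)"
    and rep: "\<And>t ms. t \<in> torus \<Longrightarrow> log_part v t ms = (\<Sum>I\<in>B. a I ms * character I t)"
  shows "a I \<in> regular_multivectors \<Delta> k I"
  unfolding regular_multivectors_def
proof (intro CollectI conjI B(3) ballI allI impI)
  fix \<alpha> ms assume \<alpha>: "\<alpha> \<in> rays \<Delta>" and nonneg: "\<forall>m\<in>set ms. 0 \<le> lpair m (prim_gen \<alpha>)"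
    and neg: "lpair (I + sum_list ms) (prim_gen \<alpha>) < 0"
  define e where "e = prim_gen \<alpha>"
  have \<alpha>\<Delta>: "\<alpha> \<in> \<Delta>" using \<alpha> by (simp add: rays_def)
  have S: "dual_monoid \<alpha> = {m. 0 \<le> lpair m e}" unfolding e_def by (rule dual_monoid_ray[OF assms(1) \<alpha>])
  have ms: "set ms \<subseteq> dual_monoid \<alpha>" using nonneg by (auto simp: S e_def)
  have sub: "{0} \<subseteq> \<alpha>" using fan_contains_0[OF assms(1) \<alpha>\<Delta>] by simp
  \<comment> \<open>The one-parameter subgroup of \<open>e\<close>; as \<open>s\<close> grows,
    characters pairing positively with \<open>e\<close> decay.\<close>
  define lam :: "real \<Rightarrow> complex ^ 'n" where "lam s = (\<chi> i. exp (- of_real s * of_real (rvec e $ i)))" for s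
  have char_lam: "character m (lam s) = of_real (exp (- s * of_int (lpair m e)))" for m s
    unfolding lam_def character_exp inner_rvec by (simp flip: exp_of_real)
  have lam: "lam s \<in> torus" for s unfolding lam_def by (rule torus_exp)
  define mul where "mul u s = (\<chi> i. u $ i * lam s $ i)" for u s
  have mul: "mul u s \<in> torus" if "u \<in> torus" for u s
    unfolding mul_def by (rule torus_mult[OF that lam])
  have char_mul: "character m (mul u s) = character m u * character m (lam s)" for m u s
    unfolding mul_def by (rule character_mult)
  \<comment> \<open>The exponential factor undoes the division by the character of
    \<open>sum_list ms\<close> in \<open>log_part\<close>, up to a constant depending on
    \<open>u\<close>.\<close>
  have bound: "\<exists>K. \<forall>s\<ge>0. cmod (log_part v (mul u s) ms) * exp (- s * of_int (lpair (sum_list ms) e)) \<le> K"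
    if u: "u \<in> torus" for u
  proof -
    obtain C where C: "\<And>x. x \<in> affine_chart \<alpha> \<Longrightarrow> (\<And>m. cmod (x m) \<le> cmod (character m u)) \<Longrightarrow>
        cmod (v (\<alpha>, x, ms)) \<le> C"
      using holo_on_chart_bounded[OF multivector_fieldsD(2)[OF assms(2) \<alpha>\<Delta> ms], of "\<lambda>m. cmod (character m u)"] by metis
    have "cmod (log_part v (mul u s) ms) * exp (- s * of_int (lpair (sum_list ms) e))
        \<le> C / cmod (character (sum_list ms) u)" if s: "s \<ge> 0" for s
    proof -
      define x where "x = chart_incl \<alpha> (torus_point (mul u s))"
      have x: "x \<in> affine_chart \<alpha>"
        unfolding x_def by (rule chart_incl_affine_chart[OF torus_point_affine_chart[OF mul[OF u]] sub])
      have "cmod (x m) \<le> cmod (character m u)" for m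
      proof (cases "m \<in> dual_monoid \<alpha>")
        case True
        then have "exp (- s * of_int (lpair m e)) \<le> 1" using s by (simp add: S)
        then have "cmod (character m u) * exp (- s * of_int (lpair m e)) \<le> cmod (character m u) * 1"
          by (intro mult_left_mono) auto
        then show ?thesis
          using True by (simp add: x_def chart_incl_def torus_point_def char_mul char_lam norm_mult)
      qed (simp add: x_def chart_incl_def)
      then have "cmod (v (\<alpha>, x, ms)) \<le> C" by (rule C[OF x])
      moreover have "v (\<alpha>, x, ms) = log_part v (mul u s) ms * character (sum_list ms) (mul u s)"
        using multivector_fieldsD(3)[OF assms(2) \<alpha>\<Delta> fan_zero[OF assms(1)] sub torus_point_affine_chart[OF mul[OF u]] ms]
          torus_value_log_part[OF mul[OF u]] by (simp add: x_def)
      ultimately show ?thesis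
        using character_nonzero[OF u, of "sum_list ms"]
        by (simp add: char_mul char_lam norm_mult pos_le_divide_eq mult_ac)
    qed
    then show ?thesis by blast
  qed
  then obtain K where K: "\<And>u s. u \<in> torus \<Longrightarrow> s \<ge> 0 \<Longrightarrow>
      cmod (log_part v (mul u s) ms) * exp (- s * of_int (lpair (sum_list ms) e)) \<le> K u"
    by metis
  obtain xs where xs: "snd ` set xs \<subseteq> (torus :: (complex ^ 'n) set)"
    "\<And>a. (\<Sum>(c, s)\<leftarrow>xs. c * (\<Sum>J\<in>B. a J * character J s)) = a I"
    by (rule torus_character_projection[OF B(1,2)]) (rule that)
  define M where "M = (\<Sum>(c, u)\<leftarrow>xs. cmod c * K u)"
  define j where "j = lpair (I + sum_list ms) e"
  \<comment> \<open>For fixed \<open>s\<close>, the log part at \<open>mul u s\<close> is a Laurent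
    polynomial in \<open>u\<close> with coefficients \<open>a J ms * character J (lam s)\<close>;
    the projection extracts the one for \<open>I\<close> and keeps the bound.\<close>
  have le: "cmod (a I ms) * exp (- s * of_int j) \<le> M" if s: "s \<ge> 0" for s
  proof -
    let ?E = "exp (- s * of_int (lpair (sum_list ms) e))"
    have "(\<Sum>(c, u)\<leftarrow>ps. c * log_part v (mul u s) ms) =
        (\<Sum>(c, u)\<leftarrow>ps. c * (\<Sum>J\<in>B. (a J ms * character J (lam s)) * character J u))"
      if "snd ` set ps \<subseteq> torus" for ps
      using that by (induction ps) (auto simp: rep mul char_mul mult_ac)
    from this[OF xs(1)] have "(\<Sum>(c, u)\<leftarrow>xs. c * log_part v (mul u s) ms) = a I ms * character I (lam s)"
      using xs(2)[of "\<lambda>J. a J ms * character J (lam s)"] by simp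
    moreover have "cmod (\<Sum>(c, u)\<leftarrow>ps. c * log_part v (mul u s) ms) * ?E \<le> (\<Sum>(c, u)\<leftarrow>ps. cmod c * K u)"
      if "snd ` set ps \<subseteq> torus" for ps
      using that
    proof (induction ps)
      case (Cons p ps)
      obtain c u where p: "p = (c, u)" by (cases p)
      have "cmod (c * log_part v (mul u s) ms) * ?E \<le> cmod c * K u"
        using mult_left_mono[OF K[of u s], of "cmod c"] Cons.prems s by (simp add: p norm_mult mult.assoc)
      moreover have "cmod (c * log_part v (mul u s) ms + (\<Sum>(c, u)\<leftarrow>ps. c * log_part v (mul u s) ms)) * ?E
          \<le> (cmod (c * log_part v (mul u s) ms) + cmod (\<Sum>(c, u)\<leftarrow>ps. c * log_part v (mul u s) ms)) * ?E"
        by (intro mult_right_mono norm_triangle_ineq) auto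
      ultimately show ?case using Cons by (simp add: p ring_distribs)
    qed simp
    note this[OF xs(1)]
    ultimately have "cmod (a I ms * character I (lam s)) * ?E \<le> M" by (simp add: M_def)
    then show ?thesis
      by (simp add: char_lam norm_mult j_def lpair_add_left ring_distribs mult.assoc flip: exp_add)
  qed
  show "a I ms = 0"
  proof (rule ccontr)
    assume nz: "a I ms \<noteq> 0"
    have "cmod (a I ms) \<le> M" using le[of 0] by simp
    then have "M \<ge> 0" using norm_ge_zero[of "a I ms"] by linarith
    \<comment> \<open>Chosen so that \<open>cmod (a I ms) * (1 + s)\<close> exceeds
      \<open>M\<close>; the exponential is at least \<open>1 + s\<close> because \<open>j\<close> is
      at most -1.\<close>
    define s where "s = M / cmod (a I ms)"
    have "s \<ge> 0" using \<open>M \<ge> 0\<close> by (simp add: s_def)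
    have "j \<le> - 1" using neg by (simp add: j_def e_def)
    then have "s * 1 \<le> s * - of_int j" using \<open>s \<ge> 0\<close> by (intro mult_left_mono) auto
    then have "1 + s \<le> exp (- s * of_int j)"
      using exp_ge_add_one_self[of "- s * of_int j"] by simp
    then have "cmod (a I ms) * (1 + s) \<le> M"
      using le[OF \<open>s \<ge> 0\<close>] mult_left_mono[of "1 + s" "exp (- s * of_int j)" "cmod (a I ms)"] by simp
    then show False using nz by (simp add: s_def ring_distribs)
  qed
qed

section \<open>The field defined by a regular multivector\<close>

text \<open>On the torus this is \<chi>^I times \<open>rho\<close> of \<open>a\<close>. The factors
  are merged into the single character \<open>I + sum_list ms\<close> because at a boundary point
  the value of \<chi>^I alone may have no meaning.\<close>

definition character_field ::
    "'n::finite cone set \<Rightarrow> 'n lat \<Rightarrow> ('n lat list \<Rightarrow> complex) \<Rightarrow> ('n cone \<times> 'n point \<times> 'n lat list \<Rightarrow> complex)" where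
  "character_field \<Delta> I a = (\<lambda>(\<sigma>, x, ms).
     if \<sigma> \<in> \<Delta> \<and> x \<in> affine_chart \<sigma> \<and> set ms \<subseteq> dual_monoid \<sigma> then a ms * x (I + sum_list ms) else 0)"

lemma character_field_linear:
  "character_field \<Delta> I (a + b) = character_field \<Delta> I a + character_field \<Delta> I b"
  "character_field \<Delta> I (cscale c a) = cscale c (character_field \<Delta> I a)"
  "character_field \<Delta> I 0 = 0"
  by (auto simp: character_field_def fun_eq_iff cscale_apply ring_distribs)

lemma character_field_torus:
  assumes "fan \<Delta>" "t \<in> torus"
  shows "character_field \<Delta> I a ({0}, torus_point t, ms) = a ms * character I t * character (sum_list ms) t"
  using fan_zero[OF assms(1)] torus_point_affine_chart[OF assms(2)]
  by (simp add: character_field_def torus_point_def character_add[OF assms(2)])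

lemma log_part_character_field:
  "fan \<Delta> \<Longrightarrow> t \<in> torus \<Longrightarrow> log_part (character_field \<Delta> I a) t ms = a ms * character I t"
  by (simp add: log_part_def character_field_torus character_nonzero)

lemma regular_multivectors_vanish:
  assumes "fan \<Delta>" "a \<in> regular_multivectors \<Delta> k I" "\<sigma> \<in> \<Delta>" "set ms \<subseteq> dual_monoid \<sigma>"
    "I + sum_list ms \<notin> dual_monoid \<sigma>"
  shows "a ms = 0"
proof -
  obtain \<alpha> where \<alpha>: "\<alpha> \<in> rays \<Delta>" "\<alpha> \<subseteq> \<sigma>" "lpair (I + sum_list ms) (prim_gen \<alpha>) < 0"
    using assms(5) fan_dual_monoid_iff[OF assms(1,3)] by force
  have "0 \<le> lpair m (prim_gen \<alpha>)" if "m \<in> set ms" for m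
    using that assms(4) \<alpha>(1,2) fan_dual_monoid_iff[OF assms(1,3)] by blast
  then show ?thesis using assms(2) \<alpha> by (auto simp: regular_multivectors_def)
qed

theorem character_field_holomorphic:
  assumes "fan \<Delta>" "toric_smooth \<Delta>" "a \<in> regular_multivectors \<Delta> k I"
  shows "character_field \<Delta> I a \<in> multivector_fields \<Delta> k"
proof -
  let ?v = "character_field \<Delta> I a"
  have a: "alternating k a"
    "\<And>ms i m m'. length ms = k \<Longrightarrow> i < k \<Longrightarrow> a (ms[i := m + m']) = a (ms[i := m]) + a (ms[i := m'])"
    using assms(3) unfolding regular_multivectors_def ext_power_cpair_iff by blast+
  note vanish = regular_multivectors_vanish[OF assms(1,3)]
  have "(\<lambda>ms. ?v (\<sigma>, x, ms)) \<in> ext_power k (tangent_space \<sigma> x)"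
    if \<sigma>: "\<sigma> \<in> \<Delta>" and x: "x \<in> affine_chart \<sigma>" for \<sigma> x
    unfolding ext_power_tangent_iff[OF assms(2) \<sigma> x]
  proof (intro conjI allI impI)
    show "alternating k (\<lambda>ms. ?v (\<sigma>, x, ms))"
      unfolding alternating_def
    proof (intro conjI allI impI)
      show "?v (\<sigma>, x, ms) = 0" if "length ms \<noteq> k" for ms
        using alternating_length[OF a(1) that] by (simp add: character_field_def)
      fix p and ms :: "'a lat list" assume p: "p permutes {..<k}" "length ms = k"
      then show "?v (\<sigma>, x, permute_list p ms) = of_int (sign p) * ?v (\<sigma>, x, ms)"
        using alternating_permute[OF a(1) p] sum_list_permute[of p ms] set_permute_list[of p ms]
        by (simp add: character_field_def)
    qed
    fix ms :: "'a lat list" and i assume i: "length ms = k" "i < k"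
    \<comment> \<open>Concerns the entries other than slot \<open>i\<close>: if one of them is
      outside the dual monoid, the slot function is identically 0.\<close>
    define rest where "rest \<longleftrightarrow> (\<forall>l<k. l \<noteq> i \<longrightarrow> ms ! l \<in> dual_monoid \<sigma>)"
    have set_upd: "set (ms[i := m]) \<subseteq> dual_monoid \<sigma> \<longleftrightarrow> rest \<and> m \<in> dual_monoid \<sigma>" for m
    proof -
      have "set (ms[i := m]) \<subseteq> dual_monoid \<sigma> \<longleftrightarrow> (\<forall>l<k. ms[i := m] ! l \<in> dual_monoid \<sigma>)"
        using i(1) by (auto simp: set_conv_nth subset_iff)
      then show ?thesis using i by (auto simp: rest_def nth_list_update)
    qed
    define s0 where "s0 = I + sum_list (ms[i := 0])"
    have sum_upd: "I + sum_list (ms[i := m]) = s0 + m" for m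
      using sum_list_update_group[of i ms m] i by (simp add: s0_def add.assoc)
    have val: "?v (\<sigma>, x, ms[i := m]) = (if rest \<and> m \<in> dual_monoid \<sigma> then a (ms[i := m]) * x (s0 + m) else 0)" for m
      using \<sigma> x by (simp add: character_field_def set_upd sum_upd)
    show "(\<lambda>m. ?v (\<sigma>, x, ms[i := m])) \<in> tangent_space \<sigma> x"
      unfolding tangent_space_def
    proof (intro CollectI conjI ballI allI impI)
      show "?v (\<sigma>, x, ms[i := m]) = 0" if "m \<notin> dual_monoid \<sigma>" for m
        using that by (simp add: val)
      fix m m' assume m: "m \<in> dual_monoid \<sigma>" "m' \<in> dual_monoid \<sigma>"
      show "?v (\<sigma>, x, ms[i := m + m']) = x m * ?v (\<sigma>, x, ms[i := m']) + x m' * ?v (\<sigma>, x, ms[i := m])"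
      proof (cases rest)
        case True
        \<comment> \<open>Multiplicativity of \<open>x\<close> needs \<open>s0 + n'\<close> in the
          monoid; when it is not there, the coefficient vanishes by regularity. With this, the
          Leibniz rule reduces to additivity of \<open>a\<close>.\<close>
        have shift: "x n * (a (ms[i := n']) * x (s0 + n')) = a (ms[i := n']) * x (s0 + (n + n'))"
          if n: "n \<in> dual_monoid \<sigma>" "n' \<in> dual_monoid \<sigma>" for n n'
        proof (cases "s0 + n' \<in> dual_monoid \<sigma>")
          case True
          then have "x (n + (s0 + n')) = x n * x (s0 + n')"
            using affine_chartD(2)[OF x n(1)] by blast
          then show ?thesis by (simp add: add.left_commute)
        next
          case False
          then have "a (ms[i := n']) = 0"
            using vanish[OF \<sigma>, of "ms[i := n']"] set_upd[of n'] n(2) \<open>rest\<close> sum_upd[of n'] by simp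
          then show ?thesis by simp
        qed
        have "?v (\<sigma>, x, ms[i := m + m']) = a (ms[i := m + m']) * x (s0 + (m + m'))"
          by (simp only: val True dual_monoid_add[OF m] simp_thms if_True)
        moreover have "x m * ?v (\<sigma>, x, ms[i := m']) = a (ms[i := m']) * x (s0 + (m + m'))"
          by (simp only: val True m simp_thms if_True shift[OF m])
        moreover have "x m' * ?v (\<sigma>, x, ms[i := m]) = a (ms[i := m]) * x (s0 + (m + m'))"
          by (simp only: val True m simp_thms if_True shift[OF m(2,1)] add.commute[of m m'])
        ultimately show ?thesis
          by (simp only: a(2)[OF i] ring_distribs add.commute)
      next
        case False
        then show ?thesis by (simp add: val)
      qed
    qed
  qed
  moreover have "holo_on_chart \<sigma> (\<lambda>x. ?v (\<sigma>, x, ms))" if \<sigma>: "\<sigma> \<in> \<Delta>" "set ms \<subseteq> dual_monoid \<sigma>" for \<sigma> ms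
  proof -
    have "?v (\<sigma>, x, ms) = a ms * x (I + sum_list ms)" if "x \<in> affine_chart \<sigma>" for x
      using that \<sigma> by (simp add: character_field_def)
    then show ?thesis
      using holo_on_chart_monomial[of \<sigma> "a ms" "I + sum_list ms"] unfolding holo_on_chart_def by simp
  qed
  moreover have "?v (\<sigma>, chart_incl \<sigma> x, ms) = ?v (\<tau>, x, ms)"
    if \<sigma>: "\<sigma> \<in> \<Delta>" "\<tau> \<in> \<Delta>" "\<tau> \<subseteq> \<sigma>" and x: "x \<in> affine_chart \<tau>" and ms: "set ms \<subseteq> dual_monoid \<sigma>" for \<sigma> \<tau> x ms
  proof -
    have "set ms \<subseteq> dual_monoid \<tau>" using ms dual_monoid_antimono[OF \<sigma>(3)] by blast
    \<comment> \<open>Where the exponent is in the monoid of \<open>\<tau>\<close> but not in that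
      of \<open>\<sigma>\<close>, \<open>chart_incl\<close> gives 0 and regularity makes the
      coefficient 0.\<close>
    then show ?thesis
      using \<sigma> x ms chart_incl_affine_chart[OF x \<sigma>(3)] vanish[OF \<sigma>(1) ms]
      by (auto simp: character_field_def chart_incl_def)
  qed
  moreover have "?v (\<sigma>, x, ms) = 0" if "\<not> (\<sigma> \<in> \<Delta> \<and> x \<in> affine_chart \<sigma>)" for \<sigma> x ms
    using that by (auto simp: character_field_def)
  ultimately show ?thesis unfolding multivector_fields_def by blast
qed

section \<open>The weight decomposition\<close>

theorem multivector_field_decomposition:
  fixes \<Delta> :: "(real ^ 'n::finite) set set"
  assumes "fan \<Delta>" "\<Union>\<Delta> = UNIV" "toric_smooth \<Delta>" "k \<le> CARD('n)" "v \<in> multivector_fields \<Delta> k"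
  obtains B a where "finite B" "B \<subseteq> S_upto \<Delta> k" "\<And>I. I \<in> B \<Longrightarrow> a I \<in> regular_multivectors \<Delta> k I"
    "v = (\<Sum>I\<in>B. character_field \<Delta> I (a I))"
proof -
  obtain B0 a where B0: "finite B0" "\<And>I. a I \<in> ext_power k (range cpair)"
    "\<And>t ms. t \<in> torus \<Longrightarrow> log_part v t ms = (\<Sum>I\<in>B0. a I ms * character I t)"
    using log_part_expansion[OF assms(1,2,3,5)] by blast
  \<comment> \<open>Zero coefficients are dropped, since only a nonzero regular multivector forces
    its exponent into the polytope with rank at most \<open>k\<close>.\<close>
  define B where "B = {I\<in>B0. a I \<noteq> 0}"
  have finB: "finite B" using B0(1) by (simp add: B_def)
  have reg: "a I \<in> regular_multivectors \<Delta> k I" if "I \<in> B" for I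
    using that by (intro log_part_coefficient_regular[OF assms(1,5) B0(1) _ B0(2) B0(3)]) (auto simp: B_def)
  have sub: "B \<subseteq> S_upto \<Delta> k"
    using regular_multivectors_zero[OF assms(1) reg] S_upto_iff[OF assms(1,4)] by (auto simp: B_def)
  have "v = (\<Sum>I\<in>B. character_field \<Delta> I (a I))"
  proof (rule multivector_fields_eqI[OF assms(1,5) _ assms(3)])
    show "(\<Sum>I\<in>B. character_field \<Delta> I (a I)) \<in> multivector_fields \<Delta> k"
      by (intro cfun.subspace_sum[OF multivector_fields_subspace]
          character_field_holomorphic[OF assms(1,3)] reg)
    fix t :: "complex ^ 'n" and ms assume t: "t \<in> torus"
    have "(\<Sum>I\<in>B0. a I ms * character I t) = (\<Sum>I\<in>B. a I ms * character I t)"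
      using B0(1) by (intro sum.mono_neutral_right) (auto simp: B_def)
    then show "v ({0}, torus_point t, ms) = (\<Sum>I\<in>B. character_field \<Delta> I (a I)) ({0}, torus_point t, ms)"
      using torus_value_log_part[OF t, of v ms] B0(3)[OF t, of ms]
      by (simp add: sum_fun_apply character_field_torus[OF assms(1) t] sum_distrib_right)
  qed
  then show thesis using that finB sub reg by blast
qed

text \<open>Cancelling the common factor \<open>character (sum_list ms) t\<close> leaves, for each
  \<open>ms\<close>, a linear relation between distinct characters.\<close>

lemma character_field_sum_eq_0:
  assumes "fan \<Delta>" "finite B"
    and "\<And>t ms. t \<in> torus \<Longrightarrow> (\<Sum>I\<in>B. character_field \<Delta> I (a I) ({0}, torus_point t, ms)) = 0" "I \<in> B"
  shows "a I = 0"
proof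
  fix ms
  have "(\<Sum>J\<in>B. a J ms * character J t) = 0" if t: "t \<in> torus" for t
    using assms(3)[OF t, of ms] character_nonzero[OF t]
    by (simp add: character_field_torus[OF assms(1) t] flip: sum_distrib_right)
  then show "a I ms = 0 ms"
    using character_independent[OF assms(2) _ assms(4), of "\<lambda>J. a J ms"] by simp
qed

section \<open>Restriction to the torus, and weight spaces\<close>

lemma restrict_torus_apply: "restrict_torus v (x, ms) = v ({0}, x, ms)"
  by (simp add: restrict_torus_def)

lemma restrict_torus_linear:
  "restrict_torus (u + v) = restrict_torus u + restrict_torus v"
  "restrict_torus (cscale c v) = cscale c (restrict_torus v)"
  "restrict_torus 0 = 0"
  by (auto simp: restrict_torus_def fun_eq_iff cscale_apply)

lemma restrict_torus_sum: "restrict_torus (\<Sum>i\<in>B. f i) = (\<Sum>i\<in>B. restrict_torus (f i))"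
  by (auto simp: fun_eq_iff restrict_torus_def sum_fun_apply)

lemma restrict_torus_image_subspace:
  assumes "cfun.subspace S"
  shows "cfun.subspace (restrict_torus ` S)"
  unfolding cfun_subspace_alt
proof (intro conjI ballI allI)
  show "0 \<in> restrict_torus ` S"
    using cfun.subspace_0[OF assms] restrict_torus_linear(3) by (metis image_eqI)
  fix f c assume "f \<in> restrict_torus ` S"
  then obtain u where u: "u \<in> S" "f = restrict_torus u" by blast
  then show "cscale c f \<in> restrict_torus ` S"
    using cfun.subspace_scale[OF assms u(1), of c] by (metis image_eqI restrict_torus_linear(2))
  fix g assume "g \<in> restrict_torus ` S"
  then obtain v where v: "v \<in> S" "g = restrict_torus v" by blast
  then show "f + g \<in> restrict_torus ` S"
    using cfun.subspace_add[OF assms u(1) v(1)] u(2) by (metis image_eqI restrict_torus_linear(1))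
qed

lemma character_field_image_subspace:
  "cfun.subspace (character_field \<Delta> I ` regular_multivectors \<Delta> k I)"
  unfolding cfun_subspace_alt
proof (intro conjI ballI allI)
  note S = regular_multivectors_subspace[of \<Delta> k I]
  show "0 \<in> character_field \<Delta> I ` regular_multivectors \<Delta> k I"
    using cfun.subspace_0[OF S] character_field_linear(3) by (metis image_eqI)
  fix f c assume "f \<in> character_field \<Delta> I ` regular_multivectors \<Delta> k I"
  then obtain u where u: "u \<in> regular_multivectors \<Delta> k I" "f = character_field \<Delta> I u" by blast
  then show "cscale c f \<in> character_field \<Delta> I ` regular_multivectors \<Delta> k I"
    using cfun.subspace_scale[OF S u(1), of c] by (metis image_eqI character_field_linear(2))
  fix g assume "g \<in> character_field \<Delta> I ` regular_multivectors \<Delta> k I"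
  then obtain v where v: "v \<in> regular_multivectors \<Delta> k I" "g = character_field \<Delta> I v" by blast
  then show "f + g \<in> character_field \<Delta> I ` regular_multivectors \<Delta> k I"
    using cfun.subspace_add[OF S u(1) v(1)] u(2) by (metis image_eqI character_field_linear(1))
qed

text \<open>On the torus, \<open>rho\<close> contributes the product of the values
  \<open>x m\<close>, that is, the character of \<open>sum_list ms\<close>; multiplying by
  \<open>x I\<close> gives the restriction of \<open>character_field\<close>.\<close>

lemma V_space_eq:
  fixes \<Delta> :: "(real ^ 'n::finite) set set"
  assumes "fan \<Delta>" "k \<le> CARD('n)" "I \<in> S_upto \<Delta> k"
  shows "V_space \<Delta> k I = restrict_torus ` character_field \<Delta> I ` regular_multivectors \<Delta> k I"
proof -
  have I: "rvec I \<in> polytope_of \<Delta>" "codim_of \<Delta> I \<le> k"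
    using assms(3) codim_of_eq[OF assms(1)] unfolding S_upto_iff[OF assms(1,2)] by auto
  have "(\<lambda>(x, ms). x I * restrict_torus (rho \<Delta> a) (x, ms)) = restrict_torus (character_field \<Delta> I a)" for a
  proof (intro ext, clarify)
    fix x :: "'n point" and ms
    show "x I * restrict_torus (rho \<Delta> a) (x, ms) = restrict_torus (character_field \<Delta> I a) (x, ms)"
    proof (cases "x \<in> affine_chart {0}")
      case True
      then obtain t where t: "t \<in> torus" "x = torus_point t" by (rule affine_chart_zero_cone)
      have "x I = character I t" "(\<Prod>m\<leftarrow>ms. x m) = character (sum_list ms) t"
        by (simp_all add: t torus_point_def character_sum_list)
      moreover have "character_field \<Delta> I a ({0}, x, ms) = a ms * character I t * character (sum_list ms) t"
        unfolding t(2) by (rule character_field_torus[OF assms(1) t(1)])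
      ultimately show ?thesis
        using True fan_zero[OF assms(1)] by (simp add: restrict_torus_apply rho_def)
    next
      case False
      then show ?thesis by (simp add: restrict_torus_apply rho_def character_field_def)
    qed
  qed
  then show ?thesis
    unfolding V_space_def W_space_def N_space_eq_regular[OF assms(1) I] image_image by simp
qed

lemma torus_act_affine_chart:
  assumes "t \<in> torus" "x \<in> affine_chart \<sigma>"
  shows "torus_act t x \<in> affine_chart \<sigma>"
  using assms(2) by (auto simp: affine_chart_def torus_act_def character_add[OF assms(1)])

text \<open>The product over \<open>ms\<close> cancels against the same characters at the inverse of
  \<open>t\<close>, since the frame is invariant. What remains is \<chi>^I at the inverse of
  \<open>t\<close>, hence the weight \<open>- I\<close>.\<close>

lemma push_forward_character_field:
  assumes t: "t \<in> torus"
  shows "push_forward t (character_field \<Delta> I a) = cscale (character (- I) t) (character_field \<Delta> I a)"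
proof (intro ext, clarify)
  fix \<sigma> x and ms :: "'a lat list"
  let ?s = "\<chi> i. inverse (t $ i)"
  have s: "?s \<in> torus" by (rule torus_inverse[OF t])
  have "torus_act t (torus_act ?s x) = x"
    using character_nonzero[OF t] by (auto simp: torus_act_def character_inverse)
  then have iff: "torus_act ?s x \<in> affine_chart \<sigma> \<longleftrightarrow> x \<in> affine_chart \<sigma>"
    using torus_act_affine_chart[OF t] torus_act_affine_chart[OF s] by metis
  have "(\<Prod>m\<leftarrow>ms. character m t) * torus_act ?s x (I + sum_list ms) = character (- I) t * x (I + sum_list ms)"
    unfolding torus_act_def character_inverse character_add[OF t] character_minus
      character_sum_list[OF t, symmetric]
    using character_nonzero[OF t] by (simp add: field_simps)
  then show "push_forward t (character_field \<Delta> I a) (\<sigma>, x, ms) =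
      cscale (character (- I) t) (character_field \<Delta> I a) (\<sigma>, x, ms)"
    by (simp add: push_forward_def character_field_def iff cscale_apply mult.left_commute)
qed

text \<open>The torus acts transitively on its open orbit, so a weight vector is determined by its
  value at the identity: its log part is that value times the character of \<open>I\<close>.
  Regularity of the value is the case of a single exponent.\<close>

theorem weight_space_eq:
  fixes \<Delta> :: "(real ^ 'n::finite) set set"
  assumes "fan \<Delta>" "toric_smooth \<Delta>"
  shows "weight_space \<Delta> k (- I) = character_field \<Delta> I ` regular_multivectors \<Delta> k I"
proof
  show "character_field \<Delta> I ` regular_multivectors \<Delta> k I \<subseteq> weight_space \<Delta> k (- I)"
    using character_field_holomorphic[OF assms] push_forward_character_field
    by (auto simp: weight_space_def)
  show "weight_space \<Delta> k (- I) \<subseteq> character_field \<Delta> I ` regular_multivectors \<Delta> k I"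
  proof
    fix v assume "v \<in> weight_space \<Delta> k (- I)"
    then have v: "v \<in> multivector_fields \<Delta> k"
      and weight: "\<And>t. t \<in> torus \<Longrightarrow> push_forward t v = cscale (character (- I) t) v"
      by (auto simp: weight_space_def)
    define a where "a = log_part v (\<chi> i. 1)"
    have rep: "log_part v t ms = a ms * character I t" if t: "t \<in> torus" for t ms
    proof -
      have "torus_act (\<chi> i. inverse (t $ i)) (torus_point t) = torus_point (\<chi> i. 1)"
        using character_nonzero[OF t] by (auto simp: torus_act_def torus_point_def character_inverse)
      then have "character (sum_list ms) t * v ({0}, torus_point (\<chi> i. 1), ms) =
          character (- I) t * v ({0}, torus_point t, ms)"
        using fun_cong[OF weight[OF t], of "({0}, torus_point t, ms)"]
        by (simp add: push_forward_def cscale_apply flip: character_sum_list[OF t])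
      then show ?thesis
        using character_nonzero[OF t]
        by (simp add: a_def log_part_def character_minus field_simps)
    qed
    have "a \<in> ext_power k (range cpair)"
      unfolding a_def by (rule log_part_ext_power[OF assms v torus_one])
    then have a: "a \<in> regular_multivectors \<Delta> k I"
      using log_part_coefficient_regular[OF assms(1) v, of "{I}" I "\<lambda>_. a"] rep by simp
    have "v = character_field \<Delta> I a"
      by (rule multivector_fields_eqI[OF assms(1) v character_field_holomorphic[OF assms a] assms(2)])
        (simp add: torus_value_log_part rep log_part_character_field[OF assms(1)])
    then show "v \<in> character_field \<Delta> I ` regular_multivectors \<Delta> k I" using a by blast
  qed
qed

section \<open>Bases and dimensions\<close>

lemma independent_family:
  assumes "finite X" and indep: "\<And>c. (\<Sum>x\<in>X. cscale (c x) (\<beta> x)) = 0 \<Longrightarrow> \<forall>x\<in>X. c x = 0"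
  shows "inj_on \<beta> X" "cfun.independent (\<beta> ` X)"
proof -
  show inj: "inj_on \<beta> X"
  proof (rule inj_onI, rule ccontr)
    fix x y assume xy: "x \<in> X" "y \<in> X" "\<beta> x = \<beta> y" "x \<noteq> y"
    define c :: "_ \<Rightarrow> complex" where "c z = (if z = x then 1 else if z = y then - 1 else 0)" for z
    have "(\<Sum>z\<in>X. cscale (c z) (\<beta> z)) w = 0" for w
    proof -
      have "(\<Sum>z\<in>X. c z * \<beta> z w) = (\<Sum>z\<in>{x, y}. c z * \<beta> z w)"
        using assms(1) xy by (intro sum.mono_neutral_right) (auto simp: c_def)
      then show ?thesis using xy by (simp add: sum_fun_apply cscale_apply c_def)
    qed
    then have "(\<Sum>z\<in>X. cscale (c z) (\<beta> z)) = 0" by (intro ext) simp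
    from indep[OF this] show False using xy by (auto simp: c_def)
  qed
  show "cfun.independent (\<beta> ` X)"
  proof
    assume "cfun.dependent (\<beta> ` X)"
    then obtain u x where u: "x \<in> X" "u (\<beta> x) \<noteq> 0" "(\<Sum>v\<in>\<beta> ` X. cscale (u v) v) = 0"
      unfolding cfun.dependent_finite[OF finite_imageI[OF assms(1)]] by blast
    have "(\<Sum>x\<in>X. cscale (u (\<beta> x)) (\<beta> x)) = 0"
      using u(3) unfolding sum.reindex[OF inj] o_def .
    from indep[OF this] show False using u by blast
  qed
qed

theorem multivector_fields_basis:
  fixes \<Delta> :: "(real ^ 'n::finite) set set"
  assumes "fan \<Delta>" "\<Union>\<Delta> = UNIV" "toric_smooth \<Delta>" "k \<le> CARD('n)"
  obtains B where "finite B" "cfun.independent B" "cfun.span B = multivector_fields \<Delta> k"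
    "card B = (\<Sum>I\<in>S_upto \<Delta> k. (CARD('n) - lattice_rank \<Delta> I) choose (k - lattice_rank \<Delta> I))"
proof -
  have I: "rvec I \<in> polytope_of \<Delta>" "codim_of \<Delta> I = lattice_rank \<Delta> I" "lattice_rank \<Delta> I \<le> k"
    if "I \<in> S_upto \<Delta> k" for I
    using that codim_of_eq[OF assms(1)] unfolding S_upto_iff[OF assms(1,4)] by auto
  have finS: "finite (S_upto \<Delta> k)"
    using finite_polytope_lattice_points[OF assms(1,2)] I(1) by (rule_tac finite_subset) auto
  \<comment> \<open>The bases for all lattice points are packed into one predicate so that
    \<open>X\<close>, \<open>w\<close> and \<open>p\<close> can be chosen for all of them at
    once.\<close>
  define Q where "Q J Y w p \<longleftrightarrow> finite Y \<and>
      card Y = (CARD('n) - lattice_rank \<Delta> J) choose (k - lattice_rank \<Delta> J) \<and>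
      (\<forall>K\<in>Y. w K \<in> regular_multivectors \<Delta> k J) \<and>
      (\<forall>K\<in>Y. \<forall>K'\<in>Y. w K (p K') = (if K = K' then 1 else 0)) \<and>
      (\<forall>a\<in>regular_multivectors \<Delta> k J. a = (\<Sum>K\<in>Y. cscale (a (p K)) (w K)))"
    for J and Y :: "nat set set" and w p
  have "\<exists>Y w p. Q J Y w p" if J: "J \<in> S_upto \<Delta> k" for J
  proof -
    have rank: "codim_of \<Delta> J \<le> k" using I(2,3)[OF J] by simp
    obtain Y :: "nat set set" and w p where "finite Y"
      "card Y = (CARD('n) - codim_of \<Delta> J) choose (k - codim_of \<Delta> J)"
      "\<And>K. K \<in> Y \<Longrightarrow> w K \<in> N_space \<Delta> k J"
      "\<And>K K'. K \<in> Y \<Longrightarrow> K' \<in> Y \<Longrightarrow> w K (p K') = (if K = K' then 1 else 0)"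
      "\<And>a. a \<in> regular_multivectors \<Delta> k J \<Longrightarrow> a = (\<Sum>K\<in>Y. cscale (a (p K)) (w K))"
      by (rule regular_multivectors_basis[OF assms(1) I(1)[OF J] rank]) (rule that)
    note Y = this[unfolded I(2)[OF J] N_space_eq_regular[OF assms(1) I(1)[OF J] rank]]
    have "Q J Y w p"
      unfolding Q_def by (intro conjI ballI) (rule Y; assumption)+
    then show ?thesis by blast
  qed
  then obtain X w p where Q: "\<And>I. I \<in> S_upto \<Delta> k \<Longrightarrow> Q I (X I) (w I) (p I)" by metis
  have X: "finite (X I)" "card (X I) = (CARD('n) - lattice_rank \<Delta> I) choose (k - lattice_rank \<Delta> I)"
    "\<And>K. K \<in> X I \<Longrightarrow> w I K \<in> regular_multivectors \<Delta> k I"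
    "\<And>K K'. K \<in> X I \<Longrightarrow> K' \<in> X I \<Longrightarrow> w I K (p I K') = (if K = K' then 1 else 0)"
    "\<And>a. a \<in> regular_multivectors \<Delta> k I \<Longrightarrow> a = (\<Sum>K\<in>X I. cscale (a (p I K)) (w I K))"
    if "I \<in> S_upto \<Delta> k" for I
    using Q[OF that] unfolding Q_def by blast+
  define \<beta> where "\<beta> = (\<lambda>(I, K). character_field \<Delta> I (w I K))"
  let ?X = "SIGMA I:S_upto \<Delta> k. X I"
  have finX: "finite ?X" using finS X(1) by blast
  have sum_field: "character_field \<Delta> I (\<Sum>K\<in>Y. cscale (c K) (w I K)) =
      (\<Sum>K\<in>Y. cscale (c K) (character_field \<Delta> I (w I K)))" for I c Y
  proof (intro ext, clarify)
    fix \<sigma> x and ms :: "'n lat list"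
    show "character_field \<Delta> I (\<Sum>K\<in>Y. cscale (c K) (w I K)) (\<sigma>, x, ms) =
        (\<Sum>K\<in>Y. cscale (c K) (character_field \<Delta> I (w I K))) (\<sigma>, x, ms)"
    proof (cases "\<sigma> \<in> \<Delta> \<and> x \<in> affine_chart \<sigma> \<and> set ms \<subseteq> dual_monoid \<sigma>")
      case True
      then show ?thesis
        by (simp add: character_field_def sum_fun_apply cscale_apply sum_distrib_right mult.assoc)
    next
      case False
      then show ?thesis
        by (simp only: character_field_def sum_fun_apply cscale_apply prod.case if_False
            mult_zero_right sum.neutral_const)
    qed
  qed
  have indep: "\<forall>x\<in>?X. c x = 0" if zero: "(\<Sum>x\<in>?X. cscale (c x) (\<beta> x)) = 0" for c
  proof
    fix x assume "x \<in> ?X"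
    then obtain I K where x: "x = (I, K)" "I \<in> S_upto \<Delta> k" "K \<in> X I" by blast
    define a where "a I = (\<Sum>K\<in>X I. cscale (c (I, K)) (w I K))" for I
    have "(\<Sum>x\<in>?X. cscale (c x) (\<beta> x)) = (\<Sum>I\<in>S_upto \<Delta> k. \<Sum>K\<in>X I. cscale (c (I, K)) (\<beta> (I, K)))"
      using finS X(1) by (subst sum.Sigma) (auto simp: case_prod_unfold)
    also have "\<dots> = (\<Sum>I\<in>S_upto \<Delta> k. character_field \<Delta> I (a I))"
      by (simp add: a_def \<beta>_def sum_field)
    finally have "(\<Sum>I\<in>S_upto \<Delta> k. character_field \<Delta> I (a I)) = 0" using zero by simp
    then have "(\<Sum>I\<in>S_upto \<Delta> k. character_field \<Delta> I (a I) y) = 0" for y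
      by (metis sum_fun_apply zero_fun_apply)
    then have "a I = 0"
      by (intro character_field_sum_eq_0[OF assms(1) finS _ x(2)]) blast
    then have "a I (p I K) = 0" by simp
    \<comment> \<open>By duality, evaluation at \<open>p I K\<close> reads off the coefficient of
      \<open>w I K\<close>.\<close>
    moreover have "a I (p I K) = (\<Sum>K'\<in>X I. if K' = K then c (I, K') else 0)"
      unfolding a_def sum_fun_apply cscale_apply using X(4)[OF x(2) _ x(3)] by (intro sum.cong) auto
    ultimately show "c x = 0" using X(1)[OF x(2)] x by simp
  qed
  note basis = independent_family[OF finX indep]
  have "cfun.span (\<beta> ` ?X) = multivector_fields \<Delta> k"
  proof
    have "\<beta> ` ?X \<subseteq> multivector_fields \<Delta> k"
      using X(3) character_field_holomorphic[OF assms(1,3)] by (auto simp: \<beta>_def)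
    then show "cfun.span (\<beta> ` ?X) \<subseteq> multivector_fields \<Delta> k"
      by (rule cfun.span_minimal[OF _ multivector_fields_subspace])
    show "multivector_fields \<Delta> k \<subseteq> cfun.span (\<beta> ` ?X)"
    proof
      fix v assume v: "v \<in> multivector_fields \<Delta> k"
      obtain B a where B: "finite B" "B \<subseteq> S_upto \<Delta> k" "\<And>I. I \<in> B \<Longrightarrow> a I \<in> regular_multivectors \<Delta> k I"
        "v = (\<Sum>I\<in>B. character_field \<Delta> I (a I))"
        using multivector_field_decomposition[OF assms v] by blast
      have "character_field \<Delta> I (a I) \<in> cfun.span (\<beta> ` ?X)" if J: "I \<in> B" for I
      proof -
        have S: "I \<in> S_upto \<Delta> k" using J B(2) by blast
        have "character_field \<Delta> I (a I) = (\<Sum>K\<in>X I. cscale (a I (p I K)) (character_field \<Delta> I (w I K)))"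
          by (subst X(5)[OF S B(3)[OF J]]) (rule sum_field)
        also have "\<dots> \<in> cfun.span (\<beta> ` ?X)"
        proof (intro cfun.span_sum cfun.span_scale cfun.span_base)
          fix K assume "K \<in> X I"
          then show "character_field \<Delta> I (w I K) \<in> \<beta> ` ?X"
            using S by (intro image_eqI[of _ _ "(I, K)"]) (auto simp: \<beta>_def)
        qed
        finally show ?thesis .
      qed
      then show "v \<in> cfun.span (\<beta> ` ?X)" unfolding B(4) by (rule cfun.span_sum)
    qed
  qed
  moreover have "card (\<beta> ` ?X) = (\<Sum>I\<in>S_upto \<Delta> k. card (X I))"
    using card_image[OF basis(1)] finS X(1) by (simp add: card_SigmaI)
  then have "card (\<beta> ` ?X) = (\<Sum>I\<in>S_upto \<Delta> k. (CARD('n) - lattice_rank \<Delta> I) choose (k - lattice_rank \<Delta> I))"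
    using X(2) by simp
  ultimately show thesis using that finX basis(2) by blast
qed

text \<open>The lattice points are grouped by rank; those of rank \<open>i\<close> are partitioned
  by the relative interiors of the faces of codimension \<open>i\<close>.\<close>

lemma sum_S_upto:
  fixes \<Delta> :: "(real ^ 'n::finite) set set"
  assumes "fan \<Delta>" "\<Union>\<Delta> = UNIV" "k \<le> CARD('n)"
  shows "(\<Sum>I\<in>S_upto \<Delta> k. g (lattice_rank \<Delta> I)) =
    (\<Sum>i\<in>{0..k}. \<Sum>F\<in>polytope_faces \<Delta> (CARD('n) - i). g i * card (int_lattice F))"
proof -
  have codim: "I \<in> codim_lattice \<Delta> i \<longleftrightarrow> rvec I \<in> polytope_of \<Delta> \<and> lattice_rank \<Delta> I = i" if "i \<in> {0..k}" for i I
    using codim_lattice_iff[OF assms(1), of i I] that assms(3) by simp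
  have fin: "finite (codim_lattice \<Delta> i)" if "i \<in> {0..k}" for i
    using finite_polytope_lattice_points[OF assms(1,2)] by (rule finite_subset[rotated]) (use codim[OF that] in blast)
  have "(\<Sum>I\<in>S_upto \<Delta> k. g (lattice_rank \<Delta> I)) = (\<Sum>i\<in>{0..k}. \<Sum>I\<in>codim_lattice \<Delta> i. g (lattice_rank \<Delta> I))"
    unfolding S_upto_def by (rule sum.UNION_disjoint) (use fin codim in auto)
  also have "\<dots> = (\<Sum>i\<in>{0..k}. g i * card (codim_lattice \<Delta> i))"
  proof (rule sum.cong[OF refl])
    fix i assume i: "i \<in> {0..k}"
    have "(\<Sum>I\<in>codim_lattice \<Delta> i. g (lattice_rank \<Delta> I)) = (\<Sum>I\<in>codim_lattice \<Delta> i. g i)"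
      using codim[OF i] by (intro sum.cong) auto
    then show "(\<Sum>I\<in>codim_lattice \<Delta> i. g (lattice_rank \<Delta> I)) = g i * card (codim_lattice \<Delta> i)"
      by simp
  qed
  also have "\<dots> = (\<Sum>i\<in>{0..k}. g i * (\<Sum>F\<in>polytope_faces \<Delta> (CARD('n) - i). card (int_lattice F)))"
    by (simp only: codim_lattice_def sum_card_int_lattice[OF assms(1,2)])
  finally show ?thesis by (simp add: sum_distrib_left)
qed

theorem theoremA:
  fixes \<Delta> :: "(real ^ 'n) set set" and k :: nat
  assumes "fan \<Delta>"
    and "toric_smooth \<Delta>"
    and "compact_space (toric_topology \<Delta>)"
    and "k \<le> CARD('n)"
  shows
    "(inj_on restrict_torus (multivector_fields \<Delta> k) \<and>
      internal_direct_sum (restrict_torus ` multivector_fields \<Delta> k) (S_upto \<Delta> k) (V_space \<Delta> k) \<and>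
      (\<forall>I\<in>S_upto \<Delta> k. V_space \<Delta> k I = restrict_torus ` weight_space \<Delta> k (- I)))
     \<and>
     ((\<exists>B. finite B \<and> cfun.span B = multivector_fields \<Delta> k) \<and>
      cfun.dim (multivector_fields \<Delta> k) =
        (\<Sum>i\<in>{0..k}. \<Sum>F\<in>polytope_faces \<Delta> (CARD('n) - i).
           ((CARD('n) - i) choose (k - i)) * card (int_lattice F)))"
proof (intro conjI)
  have complete: "\<Union>\<Delta> = UNIV" by (rule compact_fan_complete[OF assms(1,3)])
  note V = V_space_eq[OF assms(1,4)]
  show "inj_on restrict_torus (multivector_fields \<Delta> k)"
  proof (rule inj_onI)
    fix u v assume uv: "u \<in> multivector_fields \<Delta> k" "v \<in> multivector_fields \<Delta> k"
      "restrict_torus u = restrict_torus v"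
    have "u ({0}, x, ms) = v ({0}, x, ms)" for x ms
      using uv(3) by (metis restrict_torus_apply)
    then show "u = v"
      by (intro multivector_fields_eqI[OF assms(1) uv(1,2) assms(2)])
  qed
  show "\<forall>I\<in>S_upto \<Delta> k. V_space \<Delta> k I = restrict_torus ` weight_space \<Delta> k (- I)"
    by (simp add: V weight_space_eq[OF assms(1,2)])
  let ?H = "multivector_fields \<Delta> k"
  have V_sub: "V_space \<Delta> k I \<subseteq> restrict_torus ` ?H" if "I \<in> S_upto \<Delta> k" for I
    unfolding V[OF that] using character_field_holomorphic[OF assms(1,2)] by blast
  show "internal_direct_sum (restrict_torus ` ?H) (S_upto \<Delta> k) (V_space \<Delta> k)"
    unfolding internal_direct_sum_def
  proof (intro conjI ballI allI impI)
    show "cfun.subspace (V_space \<Delta> k I)" if "I \<in> S_upto \<Delta> k" for I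
      unfolding V[OF that] by (intro restrict_torus_image_subspace character_field_image_subspace)
    show "restrict_torus ` ?H = cfun.span (\<Union>I\<in>S_upto \<Delta> k. V_space \<Delta> k I)"
    proof
      show "cfun.span (\<Union>I\<in>S_upto \<Delta> k. V_space \<Delta> k I) \<subseteq> restrict_torus ` ?H"
        using V_sub by (intro cfun.span_minimal restrict_torus_image_subspace multivector_fields_subspace) blast
      show "restrict_torus ` ?H \<subseteq> cfun.span (\<Union>I\<in>S_upto \<Delta> k. V_space \<Delta> k I)"
      proof
        fix f assume "f \<in> restrict_torus ` ?H"
        then obtain v where v: "v \<in> ?H" "f = restrict_torus v" by blast
        obtain B a where B: "finite B" "B \<subseteq> S_upto \<Delta> k" "\<And>I. I \<in> B \<Longrightarrow> a I \<in> regular_multivectors \<Delta> k I"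
          "v = (\<Sum>I\<in>B. character_field \<Delta> I (a I))"
          using multivector_field_decomposition[OF assms(1) complete assms(2,4) v(1)] by blast
        have "restrict_torus (character_field \<Delta> I (a I)) \<in> (\<Union>I\<in>S_upto \<Delta> k. V_space \<Delta> k I)" if "I \<in> B" for I
          using that B(2,3) V[of I] by blast
        then show "f \<in> cfun.span (\<Union>I\<in>S_upto \<Delta> k. V_space \<Delta> k I)"
          unfolding v(2) B(4) restrict_torus_sum by (intro cfun.span_sum cfun.span_base)
      qed
    qed
    fix B f I
    assume "finite B \<and> B \<subseteq> S_upto \<Delta> k \<and> (\<forall>I\<in>B. f I \<in> V_space \<Delta> k I) \<and> (\<Sum>I\<in>B. f I) = 0"
    then have B: "finite B" "B \<subseteq> S_upto \<Delta> k" "\<And>I. I \<in> B \<Longrightarrow> f I \<in> V_space \<Delta> k I" "(\<Sum>I\<in>B. f I) = 0"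
      by auto
    assume I: "I \<in> B"
    \<comment> \<open>Elements of \<open>V_space\<close> are restrictions of global fields, so a
      relation between them can be tested on the torus, where distinct characters are
      independent.\<close>
    have "\<exists>a. f I = restrict_torus (character_field \<Delta> I a)" if "I \<in> B" for I
      using B(3)[OF that] V[of I] B(2) that by blast
    then obtain a where a: "\<And>I. I \<in> B \<Longrightarrow> f I = restrict_torus (character_field \<Delta> I (a I))" by metis
    have "(\<Sum>I\<in>B. character_field \<Delta> I (a I) ({0}, x, ms)) = 0" for x ms
    proof -
      have "(\<Sum>I\<in>B. f I (x, ms)) = 0" using B(4) by (metis sum_fun_apply zero_fun_apply)
      then show ?thesis by (simp add: a restrict_torus_apply)
    qed
    then have "a I = 0"
      by (intro character_field_sum_eq_0[OF assms(1) B(1) _ I]) blast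
    then show "f I = 0" using a[OF I] by (simp add: character_field_linear restrict_torus_linear)
  qed
  obtain B where B: "finite B" "cfun.independent B" "cfun.span B = ?H"
    "card B = (\<Sum>I\<in>S_upto \<Delta> k. (CARD('n) - lattice_rank \<Delta> I) choose (k - lattice_rank \<Delta> I))"
    by (rule multivector_fields_basis[OF assms(1) complete assms(2,4)])
  then show "\<exists>B. finite B \<and> cfun.span B = ?H" by blast
  have "cfun.dim ?H = card B"
    using cfun.dim_span_eq_card_independent[OF B(2)] B(3) by simp
  then show "cfun.dim ?H = (\<Sum>i\<in>{0..k}. \<Sum>F\<in>polytope_faces \<Delta> (CARD('n) - i).
      ((CARD('n) - i) choose (k - i)) * card (int_lattice F))"
    using B(4) sum_S_upto[OF assms(1) complete assms(4), of "\<lambda>i. (CARD('n) - i) choose (k - i)"] by simp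
qed

end
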